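(* Let $a>1$, $b>0$, and let $\psi\in L^2(\mathbb{R})$ be such that $\{D_{a^j}T_{kb}\psi\}_{j,k\in\mathbb{Z}}$ is a frame for $L^2(\mathbb{R})$ with lower frame bound $A>0$. Assume that for some constants $C>0$ and $\sigma>0$, $$|\widehat{\psi}(\gamma)|\le \frac{C}{1+|\gamma|^{1+\sigma}},\qquad \gamma\in\mathbb{R}.$$ Given $K\in\mathbb{N}$, let $N$ denote the unique odd integer such that $N-2\le 2bK<N$, let $\psi_K\in L^2(\mathbb{R})$ be defined by $\widehat{\psi_K}:=\widehat{\psi}\,\chi_{[-K,K]}$, and define the function $\widetilde{\psi_K}$ by $$\widehat{\widetilde{\psi_K}}(\gamma)=\frac{b\,\widehat{\psi_K}(\gamma)}{N\sum_{k\in\mathbb{Z}}|\widehat{\psi_K}(a^k\gamma)|^2}.$$ Let $$\varepsilon_K:=\left(\frac{K+1/b}{K^{3+2\sigma}}\right)^{1/2}2C\left[\left(1+\frac{1}{2\sigma}\right)\frac{a^{1+\sigma}}{a^{1+\sigma}-1}\right]^{1/2}.$$ Then for every $K\in\mathbb{N}$ large enough that $\varepsilon_K<\sqrt{2bA}$, $$\left\|f-\sum_{j,k\in\mathbb{Z}}\langle f,D_{a^j}T_{kb/N}\widetilde{\psi_K}\rangle D_{a^j}T_{kb/N}\psi\right\|\le\frac{\varepsilon_K}{\sqrt{2bA}-\varepsilon_K}\,\|f\|,\qquad\forall f\in L^2(\mathbb{R}).$$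
   Context: For $a>0$ and $b\in\mathbb{R}$, the scaling and translation operators on $L^2(\mathbb{R})$ are $D_af(x)=a^{1/2}f(ax)$ and $T_bf(x)=f(x-b)$; thus $D_{a^j}T_{kb}\psi(x)=a^{j/2}\psi(a^jx-kb)$. The Fourier transform is normalized by $\widehat{f}(\gamma)=\int_{\mathbb{R}}f(x)e^{-2\pi i x\gamma}\,dx$ for $f\in L^1(\mathbb{R})\cap L^2(\mathbb{R})$, extended unitarily to $L^2(\mathbb{R})$. $\chi_E$ is the indicator function of $E$. A sequence $\{f_k\}_{k\in I}$ in a Hilbert space $\mathcal{H}$, with $I$ countable, is a frame if there are constants $A,B>0$ (lower and upper frame bounds) with $A\|f\|^2\le\sum_{k\in I}|\langle f,f_k\rangle|^2\le B\|f\|^2$ for all $f\in\mathcal{H}$. Inner products are linear in the first entry. Identities between Fourier transforms are understood almost everywhere, and the quotient defining $\widehat{\widetilde{\psi_K}}$ is taken as $0$ where $\widehat{\psi_K}$ vanishes. *)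

theory Defs
  imports "HOL-Analysis.Analysis"
begin

text \<open>
  Elements of \<open>L\<^sup>2(\<real>)\<close> are handled through Borel representatives; all notions below are
  insensitive to changes on null sets.
\<close>

definition L2 :: "(real \<Rightarrow> complex) set" where
  "L2 = {f. f \<in> borel_measurable lborel \<and> integrable lborel (\<lambda>x. (cmod (f x))\<^sup>2)}"

definition inner_L2 :: "(real \<Rightarrow> complex) \<Rightarrow> (real \<Rightarrow> complex) \<Rightarrow> complex" where
  "inner_L2 f g = (LINT x|lborel. f x * cnj (g x))"

definition norm_L2 :: "(real \<Rightarrow> complex) \<Rightarrow> real" where
  "norm_L2 f = sqrt (LINT x|lborel. (cmod (f x))\<^sup>2)"

text \<open>
  The membership clauses exclude the junk value \<open>0\<close> that the Bochner integral assigns to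
  non-integrable functions.
\<close>

definition tendsto_L2 ::
    "('i \<Rightarrow> real \<Rightarrow> complex) \<Rightarrow> (real \<Rightarrow> complex) \<Rightarrow> 'i filter \<Rightarrow> bool" where
  "tendsto_L2 u f F \<longleftrightarrow>
     f \<in> L2 \<and> (\<forall>\<^sub>F i in F. u i \<in> L2) \<and> ((\<lambda>i. norm_L2 (\<lambda>x. u i x - f x)) \<longlongrightarrow> 0) F"

text \<open>Unconditional convergence of a series in \<open>L\<^sup>2(\<real>)\<close>.\<close>

definition has_sum_L2 ::
    "('i \<Rightarrow> real \<Rightarrow> complex) \<Rightarrow> 'i set \<Rightarrow> (real \<Rightarrow> complex) \<Rightarrow> bool" where
  "has_sum_L2 u I g \<longleftrightarrow> tendsto_L2 (\<lambda>J x. \<Sum>i\<in>J. u i x) g (finite_subsets_at_top I)"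

definition fourier_L1 :: "(real \<Rightarrow> complex) \<Rightarrow> real \<Rightarrow> complex" where
  "fourier_L1 f \<gamma> =
     (LINT x|lborel. f x * exp (- (2 * complex_of_real pi * \<i> * complex_of_real (x * \<gamma>))))"

text \<open>
  The extension by continuity from \<open>L\<^sup>1 \<inter> L\<^sup>2\<close> to \<open>L\<^sup>2\<close>. By Plancherel's theorem this relation
  is, up to null sets, the graph of a unitary operator, so that the choices made in
  \<open>fourier_L2\<close> and \<open>inv_fourier_L2\<close> only pick representatives.
\<close>

definition has_fourier_L2 :: "(real \<Rightarrow> complex) \<Rightarrow> (real \<Rightarrow> complex) \<Rightarrow> bool" where
  "has_fourier_L2 f g \<longleftrightarrow>
     (\<exists>s :: nat \<Rightarrow> real \<Rightarrow> complex.
        (\<forall>n. integrable lborel (s n)) \<and>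
        tendsto_L2 s f sequentially \<and>
        tendsto_L2 (\<lambda>n. fourier_L1 (s n)) g sequentially)"

definition fourier_L2 :: "(real \<Rightarrow> complex) \<Rightarrow> real \<Rightarrow> complex" where
  "fourier_L2 f = (SOME g. has_fourier_L2 f g)"

definition inv_fourier_L2 :: "(real \<Rightarrow> complex) \<Rightarrow> real \<Rightarrow> complex" where
  "inv_fourier_L2 g = (SOME f. has_fourier_L2 f g)"

definition dilation :: "real \<Rightarrow> (real \<Rightarrow> complex) \<Rightarrow> real \<Rightarrow> complex" where
  "dilation a f = (\<lambda>x. complex_of_real (sqrt a) * f (a * x))"

definition translation :: "real \<Rightarrow> (real \<Rightarrow> complex) \<Rightarrow> real \<Rightarrow> complex" where
  "translation b f = (\<lambda>x. f (x - b))"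

definition wavelet_system ::
    "real \<Rightarrow> real \<Rightarrow> (real \<Rightarrow> complex) \<Rightarrow> int \<times> int \<Rightarrow> real \<Rightarrow> complex" where
  "wavelet_system a b \<psi> = (\<lambda>(j, k). dilation (a powi j) (translation (of_int k * b) \<psi>))"

definition frame_with_bounds_L2 ::
    "('i \<Rightarrow> real \<Rightarrow> complex) \<Rightarrow> 'i set \<Rightarrow> real \<Rightarrow> real \<Rightarrow> bool" where
  "frame_with_bounds_L2 e I A B \<longleftrightarrow>
     countable I \<and> (\<forall>i\<in>I. e i \<in> L2) \<and> A > 0 \<and> B > 0 \<and>
     (\<forall>f\<in>L2. (\<lambda>i. (cmod (inner_L2 f (e i)))\<^sup>2) summable_on I \<and>
        A * (norm_L2 f)\<^sup>2 \<le> (\<Sum>\<^sub>\<infinity>i\<in>I. (cmod (inner_L2 f (e i)))\<^sup>2) \<and>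
        (\<Sum>\<^sub>\<infinity>i\<in>I. (cmod (inner_L2 f (e i)))\<^sup>2) \<le> B * (norm_L2 f)\<^sup>2)"

definition band_limit :: "nat \<Rightarrow> (real \<Rightarrow> complex) \<Rightarrow> real \<Rightarrow> complex" where
  "band_limit K \<psi> =
     inv_fourier_L2 (\<lambda>\<gamma>. fourier_L2 \<psi> \<gamma> * indicator {- real K..real K} \<gamma>)"

text \<open>
  Division by zero yields \<open>0\<close>, in accordance with the convention that the quotient vanishes
  where the Fourier transform of \<open>band_limit K \<psi>\<close> does.
\<close>

definition dual_generator ::
    "real \<Rightarrow> real \<Rightarrow> int \<Rightarrow> nat \<Rightarrow> (real \<Rightarrow> complex) \<Rightarrow> real \<Rightarrow> complex" where
  "dual_generator a b N K \<psi> =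
     inv_fourier_L2 (\<lambda>\<gamma>.
       complex_of_real b * fourier_L2 (band_limit K \<psi>) \<gamma> /
       complex_of_real (of_int N *
         (\<Sum>\<^sub>\<infinity>k\<in>(UNIV :: int set). (cmod (fourier_L2 (band_limit K \<psi>) (a powi k * \<gamma>)))\<^sup>2)))"

definition approx_eps :: "real \<Rightarrow> real \<Rightarrow> real \<Rightarrow> real \<Rightarrow> nat \<Rightarrow> real" where
  "approx_eps a b C \<sigma> K =
     sqrt ((real K + 1 / b) / real K powr (3 + 2 * \<sigma>)) * (2 * C) *
     sqrt ((1 + 1 / (2 * \<sigma>)) * (a powr (1 + \<sigma>) / (a powr (1 + \<sigma>) - 1)))"

end

theory Submission
  imports Defs
begin

text \<open>
  On the Fourier side the system \<open>D\<^bsub>a\<^sup>j\<^esub> T\<^bsub>k b\<^esub> \<psi>\<close> consists, at each scale \<open>j\<close>, of modulations of the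
  dilated transform \<open>\<Psi>(\<gamma> / a\<^sup>j)\<close>, and its coefficients are Fourier coefficients with respect to
  intervals of length \<open>a\<^sup>j / b\<close>. Everything follows from Parseval's identity on intervals.

  \<^emph>\<open>Exact duality.\<close> Let \<open>\<Phi>\<close> be \<open>\<Psi>\<close> restricted to \<open>[-K, K]\<close>. As \<open>2 K < N / b\<close>, the shifts by
  \<open>N / b\<close> of \<open>\<Phi>\<close> do not overlap, so the frame operator of the system generated by \<open>\<Phi>\<close> with translation
  parameter \<open>b / N\<close> is multiplication by \<open>(N / b) S\<close> with \<open>S(\<gamma>) = \<Sum>j. |\<Phi>(\<gamma> / a\<^sup>j)|\<^sup>2\<close>
  (\<open>band_system_energy\<close>). The function \<open>S\<close> is invariant under dilation by \<open>a\<close>; hence dividing \<open>\<Phi>\<close> by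
  \<open>(N / b) S\<close>, which produces the dual generator, inverts this operator. With the band-limited generator
  \<open>\<psi>\<^sub>K\<close> in place of \<open>\<psi>\<close> the reconstruction would be exact.

  \<^emph>\<open>The error.\<close> It is therefore, up to sign, the synthesis from the same coefficients with the tail
  \<open>H = \<Psi> - \<Phi>\<close> (\<open>perturbed_expansion_error\<close>), and its norm is at most the product of the bounds of two
  operators. The coefficients are controlled by a lower bound of \<open>S\<close>. The tail system is
  controlled by a Bessel inequality weighted by \<open>|H|\<close> (\<open>weighted_Bessel\<close>) and the decay of \<open>\<Psi>\<close>, which
  bounds the sum of \<open>|H|\<close> over a lattice and over all dilations (\<open>tail_system_Bessel\<close>).

  \<^emph>\<open>The lower bound of \<open>S\<close>.\<close> Testing the frame inequalities with indicator functions \<open>\<chi>\<^sub>E\<close> of sets in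
  short intervals isolates, up to a vanishing contribution of the low scales, the integral over \<open>E\<close> of
  \<open>(1 / b) \<Sum>j. |\<Psi>(\<gamma> / a\<^sup>j)|\<^sup>2\<close>. So this sum is at least \<open>b A\<close> and finite almost everywhere
  (\<open>frame_lower_energy\<close>, \<open>frame_upper_energy\<close>), and removing the tail subtracts at most a quantity
  \<open>X\<close> with \<open>2 X \<le> \<epsilon>\<^sub>K\<^sup>2\<close>. The elementary estimate \<open>b A - X \<ge> (sqrt (b A) - sqrt X)\<^sup>2\<close> brings the product
  of the two bounds into the stated form (\<open>approx_eps_error_bound\<close>).

  \<^emph>\<open>The transform.\<close> Plancherel's theorem is obtained from Parseval's identity as well: for a function
  supported in an interval of length \<open>L\<close> the squares of the samples of its transform on \<open>t + \<int> / L\<close> have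
  a sum that does not depend on \<open>t\<close>, and averaging over \<open>t\<close> gives the norm. Completeness of \<open>L\<^sup>2\<close>
  extends the transform, and the multiplication formula shows that it is onto.
\<close>

section \<open>The space of square-integrable functions\<close>

lemma L2_iff:
  "f \<in> L2 \<longleftrightarrow> f \<in> borel_measurable borel \<and> integrable lborel (\<lambda>x. (cmod (f x))\<^sup>2)"
  by (simp add: L2_def)

lemma L2_measurable [measurable_dest]: "f \<in> L2 \<Longrightarrow> f \<in> borel_measurable borel"
  by (simp add: L2_iff)

lemma L2_integrable_square: "f \<in> L2 \<Longrightarrow> integrable lborel (\<lambda>x. (cmod (f x))\<^sup>2)"
  by (simp add: L2_iff)

lemma cnj_measurable [measurable]: "cnj \<in> borel_measurable borel"
  by (intro borel_measurable_continuous_onI continuous_intros)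

lemma norm_L2_nonneg [simp]: "0 \<le> norm_L2 f"
  by (simp add: norm_L2_def)

lemma norm_L2_square: "(norm_L2 f)\<^sup>2 = (LINT x|lborel. (cmod (f x))\<^sup>2)"
  by (simp add: norm_L2_def)

lemma nn_norm_L2: "f \<in> L2 \<Longrightarrow> (\<integral>\<^sup>+x. ennreal ((cmod (f x))\<^sup>2) \<partial>lborel) = ennreal ((norm_L2 f)\<^sup>2)"
  unfolding norm_L2_square by (intro nn_integral_eq_integral L2_integrable_square) auto

lemma L2_nn_boundI:
  assumes "f \<in> borel_measurable borel"
    and "(\<integral>\<^sup>+x. ennreal ((cmod (f x))\<^sup>2) \<partial>lborel) \<le> ennreal c" and "0 \<le> c"
  shows "f \<in> L2" "(norm_L2 f)\<^sup>2 \<le> c"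
proof -
  show f: "f \<in> L2"
    using assms by (auto simp: L2_iff integrable_iff_bounded intro: le_less_trans)
  show "(norm_L2 f)\<^sup>2 \<le> c"
    using assms nn_norm_L2[OF f] by (simp add: ennreal_le_iff)
qed

lemma L2_zero [simp]: "(\<lambda>x. 0) \<in> L2"
  by (simp add: L2_iff)

lemma L2_dominated:
  assumes "g \<in> L2" and [measurable]: "f \<in> borel_measurable borel"
    and "AE x in lborel. cmod (f x) \<le> cmod (g x)"
  shows "f \<in> L2"
proof -
  have "integrable lborel (\<lambda>x. (cmod (f x))\<^sup>2)"
    by (rule Bochner_Integration.integrable_bound[OF L2_integrable_square[OF assms(1)]])
      (use assms(3) in \<open>auto simp: power_mono\<close>)
  then show ?thesis by (simp add: L2_iff)
qed

lemma norm_L2_mono: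
  assumes "g \<in> L2" and [measurable]: "f \<in> borel_measurable borel"
    and "AE x in lborel. cmod (f x) \<le> cmod (g x)"
  shows "norm_L2 f \<le> norm_L2 g"
  unfolding norm_L2_def
  by (intro real_sqrt_le_mono integral_mono_AE L2_integrable_square L2_dominated[OF assms] assms(1))
    (use assms(3) in \<open>auto simp: power_mono\<close>)

lemma L2_scale [intro]: "f \<in> L2 \<Longrightarrow> (\<lambda>x. c * f x) \<in> L2"
  by (auto simp: L2_iff norm_mult power_mult_distrib)

lemma norm_L2_scale: "norm_L2 (\<lambda>x. c * f x) = cmod c * norm_L2 f"
  by (simp add: norm_L2_def norm_mult power_mult_distrib real_sqrt_mult)

lemma cmod_add_square_le: "(cmod (x + y))\<^sup>2 \<le> 2 * (cmod x)\<^sup>2 + 2 * (cmod y)\<^sup>2"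
proof -
  have "(cmod (x + y))\<^sup>2 \<le> (cmod x + cmod y)\<^sup>2"
    by (intro power_mono norm_triangle_ineq) auto
  also have "\<dots> \<le> 2 * (cmod x)\<^sup>2 + 2 * (cmod y)\<^sup>2"
    using sum_squares_bound[of "cmod x" "cmod y"] by (simp add: power2_sum)
  finally show ?thesis .
qed

lemma L2_add [intro]:
  assumes "f \<in> L2" "g \<in> L2"
  shows "(\<lambda>x. f x + g x) \<in> L2"
proof -
  have [measurable]: "f \<in> borel_measurable borel" "g \<in> borel_measurable borel"
    using assms by (auto simp: L2_iff)
  have "integrable lborel (\<lambda>x. 2 * (cmod (f x))\<^sup>2 + 2 * (cmod (g x))\<^sup>2)"
    using assms L2_integrable_square by simp
  then have "integrable lborel (\<lambda>x. (cmod (f x + g x))\<^sup>2)"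
    by (rule Bochner_Integration.integrable_bound) (auto simp: cmod_add_square_le)
  then show ?thesis by (simp add: L2_iff)
qed

lemma L2_diff [intro]: "f \<in> L2 \<Longrightarrow> g \<in> L2 \<Longrightarrow> (\<lambda>x. f x - g x) \<in> L2"
  using L2_add[of f "\<lambda>x. (-1) * g x"] L2_scale[of g "-1"] by simp

lemma L2_sum: "(\<And>i. i \<in> I \<Longrightarrow> f i \<in> L2) \<Longrightarrow> (\<lambda>x. \<Sum>i\<in>I. f i x) \<in> L2"
  by (induction I rule: infinite_finite_induct) (auto intro: L2_add)

lemma L2_cnj [intro]: "f \<in> L2 \<Longrightarrow> (\<lambda>x. cnj (f x)) \<in> L2"
  by (auto simp: L2_iff)

lemma norm_L2_cnj: "norm_L2 (\<lambda>x. cnj (f x)) = norm_L2 f"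
  by (simp add: norm_L2_def)

lemma L2_bounded_mult:
  assumes "f \<in> L2" and [measurable]: "m \<in> borel_measurable borel"
    and "AE x in lborel. cmod (m x) \<le> c"
  shows "(\<lambda>x. m x * f x) \<in> L2"
proof (rule L2_dominated[of "\<lambda>x. of_real c * f x"])
  show "(\<lambda>x. m x * f x) \<in> borel_measurable borel"
    using assms(1) by measurable
  show "AE x in lborel. cmod (m x * f x) \<le> cmod (complex_of_real c * f x)"
    using assms(3)
  proof eventually_elim
    case (elim x)
    then have "cmod (m x) \<le> \<bar>c\<bar>" by linarith
    then show ?case by (simp add: norm_mult mult_right_mono)
  qed
qed (use assms(1) in auto)

lemma L2_restrict:
  assumes "f \<in> L2" and [measurable]: "A \<in> sets borel"
  shows "(\<lambda>x. indicator A x * f x) \<in> L2"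
  by (rule L2_bounded_mult[OF assms(1), of _ 1]) (auto simp: indicator_def)

lemma L2_integrable_mult:
  assumes "f \<in> L2" "g \<in> L2"
  shows "integrable lborel (\<lambda>x. f x * g x)"
proof -
  have [measurable]: "f \<in> borel_measurable borel" "g \<in> borel_measurable borel"
    using assms by (auto simp: L2_iff)
  have "integrable lborel (\<lambda>x. (cmod (f x))\<^sup>2 + (cmod (g x))\<^sup>2)"
    using assms L2_integrable_square by simp
  then show ?thesis
  proof (rule Bochner_Integration.integrable_bound)
    have "cmod (f x) * cmod (g x) \<le> (cmod (f x))\<^sup>2 + (cmod (g x))\<^sup>2" for x
      using sum_squares_bound[of "cmod (f x)" "cmod (g x)"]
        mult_nonneg_nonneg[OF norm_ge_zero[of "f x"] norm_ge_zero[of "g x"]] by linarith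
    then show "AE x in lborel. norm (f x * g x) \<le> norm ((cmod (f x))\<^sup>2 + (cmod (g x))\<^sup>2)"
      by (auto simp: norm_mult)
  qed auto
qed

lemma L2_integrable_inner: "f \<in> L2 \<Longrightarrow> g \<in> L2 \<Longrightarrow> integrable lborel (\<lambda>x. f x * cnj (g x))"
  by (rule L2_integrable_mult) auto

lemma inner_L2_add_left:
  "f \<in> L2 \<Longrightarrow> g \<in> L2 \<Longrightarrow> h \<in> L2 \<Longrightarrow> inner_L2 (\<lambda>x. f x + g x) h = inner_L2 f h + inner_L2 g h"
  unfolding inner_L2_def by (simp add: distrib_right L2_integrable_inner)

lemma inner_L2_diff_left:
  "f \<in> L2 \<Longrightarrow> g \<in> L2 \<Longrightarrow> h \<in> L2 \<Longrightarrow> inner_L2 (\<lambda>x. f x - g x) h = inner_L2 f h - inner_L2 g h"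
  unfolding inner_L2_def by (simp add: left_diff_distrib L2_integrable_inner)

lemma inner_L2_scale_left: "inner_L2 (\<lambda>x. c * f x) h = c * inner_L2 f h"
  unfolding inner_L2_def by (simp add: mult.assoc)

lemma inner_L2_cnj: "cnj (inner_L2 f g) = inner_L2 g f"
  unfolding inner_L2_def Bochner_Integration.integral_cnj[symmetric] by (simp add: mult.commute)

lemma inner_L2_add_right:
  "f \<in> L2 \<Longrightarrow> g \<in> L2 \<Longrightarrow> h \<in> L2 \<Longrightarrow> inner_L2 h (\<lambda>x. f x + g x) = inner_L2 h f + inner_L2 h g"
  unfolding inner_L2_def by (simp add: distrib_left L2_integrable_inner)

lemma inner_L2_diff_right:
  "f \<in> L2 \<Longrightarrow> g \<in> L2 \<Longrightarrow> h \<in> L2 \<Longrightarrow> inner_L2 h (\<lambda>x. f x - g x) = inner_L2 h f - inner_L2 h g"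
  unfolding inner_L2_def by (simp add: right_diff_distrib L2_integrable_inner)

lemma inner_L2_scale_right: "inner_L2 h (\<lambda>x. c * f x) = cnj c * inner_L2 h f"
  unfolding inner_L2_def by (simp add: mult.left_commute)

lemma inner_L2_sum_left:
  assumes "\<And>i. i \<in> I \<Longrightarrow> f i \<in> L2" and "h \<in> L2"
  shows "inner_L2 (\<lambda>x. \<Sum>i\<in>I. f i x) h = (\<Sum>i\<in>I. inner_L2 (f i) h)"
  unfolding inner_L2_def sum_distrib_right
  by (intro Bochner_Integration.integral_sum L2_integrable_inner assms)

lemma inner_L2_self: "inner_L2 f f = complex_of_real ((norm_L2 f)\<^sup>2)"
  unfolding inner_L2_def norm_L2_square complex_norm_square[symmetric] of_real_power[symmetric]
  by (rule integral_complex_of_real)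

lemma norm_L2_add_square:
  assumes "f \<in> L2" "g \<in> L2"
  shows "(norm_L2 (\<lambda>x. f x + g x))\<^sup>2 = (norm_L2 f)\<^sup>2 + 2 * Re (inner_L2 f g) + (norm_L2 g)\<^sup>2"
proof -
  have "complex_of_real ((norm_L2 (\<lambda>x. f x + g x))\<^sup>2) =
      inner_L2 f f + inner_L2 f g + (cnj (inner_L2 f g) + inner_L2 g g)"
    using assms unfolding inner_L2_self[symmetric] inner_L2_cnj
    by (simp add: inner_L2_add_left inner_L2_add_right L2_add)
  from arg_cong[OF this, of Re] show ?thesis
    by (simp add: inner_L2_self)
qed

lemma inner_L2_Cauchy_Schwarz:
  assumes "f \<in> L2" "g \<in> L2"
  shows "cmod (inner_L2 f g) \<le> norm_L2 f * norm_L2 g"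
proof -
  have [measurable]: "f \<in> borel_measurable borel" "g \<in> borel_measurable borel"
    using assms by (auto simp: L2_iff)
  have int: "integrable lborel (\<lambda>x. cmod (f x) * cmod (g x))"
    using integrable_norm[OF L2_integrable_mult[OF assms]] by (simp add: norm_mult)
  have "ennreal ((LINT x|lborel. cmod (f x) * cmod (g x))\<^sup>2)
      = (\<integral>\<^sup>+x. ennreal (cmod (f x)) * ennreal (cmod (g x)) \<partial>lborel)\<^sup>2"
    using nn_integral_eq_integral[OF int]
    by (simp add: ennreal_mult[symmetric] ennreal_power)
  also have "\<dots> \<le> (\<integral>\<^sup>+x. ennreal (cmod (f x)) ^ 2 \<partial>lborel) * (\<integral>\<^sup>+x. ennreal (cmod (g x)) ^ 2 \<partial>lborel)"
    by (rule Cauchy_Schwarz_nn_integral) auto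
  also have "\<dots> = ennreal ((norm_L2 f * norm_L2 g)\<^sup>2)"
    using assms by (simp add: ennreal_power nn_norm_L2 ennreal_mult[symmetric] power_mult_distrib)
  finally have "(LINT x|lborel. cmod (f x) * cmod (g x))\<^sup>2 \<le> (norm_L2 f * norm_L2 g)\<^sup>2"
    by (simp add: ennreal_le_iff)
  then have "(LINT x|lborel. cmod (f x) * cmod (g x)) \<le> norm_L2 f * norm_L2 g"
    by (rule power2_le_imp_le) simp
  moreover have "cmod (inner_L2 f g) \<le> (LINT x|lborel. cmod (f x) * cmod (g x))"
    unfolding inner_L2_def using integral_norm_bound[of lborel "\<lambda>x. f x * cnj (g x)"]
    by (simp add: norm_mult)
  ultimately show ?thesis by linarith
qed

lemma norm_L2_triangle:
  assumes "f \<in> L2" "g \<in> L2"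
  shows "norm_L2 (\<lambda>x. f x + g x) \<le> norm_L2 f + norm_L2 g"
proof (rule power2_le_imp_le)
  have "Re (inner_L2 f g) \<le> norm_L2 f * norm_L2 g"
    using inner_L2_Cauchy_Schwarz[OF assms] complex_Re_le_cmod order_trans by blast
  then show "(norm_L2 (\<lambda>x. f x + g x))\<^sup>2 \<le> (norm_L2 f + norm_L2 g)\<^sup>2"
    using norm_L2_add_square[OF assms] by (simp add: power2_sum)
qed simp

lemma norm_L2_minus_commute: "norm_L2 (\<lambda>x. f x - g x) = norm_L2 (\<lambda>x. g x - f x)"
  by (simp add: norm_L2_def norm_minus_commute)

lemma norm_L2_triangle_diff:
  assumes "f \<in> L2" "g \<in> L2" "h \<in> L2"
  shows "norm_L2 (\<lambda>x. f x - h x) \<le> norm_L2 (\<lambda>x. f x - g x) + norm_L2 (\<lambda>x. g x - h x)"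
  using norm_L2_triangle[OF L2_diff[OF assms(1,2)] L2_diff[OF assms(2,3)]] by simp

lemma abs_norm_L2_diff_le:
  assumes "f \<in> L2" "g \<in> L2"
  shows "\<bar>norm_L2 f - norm_L2 g\<bar> \<le> norm_L2 (\<lambda>x. f x - g x)"
  using norm_L2_triangle[OF L2_diff[OF assms] assms(2)]
    norm_L2_triangle[OF L2_diff[OF assms(2,1)] assms(1)] norm_L2_minus_commute[of f g] by simp

lemma norm_L2_eq_0_AE:
  assumes "f \<in> L2" "norm_L2 f = 0"
  shows "AE x in lborel. f x = 0"
proof -
  have "AE x in lborel. (cmod (f x))\<^sup>2 = 0"
    using assms by (subst integral_nonneg_eq_0_iff_AE[symmetric])
      (auto simp: norm_L2_def intro: L2_integrable_square)
  then show ?thesis by simp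
qed

lemma norm_L2_cong_AE:
  assumes "f \<in> borel_measurable borel" "g \<in> borel_measurable borel" "AE x in lborel. f x = g x"
  shows "norm_L2 f = norm_L2 g"
  unfolding norm_L2_def using assms by (intro arg_cong[of _ _ sqrt] integral_cong_AE) auto

subsection \<open>Convergence in mean square\<close>

lemma tendsto_L2_add:
  assumes "tendsto_L2 u f F" "tendsto_L2 v g F"
  shows "tendsto_L2 (\<lambda>i x. u i x + v i x) (\<lambda>x. f x + g x) F"
proof -
  have f: "f \<in> L2" and g: "g \<in> L2" and u: "\<forall>\<^sub>F i in F. u i \<in> L2" and v: "\<forall>\<^sub>F i in F. v i \<in> L2"
    and lim: "((\<lambda>i. norm_L2 (\<lambda>x. u i x - f x)) \<longlongrightarrow> 0) F" "((\<lambda>i. norm_L2 (\<lambda>x. v i x - g x)) \<longlongrightarrow> 0) F"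
    using assms by (auto simp: tendsto_L2_def)
  have "((\<lambda>i. norm_L2 (\<lambda>x. (u i x + v i x) - (f x + g x))) \<longlongrightarrow> 0) F"
  proof (rule tendsto_sandwich[OF _ _ tendsto_const])
    show "((\<lambda>i. norm_L2 (\<lambda>x. u i x - f x) + norm_L2 (\<lambda>x. v i x - g x)) \<longlongrightarrow> 0) F"
      using tendsto_add[OF lim] by simp
    show "\<forall>\<^sub>F i in F. norm_L2 (\<lambda>x. (u i x + v i x) - (f x + g x))
        \<le> norm_L2 (\<lambda>x. u i x - f x) + norm_L2 (\<lambda>x. v i x - g x)"
      using u v
    proof eventually_elim
      case (elim i)
      show ?case
        using norm_L2_triangle[OF L2_diff[OF elim(1) f] L2_diff[OF elim(2) g]]
        by (simp add: algebra_simps)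
    qed
  qed auto
  moreover have "\<forall>\<^sub>F i in F. (\<lambda>x. u i x + v i x) \<in> L2"
    using u v by eventually_elim auto
  ultimately show ?thesis using f g by (auto simp: tendsto_L2_def)
qed

lemma tendsto_L2_scale:
  assumes "tendsto_L2 u f F"
  shows "tendsto_L2 (\<lambda>i x. c * u i x) (\<lambda>x. c * f x) F"
proof -
  have "((\<lambda>i. norm_L2 (\<lambda>x. c * u i x - c * f x)) \<longlongrightarrow> 0) F"
    using assms tendsto_mult_right_zero[of "\<lambda>i. norm_L2 (\<lambda>x. u i x - f x)" F "cmod c"]
    by (simp add: tendsto_L2_def norm_L2_scale right_diff_distrib[symmetric])
  then show ?thesis using assms by (auto simp: tendsto_L2_def elim!: eventually_mono)
qed

lemma tendsto_L2_norm:
  assumes "tendsto_L2 u f F"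
  shows "((\<lambda>i. norm_L2 (u i)) \<longlongrightarrow> norm_L2 f) F"
proof -
  have "((\<lambda>i. norm_L2 (u i) - norm_L2 f) \<longlongrightarrow> 0) F"
    by (rule Lim_null_comparison[of _ "\<lambda>i. norm_L2 (\<lambda>x. u i x - f x)"])
      (use assms in \<open>auto simp: tendsto_L2_def abs_norm_L2_diff_le elim: eventually_mono\<close>)
  then show ?thesis by (simp add: LIM_zero_iff)
qed

lemma tendsto_L2_inner:
  assumes "tendsto_L2 u f F" "tendsto_L2 v g F"
  shows "((\<lambda>i. inner_L2 (u i) (v i)) \<longlongrightarrow> inner_L2 f g) F"
proof -
  have f: "f \<in> L2" and g: "g \<in> L2" and u: "\<forall>\<^sub>F i in F. u i \<in> L2" and v: "\<forall>\<^sub>F i in F. v i \<in> L2"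
    and lim: "((\<lambda>i. norm_L2 (\<lambda>x. u i x - f x)) \<longlongrightarrow> 0) F" "((\<lambda>i. norm_L2 (\<lambda>x. v i x - g x)) \<longlongrightarrow> 0) F"
    using assms by (auto simp: tendsto_L2_def)
  have "((\<lambda>i. inner_L2 (u i) (v i) - inner_L2 f g) \<longlongrightarrow> 0) F"
  proof (rule Lim_null_comparison)
    show "((\<lambda>i. norm_L2 (\<lambda>x. u i x - f x) * norm_L2 (v i) + norm_L2 f * norm_L2 (\<lambda>x. v i x - g x))
        \<longlongrightarrow> 0) F"
      using tendsto_add[OF tendsto_mult[OF lim(1) tendsto_L2_norm[OF assms(2)]]
          tendsto_mult[OF tendsto_const[of "norm_L2 f"] lim(2)]] by simp
    show "\<forall>\<^sub>F i in F. norm (inner_L2 (u i) (v i) - inner_L2 f g)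
        \<le> norm_L2 (\<lambda>x. u i x - f x) * norm_L2 (v i) + norm_L2 f * norm_L2 (\<lambda>x. v i x - g x)"
      using u v
    proof eventually_elim
      case (elim i)
      have "inner_L2 (u i) (v i) - inner_L2 f g
          = inner_L2 (\<lambda>x. u i x - f x) (v i) + inner_L2 f (\<lambda>x. v i x - g x)"
        using f g elim by (simp add: inner_L2_diff_left inner_L2_diff_right)
      also have "norm \<dots> \<le> cmod (inner_L2 (\<lambda>x. u i x - f x) (v i)) + cmod (inner_L2 f (\<lambda>x. v i x - g x))"
        by (rule norm_triangle_ineq)
      also have "\<dots> \<le> norm_L2 (\<lambda>x. u i x - f x) * norm_L2 (v i) + norm_L2 f * norm_L2 (\<lambda>x. v i x - g x)"
        using f g elim by (intro add_mono inner_L2_Cauchy_Schwarz) auto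
      finally show ?case .
    qed
  qed
  then show ?thesis by (simp add: LIM_zero_iff)
qed

lemma tendsto_L2_const: "f \<in> L2 \<Longrightarrow> tendsto_L2 (\<lambda>i. f) f F"
  by (simp add: tendsto_L2_def norm_L2_def)

lemma tendsto_L2_cong_AE:
  assumes "tendsto_L2 u f F" "g \<in> borel_measurable borel" "AE x in lborel. f x = g x"
  shows "tendsto_L2 u g F"
proof -
  have f: "f \<in> L2" and u: "\<forall>\<^sub>F i in F. u i \<in> L2" 
    and lim: "((\<lambda>i. norm_L2 (\<lambda>x. u i x - f x)) \<longlongrightarrow> 0) F"
    using assms by (auto simp: tendsto_L2_def)
  have g: "g \<in> L2" by (rule L2_dominated[OF f assms(2)]) (use assms(3) in auto)
  have "((\<lambda>i. norm_L2 (\<lambda>x. u i x - g x)) \<longlongrightarrow> 0) F"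
  proof (rule Lim_transform_eventually[OF lim])
    show "\<forall>\<^sub>F i in F. norm_L2 (\<lambda>x. u i x - f x) = norm_L2 (\<lambda>x. u i x - g x)"
      using u
    proof eventually_elim
      case (elim i)
      show ?case using elim f g assms(3)
        by (intro norm_L2_cong_AE L2_measurable L2_diff) auto
    qed
  qed
  then show ?thesis using g u by (simp add: tendsto_L2_def)
qed

text \<open>Applied to differences, this identifies mean-square limits with pointwise ones and gives completeness.\<close>

lemma norm_L2_Fatou:
  assumes u: "\<And>n::nat. u n \<in> L2" and [measurable]: "g \<in> borel_measurable borel"
    and lim: "AE x in lborel. (\<lambda>n. u n x) \<longlonglongrightarrow> g x"
    and bound: "\<And>n. n \<ge> m \<Longrightarrow> norm_L2 (u n) \<le> c"
  shows "g \<in> L2" "norm_L2 g \<le> c"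
proof -
  have [measurable]: "u n \<in> borel_measurable borel" for n using u by (simp add: L2_iff)
  have c: "0 \<le> c" using bound[of m] norm_L2_nonneg[of "u m"] by linarith
  have "(\<integral>\<^sup>+x. ennreal ((cmod (g x))\<^sup>2) \<partial>lborel)
      = (\<integral>\<^sup>+x. liminf (\<lambda>n. ennreal ((cmod (u n x))\<^sup>2)) \<partial>lborel)"
  proof (rule nn_integral_cong_AE)
    show "AE x in lborel. ennreal ((cmod (g x))\<^sup>2) = liminf (\<lambda>n. ennreal ((cmod (u n x))\<^sup>2))"
      using lim
    proof eventually_elim
      case (elim x)
      have "(\<lambda>n. ennreal ((cmod (u n x))\<^sup>2)) \<longlonglongrightarrow> ennreal ((cmod (g x))\<^sup>2)"
        by (intro tendsto_ennrealI tendsto_power tendsto_norm elim)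
      from lim_imp_Liminf[OF sequentially_bot this] show ?case by (rule sym)
    qed
  qed
  also have "\<dots> \<le> liminf (\<lambda>n. \<integral>\<^sup>+x. ennreal ((cmod (u n x))\<^sup>2) \<partial>lborel)"
    by (rule nn_integral_liminf) auto
  also have "\<dots> \<le> liminf (\<lambda>n::nat. ennreal (c\<^sup>2))"
  proof (rule Liminf_mono)
    show "\<forall>\<^sub>F n in sequentially. (\<integral>\<^sup>+x. ennreal ((cmod (u n x))\<^sup>2) \<partial>lborel) \<le> ennreal (c\<^sup>2)"
      using eventually_ge_at_top[of m]
      by eventually_elim (auto simp: nn_norm_L2[OF u] intro!: ennreal_leI power_mono bound)
  qed
  also have "\<dots> = ennreal (c\<^sup>2)" by (simp add: Liminf_const)
  finally have *: "(\<integral>\<^sup>+x. ennreal ((cmod (g x))\<^sup>2) \<partial>lborel) \<le> ennreal (c\<^sup>2)" .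
  show "g \<in> L2" by (rule L2_nn_boundI[OF _ *]) auto
  have "(norm_L2 g)\<^sup>2 \<le> c\<^sup>2" by (rule L2_nn_boundI[OF _ *]) auto
  then show "norm_L2 g \<le> c" using c by (rule power2_le_imp_le)
qed

lemma tendsto_L2_pointwise_limit_AE:
  assumes "tendsto_L2 u f sequentially" and "\<And>n. u n \<in> L2"
    and [measurable]: "g \<in> borel_measurable borel" and "AE x in lborel. (\<lambda>n. u n x) \<longlonglongrightarrow> g x"
  shows "AE x in lborel. f x = g x"
proof -
  have f: "f \<in> L2" using assms(1) by (simp add: tendsto_L2_def)
  have [measurable]: "f \<in> borel_measurable borel" using f by (simp add: L2_iff)
  have lim: "AE x in lborel. (\<lambda>n. u n x - f x) \<longlonglongrightarrow> g x - f x"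
    using assms(4) by eventually_elim (auto intro: tendsto_diff)
  have *: "(\<lambda>x. g x - f x) \<in> L2 \<and> norm_L2 (\<lambda>x. g x - f x) \<le> e" if "e > 0" for e
  proof -
    have "\<forall>\<^sub>F n in sequentially. norm_L2 (\<lambda>x. u n x - f x) < e"
      using assms(1) that unfolding tendsto_L2_def by (auto dest: order_tendstoD(2))
    then obtain m where "\<And>n. n \<ge> m \<Longrightarrow> norm_L2 (\<lambda>x. u n x - f x) \<le> e"
      unfolding eventually_sequentially by (meson less_imp_le)
    moreover have "(\<lambda>x. u n x - f x) \<in> L2" for n using assms(2) f by auto
    ultimately show ?thesis
      using norm_L2_Fatou[OF _ _ lim, of m e] by auto
  qed
  have "norm_L2 (\<lambda>x. g x - f x) \<le> 0"
  proof (rule field_le_epsilon)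
    fix e :: real assume "0 < e"
    from *[OF this] show "norm_L2 (\<lambda>x. g x - f x) \<le> 0 + e" by simp
  qed
  then have "norm_L2 (\<lambda>x. g x - f x) = 0"
    using norm_L2_nonneg[of "\<lambda>x. g x - f x"] by linarith
  moreover have "(\<lambda>x. g x - f x) \<in> L2" using *[of 1] by simp
  ultimately have "AE x in lborel. g x - f x = 0" by (intro norm_L2_eq_0_AE)
  then show ?thesis by auto
qed

text \<open>
  Riesz--Fischer. Along a subsequence with increments \<open>d\<^sub>n\<close> of norm at most \<open>2\<^sup>-\<^sup>n\<close> the
  integral of \<open>\<Sum>n. 2\<^sup>n d\<^sub>n\<^sup>2\<close> is finite, so that almost everywhere \<open>d\<^sub>n\<close> is dominated by a
  geometric sequence of ratio \<open>1 / sqrt 2\<close> and the subsequence converges.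
\<close>

lemma L2_complete:
  assumes u: "\<And>n::nat. u n \<in> L2"
    and Cauchy: "\<And>e. e > 0 \<Longrightarrow> \<exists>M. \<forall>m\<ge>M. \<forall>n\<ge>M. norm_L2 (\<lambda>x. u m x - u n x) < e"
  shows "\<exists>g. tendsto_L2 u g sequentially"
proof -
  have [measurable]: "u n \<in> borel_measurable borel" for n using u by (simp add: L2_iff)
  have "\<exists>M. \<forall>n. (\<forall>m\<ge>M n. \<forall>k\<ge>M n. norm_L2 (\<lambda>x. u m x - u k x) < (1/2)^n)"
    using Cauchy by (intro choice) (auto)
  then obtain M where M: "\<And>n m k. m \<ge> M n \<Longrightarrow> k \<ge> M n \<Longrightarrow> norm_L2 (\<lambda>x. u m x - u k x) < (1/2)^n"
    by blast
  define r where "r n = Max (insert n (M ` {..n}))" for n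
  have rM: "r n \<ge> M n" and rn: "r n \<ge> n" and r_Suc: "r (Suc n) \<ge> M n" for n
    unfolding r_def by (rule Max_ge; auto)+
  define d where "d n x = u (r (Suc n)) x - u (r n) x" for n x
  have dL2: "d n \<in> L2" for n unfolding d_def by (intro L2_diff u)
  have [measurable]: "d n \<in> borel_measurable borel" for n using dL2 by (simp add: L2_iff)
  have dn: "norm_L2 (d n) \<le> (1/2)^n" for n
    unfolding d_def using M[OF r_Suc rM] by (simp add: less_imp_le)
  have "(\<integral>\<^sup>+x. (\<Sum>n. ennreal (2^n * (cmod (d n x))\<^sup>2)) \<partial>lborel)
      = (\<Sum>n. \<integral>\<^sup>+x. ennreal (2^n * (cmod (d n x))\<^sup>2) \<partial>lborel)"
    by (rule nn_integral_suminf) auto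
  also have "\<dots> = (\<Sum>n. ennreal (2^n * (norm_L2 (d n))\<^sup>2))"
    by (simp add: ennreal_mult nn_integral_cmult nn_norm_L2[OF dL2])
  also have "\<dots> \<le> (\<Sum>n. ennreal ((1/2)^n))"
  proof (intro suminf_le ennreal_leI)
    fix n
    have "2^n * (norm_L2 (d n))\<^sup>2 \<le> 2^n * (((1/2)^n)\<^sup>2 :: real)"
      using dn by (intro mult_left_mono power_mono) auto
    also have "\<dots> = (1/2)^n" by (simp add: power2_eq_square power_divide)
    finally show "2^n * (norm_L2 (d n))\<^sup>2 \<le> (1/2)^n" .
  qed auto
  also have "\<dots> < \<infinity>"
    by (subst suminf_ennreal2) auto
  finally have "AE x in lborel. (\<Sum>n. ennreal (2^n * (cmod (d n x))\<^sup>2)) \<noteq> \<infinity>"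
    by (intro nn_integral_PInf_AE) auto
  then have conv: "AE x in lborel. convergent (\<lambda>n. u (r n) x)"
  proof eventually_elim
    case (elim x)
    have "summable (\<lambda>n. 2^n * (cmod (d n x))\<^sup>2)"
      using elim by (intro summable_suminf_not_top) auto
    then have "(\<lambda>n. 2^n * (cmod (d n x))\<^sup>2) \<longlonglongrightarrow> 0" by (rule summable_LIMSEQ_zero)
    then have "\<forall>\<^sub>F n in sequentially. 2^n * (cmod (d n x))\<^sup>2 < 1"
      by (rule order_tendstoD(2)) simp
    then have "\<forall>\<^sub>F n in sequentially. norm (d n x) \<le> (sqrt (1/2))^n"
    proof eventually_elim
      case (elim n)
      have "(cmod (d n x))\<^sup>2 \<le> (1/2)^n" using elim by (simp add: field_simps)
      then have "cmod (d n x) \<le> sqrt ((1/2)^n)" by (rule real_le_rsqrt)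
      then show ?case by (simp only: real_sqrt_power)
    qed
    moreover have "summable (\<lambda>n. (sqrt (1/2))^n)"
      by (intro summable_geometric) (simp add: real_sqrt_lt_1_iff)
    ultimately have "summable (\<lambda>n. d n x)"
      by (rule summable_comparison_test_ev)
    from convergentI[OF tendsto_add[OF tendsto_const summable_LIMSEQ[OF this]]]
    have "convergent (\<lambda>n. u (r 0) x + (\<Sum>i<n. d i x))" .
    moreover have "u (r 0) x + (\<Sum>i<n. d i x) = u (r n) x" for n
    proof (induction n)
      case (Suc n)
      then show ?case by (simp add: d_def add.assoc[symmetric])
    qed simp
    ultimately show ?case by (simp only:)
  qed
  define g where "g x = lim (\<lambda>n. u (r n) x)" for x
  have [measurable]: "g \<in> borel_measurable borel"
    unfolding g_def by measurable
  have lim: "AE x in lborel. (\<lambda>n. u (r n) x) \<longlonglongrightarrow> g x"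
    using conv by eventually_elim (simp add: g_def convergent_LIMSEQ_iff)
  have *: "(\<lambda>x. u k x - g x) \<in> L2 \<and> norm_L2 (\<lambda>x. u k x - g x) \<le> (1/2)^n" if "k \<ge> M n" for k n
  proof -
    have l: "AE x in lborel. (\<lambda>m. u k x - u (r m) x) \<longlonglongrightarrow> u k x - g x"
      using lim by eventually_elim (auto intro: tendsto_diff)
    have b: "norm_L2 (\<lambda>x. u k x - u (r m) x) \<le> (1/2)^n" if "m \<ge> M n" for m
      using M[OF \<open>k \<ge> M n\<close>, of "r m"] that rn[of m] by (simp add: less_imp_le)
    have "(\<lambda>x. u k x - u (r m) x) \<in> L2" for m using u by auto
    note F = norm_L2_Fatou[OF this _ l b]
    have "(\<lambda>x. u k x - g x) \<in> borel_measurable borel" by measurable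
    with F show ?thesis by blast
  qed
  have g: "g \<in> L2" 
  proof -
    have "(\<lambda>x. u (M 0) x - (u (M 0) x - g x)) \<in> L2"
      using u *[of 0 "M 0", OF order_refl] by (intro L2_diff[of _ "\<lambda>x. u (M 0) x - g x"]) blast+
    then show ?thesis by (simp only: diff_diff_eq2 add_diff_cancel_left')
  qed
  have "(\<lambda>k. norm_L2 (\<lambda>x. u k x - g x)) \<longlonglongrightarrow> 0"
  proof (rule LIMSEQ_I)
    fix e :: real assume "e > 0"
    then obtain n where "(1/2)^n < e" using real_arch_pow_inv[of e "1/2"] by auto
    moreover have "norm_L2 (\<lambda>x. u k x - g x) \<le> (1/2)^n" if "k \<ge> M n" for k
      using *[OF that] by blast
    ultimately have "norm (norm_L2 (\<lambda>x. u k x - g x) - 0) < e" if "k \<ge> M n" for k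
      unfolding diff_zero real_norm_def abs_of_nonneg[OF norm_L2_nonneg] using that le_less_trans by blast
    then show "\<exists>no. \<forall>k\<ge>no. norm (norm_L2 (\<lambda>x. u k x - g x) - 0) < e" by blast
  qed
  then show ?thesis using u g unfolding tendsto_L2_def by (intro exI[of _ g] conjI always_eventually allI)
qed

section \<open>Fourier series and Parseval's identity\<close>

text \<open>
  The character \<open>exp (- 2 \<pi> \<i> x \<gamma>)\<close> of the Fourier integral. Writing it with \<open>cis\<close> makes its
  modulus, conjugate and addition laws immediate.
\<close>

definition wave :: "real \<Rightarrow> real \<Rightarrow> complex" where
  "wave \<gamma> x = cis (- (2 * pi * (x * \<gamma>)))"

lemma wave_exp: "wave \<gamma> x = exp (- (2 * complex_of_real pi * \<i> * complex_of_real (x * \<gamma>)))"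
  unfolding wave_def cis_conv_exp by (simp add: mult_ac)

lemma fourier_L1_wave: "fourier_L1 f \<gamma> = (LINT x|lborel. f x * wave \<gamma> x)"
  by (simp add: fourier_L1_def wave_exp)

lemma norm_wave [simp]: "cmod (wave \<gamma> x) = 1"
  by (simp add: wave_def)

lemma cnj_wave: "cnj (wave \<gamma> x) = wave (- \<gamma>) x"
  by (simp add: wave_def cis_cnj)

lemma wave_commute: "wave \<gamma> x = wave x \<gamma>"
  by (simp add: wave_def mult.commute)

lemma wave_add_freq: "wave (\<gamma> + \<delta>) x = wave \<gamma> x * wave \<delta> x"
  by (simp add: wave_def cis_mult algebra_simps)

lemma wave_add: "wave \<gamma> (x + y) = wave \<gamma> x * wave \<gamma> y"
  by (simp add: wave_def cis_mult algebra_simps)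

lemma wave_int: "wave (of_int k) (of_int m) = 1"
proof -
  have "wave (of_int k) (of_int m) = cis (2 * pi * of_int (- m * k))"
    by (simp add: wave_def algebra_simps)
  then show ?thesis using cis_multiple_2pi[of "of_int (- m * k)"] Ints_of_int by metis
qed

lemma wave_measurable [measurable]: "(\<lambda>x. wave (g x) (f x)) \<in> borel_measurable M"
  if [measurable]: "f \<in> borel_measurable M" "g \<in> borel_measurable M" for f g :: "'a \<Rightarrow> real"
proof -
  have "(\<lambda>x. cis x) \<in> borel_measurable borel"
    by (intro borel_measurable_continuous_onI continuous_intros)
  then show ?thesis unfolding wave_def by measurable
qed

lemma integrable_mult_wave:
  assumes "integrable lborel f" shows "integrable lborel (\<lambda>x. f x * wave \<gamma> x)"
  using assms by (rule Bochner_Integration.integrable_bound) (use assms in \<open>auto simp: norm_mult\<close>)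

subsection \<open>Dominated convergence and density\<close>

lemma L2_dominated_convergence:
  assumes w: "w \<in> L2" and u: "\<And>n::nat. u n \<in> borel_measurable borel"
    and bound: "\<And>n. AE x in lborel. cmod (u n x) \<le> cmod (w x)"
    and f: "f \<in> borel_measurable borel" and lim: "AE x in lborel. (\<lambda>n. u n x) \<longlonglongrightarrow> f x"
  shows "tendsto_L2 u f sequentially"
proof -
  note [measurable] = u f
  have ae: "AE x in lborel. \<forall>n. cmod (u n x) \<le> cmod (w x)"
    using bound by (simp add: AE_all_countable)
  have fw: "AE x in lborel. cmod (f x) \<le> cmod (w x)"
    using ae lim by eventually_elim (auto intro!: tendsto_upperbound[OF tendsto_norm])
  have fL2: "f \<in> L2" by (rule L2_dominated[OF w f fw])
  have uL2: "u n \<in> L2" for n by (rule L2_dominated[OF w u bound])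
  have "(\<lambda>n. LINT x|lborel. (cmod (u n x - f x))\<^sup>2) \<longlonglongrightarrow> integral\<^sup>L lborel (\<lambda>x::real. 0::real)"
  proof (rule integral_dominated_convergence[where w="\<lambda>x. 4 * (cmod (w x))\<^sup>2"
        and f="\<lambda>x. 0" and s="\<lambda>n x. (cmod (u n x - f x))\<^sup>2"])
    show "integrable lborel (\<lambda>x. 4 * (cmod (w x))\<^sup>2)"
      using L2_integrable_square[OF w] by simp
    show "AE x in lborel. (\<lambda>n. (cmod (u n x - f x))\<^sup>2) \<longlonglongrightarrow> 0"
      using lim
    proof eventually_elim
      case (elim x)
      from tendsto_power[OF tendsto_norm[OF tendsto_diff[OF elim tendsto_const[of "f x"]]], of 2]
      show ?case by simp
    qed
    show "AE x in lborel. norm ((cmod (u n x - f x))\<^sup>2) \<le> 4 * (cmod (w x))\<^sup>2" for n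
      using ae fw
    proof eventually_elim
      case (elim x)
      have "cmod (u n x - f x) \<le> 2 * cmod (w x)"
        using norm_triangle_ineq4[of "u n x" "f x"] elim(1)[rule_format, of n] elim(2) by linarith
      then have "(cmod (u n x - f x))\<^sup>2 \<le> (2 * cmod (w x))\<^sup>2" by (intro power_mono) auto
      then show ?case by (simp add: power_mult_distrib)
    qed
  qed auto
  then have "(\<lambda>n. norm_L2 (\<lambda>x. u n x - f x)) \<longlonglongrightarrow> sqrt 0"
    unfolding norm_L2_def by (intro tendsto_real_sqrt) simp
  then show ?thesis using fL2 uL2 by (simp add: tendsto_L2_def)
qed

lemma L2_indicator:
  assumes [measurable]: "A \<in> sets borel" and "emeasure lborel A < \<infinity>"
  shows "indicator A \<in> L2" "(norm_L2 (indicator A))\<^sup>2 = measure lborel A"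
proof -
  have eq: "(cmod (indicator A x))\<^sup>2 = indicator A x" for x by (simp add: indicator_def)
  show "indicator A \<in> L2"
    using assms by (simp add: L2_iff eq integrable_indicator_iff)
  show "(norm_L2 (indicator A))\<^sup>2 = measure lborel A"
    by (simp add: norm_L2_square eq)
qed

lemma tendsto_L2_approx:
  assumes "tendsto_L2 u f sequentially" "e > 0"
  shows "\<exists>n. u n \<in> L2 \<and> norm_L2 (\<lambda>x. f x - u n x) < e"
proof -
  have "\<forall>\<^sub>F n in sequentially. u n \<in> L2 \<and> norm_L2 (\<lambda>x. u n x - f x) < e"
    using assms by (auto simp: tendsto_L2_def intro!: eventually_conj dest: order_tendstoD(2))
  then obtain n where "u n \<in> L2" "norm_L2 (\<lambda>x. u n x - f x) < e"
    using eventually_happens'[OF sequentially_bot] by blast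
  then show ?thesis using norm_L2_minus_commute[of "u n" f] by auto
qed

text \<open>
  A bounded measurable function is almost everywhere a limit of continuous ones; clipping these
  to the same bound and multiplying by tent functions keeps the convergence dominated and makes
  the approximants vanish at both endpoints, so that they are continuous on the circle.
\<close>

lemma L2_interval_continuous_approx:
  assumes V: "V \<in> L2" and supp: "\<And>x. x \<notin> {c..c+L} \<Longrightarrow> V x = 0" and L: "L > 0" and e: "e > 0"
  shows "\<exists>h. continuous_on UNIV h \<and> (\<forall>x. x \<notin> {c<..<c+L} \<longrightarrow> h x = 0) \<and> h \<in> L2
      \<and> norm_L2 (\<lambda>x. V x - h x) < e"
proof -
  have [measurable]: "V \<in> borel_measurable borel" using V by (simp add: L2_iff)
  have "tendsto_L2 (\<lambda>n x. indicator {x. cmod (V x) \<le> real n} x * V x) V sequentially"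
  proof (rule L2_dominated_convergence[OF V])
    show "AE x in lborel. (\<lambda>n. indicator {x. cmod (V x) \<le> real n} x * V x) \<longlonglongrightarrow> V x"
    proof (rule AE_I2)
      fix x
      obtain m where "cmod (V x) \<le> real m" using real_arch_simple by blast
      then have "\<forall>\<^sub>F n in sequentially. indicator {x. cmod (V x) \<le> real n} x * V x = V x"
        by (intro eventually_sequentiallyI[of m]) (auto simp: indicator_def)
      then show "(\<lambda>n. indicator {x. cmod (V x) \<le> real n} x * V x) \<longlonglongrightarrow> V x"
        by (rule tendsto_eventually)
    qed
  qed (auto simp: indicator_def)
  from tendsto_L2_approx[OF this, of "e/2"] e obtain n where
    n: "(\<lambda>x. indicator {x. cmod (V x) \<le> real n} x * V x) \<in> L2"
      "norm_L2 (\<lambda>x. V x - indicator {x. cmod (V x) \<le> real n} x * V x) < e/2" by auto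
  define W where "W x = indicator {x. cmod (V x) \<le> real n} x * V x" for x
  have WL2: "W \<in> L2" and WV: "norm_L2 (\<lambda>x. V x - W x) < e/2"
    using n by (simp_all add: W_def[abs_def])
  have Wn: "cmod (W x) \<le> real n" for x by (auto simp: W_def indicator_def)
  have Ws: "W x = 0" if "x \<notin> {c..c+L}" for x using supp[OF that] by (simp add: W_def)
  have [measurable]: "W \<in> borel_measurable borel" using WL2 by (simp add: L2_iff)
  have "W \<in> borel_measurable (lebesgue_on UNIV)"
    by (intro measurable_restrict_space1 measurable_completion) simp
  then have "W measurable_on UNIV" by (subst measurable_on_iff_borel_measurable) auto
  then obtain N g where N: "negligible N" and g: "\<And>m. continuous_on UNIV (g m)"
    and gW: "\<And>x. x \<notin> N \<Longrightarrow> (\<lambda>m. g m x) \<longlonglongrightarrow> W x"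
    unfolding measurable_on_def by auto
  define clip :: "complex \<Rightarrow> complex" where "clip = closest_point (cball 0 (real n))"
  have clip_cont: "continuous_on UNIV clip"
    unfolding clip_def by (rule continuous_on_closest_point) auto
  have clip_bound: "cmod (clip z) \<le> real n" for z
    using closest_point_in_set[of "cball (0::complex) (real n)" z] by (simp add: clip_def)
  have clip_id: "clip z = z" if "cmod z \<le> real n" for z
    unfolding clip_def by (rule closest_point_self) (use that in auto)
  define tent where "tent m x = min 1 (real m * max 0 (min (x - c) (c + L - x)))" for m x
  have tent_cont: "continuous_on UNIV (tent m)" for m
    unfolding tent_def by (intro continuous_intros)
  have tent_bound: "0 \<le> tent m x" "tent m x \<le> 1" for m x by (auto simp: tent_def)
  have tent_out: "tent m x = 0" if "x \<notin> {c<..<c+L}" for m x using that by (auto simp: tent_def)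
  have tent_lim: "(\<lambda>m. tent m x) \<longlonglongrightarrow> 1" if "x \<in> {c<..<c+L}" for x
  proof -
    define t where "t = min (x - c) (c + L - x)"
    have "t > 0" using that by (auto simp: t_def)
    then obtain k where "real k * t \<ge> 1" using reals_Archimedean3[of t] by (meson less_imp_le)
    then have "\<forall>\<^sub>F m in sequentially. tent m x = 1"
    proof (intro eventually_sequentiallyI[of k])
      fix m assume "m \<ge> k" and "real k * t \<ge> 1"
      then have "real m * t \<ge> 1" using \<open>t > 0\<close> mult_right_mono[of "real k" "real m" t] by linarith
      then show "tent m x = 1" using \<open>t > 0\<close> by (simp add: tent_def t_def[symmetric])
    qed
    then show ?thesis by (rule tendsto_eventually)
  qed
  define h where "h m x = of_real (tent m x) * clip (g m x)" for m x
  have hcont: "continuous_on UNIV (h m)" for m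
    unfolding h_def
    by (intro continuous_intros tent_cont continuous_on_compose2[OF clip_cont g]) auto
  have box: "(\<lambda>x. complex_of_real (real n) * indicator {c..c+L} x) \<in> L2"
    using L by (intro L2_scale L2_indicator) (auto simp: emeasure_lborel_Icc_eq)
  have "tendsto_L2 h W sequentially"
  proof (rule L2_dominated_convergence[OF box])
    show "h m \<in> borel_measurable borel" for m
      using hcont by (rule borel_measurable_continuous_onI)
    show "AE x in lborel. cmod (h m x) \<le> cmod (complex_of_real (real n) * indicator {c..c+L} x)" for m
    proof (rule AE_I2)
      fix x
      have "cmod (h m x) \<le> 1 * real n"
        unfolding h_def norm_mult using tent_bound[of m x] clip_bound by (intro mult_mono) auto
      moreover have "h m x = 0" if "x \<notin> {c..c+L}"
      proof -
        have "x \<notin> {c<..<c+L}" using that by auto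
        then show ?thesis by (simp add: h_def tent_out)
      qed
      ultimately show "cmod (h m x) \<le> cmod (complex_of_real (real n) * indicator {c..c+L} x)"
        by (cases "x \<in> {c..c+L}") auto
    qed
    have "N \<union> {c, c+L} \<in> null_sets lebesgue"
      using N by (simp add: negligible_iff_null_sets[symmetric])
    then have "AE x in lebesgue. x \<notin> N \<union> {c, c+L}" by (rule AE_not_in)
    then have "AE x in lborel. x \<notin> N \<union> {c, c+L}" by (simp only: AE_completion_iff)
    then show "AE x in lborel. (\<lambda>m. h m x) \<longlonglongrightarrow> W x"
    proof eventually_elim
      case (elim x)
      have lim: "(\<lambda>m. clip (g m x)) \<longlonglongrightarrow> W x"
        using continuous_on_tendsto_compose[OF clip_cont gW] elim clip_id[OF Wn] by auto
      show ?case
      proof (cases "x \<in> {c<..<c+L}")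
        case True
        from tendsto_mult[OF tendsto_of_real[OF tent_lim[OF True]] lim]
        show ?thesis by (simp add: h_def)
      next
        case False
        with elim have "x \<notin> {c..c+L}" by auto
        with False show ?thesis by (simp add: h_def tent_out Ws)
      qed
    qed
  qed simp
  from tendsto_L2_approx[OF this, of "e/2"] e obtain m where
    hm: "h m \<in> L2" "norm_L2 (\<lambda>x. W x - h m x) < e/2" by auto
  have "norm_L2 (\<lambda>x. V x - h m x) < e"
    using norm_L2_triangle_diff[OF V WL2 hm(1)] hm(2) WV by linarith
  then show ?thesis using hcont hm(1) tent_out by (intro exI[of _ "h m"]) (auto simp: h_def)
qed

subsection \<open>Trigonometric polynomials are uniformly dense on the circle\<close>

text \<open>
  Sums of monomials in \<open>exp (2 \<pi> \<i> t)\<close> and its inverse, generated inductively so that closure under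
  products is an induction over both factors.
\<close>

inductive trig_poly :: "(real \<Rightarrow> complex) \<Rightarrow> bool" where
  monomial: "trig_poly (\<lambda>t. c * cis (2 * pi * of_int k * t))"
| add: "trig_poly p \<Longrightarrow> trig_poly q \<Longrightarrow> trig_poly (\<lambda>t. p t + q t)"

lemma trig_poly_mult_monomial:
  "trig_poly p \<Longrightarrow> trig_poly (\<lambda>t. p t * (c * cis (2 * pi * of_int k * t)))"
proof (induction rule: trig_poly.induct)
  case (monomial d l)
  have "(\<lambda>t. d * cis (2 * pi * of_int l * t) * (c * cis (2 * pi * of_int k * t)))
      = (\<lambda>t. (d * c) * cis (2 * pi * of_int (l + k) * t))"
    by (simp add: fun_eq_iff cis_mult[symmetric] algebra_simps)
  then show ?case using trig_poly.monomial[of "d * c" "l + k"] by simp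
qed (simp add: distrib_right trig_poly.add)

lemma trig_poly_mult: "trig_poly q \<Longrightarrow> trig_poly p \<Longrightarrow> trig_poly (\<lambda>t. p t * q t)"
  by (induction rule: trig_poly.induct)
    (auto simp: distrib_left trig_poly_mult_monomial intro: trig_poly.add)

lemma trig_poly_const: "trig_poly (\<lambda>t. c)"
  using trig_poly.monomial[of c 0] by simp

text \<open>
  A real-linear functional of \<open>exp (\<i> s)\<close> is a combination of \<open>exp (\<i> s)\<close> and \<open>exp (- \<i> s)\<close>; sums and
  products of such functions are again trigonometric polynomials.
\<close>

lemma trig_poly_real_polynomial:
  assumes "real_polynomial_function q"
  shows "trig_poly (\<lambda>t. complex_of_real (q (cis (2 * pi * t))))"
  using assms
proof (induction q rule: real_polynomial_function.induct)
  case (linear f)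
  have eq: "complex_of_real (f (cis s)) = (of_real (f 1) - \<i> * of_real (f \<i>)) / 2 * cis s
      + (of_real (f 1) + \<i> * of_real (f \<i>)) / 2 * cis (- s)" for s
  proof -
    interpret bounded_linear f by (rule linear)
    have "cis s = cos s *\<^sub>R 1 + sin s *\<^sub>R \<i>" by (simp add: complex_eq_iff)
    then have "f (cis s) = cos s * f 1 + sin s * f \<i>" by (simp add: add scaleR)
    then show ?thesis by (simp add: complex_eq_iff field_simps)
  qed
  have "trig_poly (\<lambda>t. (of_real (f 1) - \<i> * of_real (f \<i>)) / 2 * cis (2 * pi * of_int 1 * t)
      + (of_real (f 1) + \<i> * of_real (f \<i>)) / 2 * cis (2 * pi * of_int (-1) * t))"
    by (intro trig_poly.intros)
  then show ?case by (simp add: eq)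
qed (auto simp: trig_poly_const intro: trig_poly.add trig_poly_mult)

lemma trig_poly_sum_form:
  "trig_poly p \<Longrightarrow> \<exists>J d. finite J \<and> p = (\<lambda>t. \<Sum>k\<in>J. d k * cis (2 * pi * of_int k * t))"
proof (induction rule: trig_poly.induct)
  case (monomial c k)
  show ?case by (rule exI[of _ "{k}"], rule exI[of _ "\<lambda>_. c"]) simp
next
  case (add p q)
  then obtain J d J' d' where J: "finite J" "p = (\<lambda>t. \<Sum>k\<in>J. d k * cis (2 * pi * of_int k * t))"
    and J': "finite J'" "q = (\<lambda>t. \<Sum>k\<in>J'. d' k * cis (2 * pi * of_int k * t))" by blast
  let ?d = "\<lambda>k. (if k \<in> J then d k else 0) + (if k \<in> J' then d' k else 0)"
  have "p t + q t = (\<Sum>k\<in>J \<union> J'. ?d k * cis (2 * pi * of_int k * t))" for t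
  proof -
    have "p t = (\<Sum>k\<in>J \<union> J'. (if k \<in> J then d k else 0) * cis (2 * pi * of_int k * t))"
      unfolding J(2) using J(1) J'(1) by (intro sum.mono_neutral_cong_left) auto
    moreover have "q t = (\<Sum>k\<in>J \<union> J'. (if k \<in> J' then d' k else 0) * cis (2 * pi * of_int k * t))"
      unfolding J'(2) using J(1) J'(1) by (intro sum.mono_neutral_cong_left) auto
    ultimately show ?thesis by (simp add: distrib_right sum.distrib)
  qed
  then show ?case using J(1) J'(1) by (intro exI[of _ "J \<union> J'"] exI[of _ ?d]) auto
qed

text \<open>
  A function on \<open>[0, 1]\<close> with equal end values descends to the unit circle. It is continuous there
  because the preimage of a closed set is the continuous image of a compact one. On the circle
  the Stone--Weierstrass theorem applies.
\<close>

lemma trig_poly_uniform_approx: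
  fixes g :: "real \<Rightarrow> complex"
  assumes g: "continuous_on {0..1} g" and g01: "g 0 = g 1" and e: "e > 0"
  shows "\<exists>p. trig_poly p \<and> (\<forall>t\<in>{0..1}. cmod (g t - p t) < e)"
proof -
  define c where "c t = cis (2 * pi * t)" for t
  define G where "G z = g (SOME t. t \<in> {0..1} \<and> c t = z)" for z
  have c_inj: "g s = g t" if "s \<in> {0..1}" "t \<in> {0..1}" "c s = c t" for s t
  proof -
    from that(3) have "cis (2 * pi * (s - t)) = 1"
      by (simp add: c_def right_diff_distrib cis_divide[symmetric])
    then have "cos (2 * pi * (s - t)) = 1" by (simp add: complex_eq_iff)
    then obtain n :: int where "2 * pi * (s - t) = of_int n * (2 * pi)"
      unfolding cos_one_2pi_int by auto
    then have "2 * pi * (s - t - of_int n) = 0" by (simp add: algebra_simps)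
    then have st: "s - t = of_int n" by simp
    with that(1,2) have "of_int n \<le> (1::real)" "of_int n \<ge> (-1::real)" by auto
    then have "n = -1 \<or> n = 0 \<or> n = 1" by linarith
    then have "s = t \<or> (s = 0 \<and> t = 1) \<or> (s = 1 \<and> t = 0)" using st that(1,2) by auto
    then show ?thesis using g01 by auto
  qed
  have Gc: "G (c t) = g t" if "t \<in> {0..1}" for t
  proof -
    have "(SOME s. s \<in> {0..1} \<and> c s = c t) \<in> {0..1} \<and> c (SOME s. s \<in> {0..1} \<and> c s = c t) = c t"
      by (rule someI[of "\<lambda>s. s \<in> {0..1} \<and> c s = c t" t]) (use that in auto)
    then show ?thesis unfolding G_def by (intro c_inj) (use that in auto)
  qed
  have circle: "sphere 0 1 = c ` {0..1}"
  proof (intro equalityI subsetI)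
    fix z :: complex assume "z \<in> sphere 0 1"
    then have "z = c (Arg2pi z / (2 * pi))" "0 \<le> Arg2pi z" "Arg2pi z < 2 * pi"
      using Arg2pi[of z] by (auto simp: c_def cis_conv_exp is_Arg_def mult.commute)
    then show "z \<in> c ` {0..1}" by (intro image_eqI) auto
  qed (auto simp: c_def)
  have c_cont: "continuous_on S c" for S
    unfolding c_def by (intro continuous_intros)
  have "continuous_on (sphere 0 1) G"
  proof (subst continuous_on_closed_vimage, simp, intro allI impI)
    fix B :: "complex set" assume B: "closed B"
    have "G -` B \<inter> sphere 0 1 = c ` ({0..1} \<inter> g -` B)"
      unfolding circle using Gc by (auto simp: image_iff)
    moreover have "compact ({0..1} \<inter> g -` B)"
      unfolding compact_eq_bounded_closed
    proof
      show "bounded ({0..1} \<inter> g -` B)"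
        by (rule bounded_subset[OF bounded_closed_interval[of 0 1]]) auto
      show "closed ({0..1} \<inter> g -` B)"
        by (rule continuous_closed_preimage[OF g _ B]) simp
    qed
    ultimately show "closed (G -` B \<inter> sphere 0 1)"
      using compact_continuous_image[OF c_cont] by (auto intro: compact_imp_closed)
  qed
  from Stone_Weierstrass_polynomial_function[OF compact_sphere this e]
  obtain P where P: "polynomial_function P" "\<And>z. z \<in> sphere 0 1 \<Longrightarrow> norm (G z - P z) < e" by blast
  have "trig_poly (\<lambda>t. complex_of_real ((Re \<circ> P) (c t)) + complex_of_real ((Im \<circ> P) (c t)) * \<i>)"
    using P(1) unfolding polynomial_function_def c_def
    by (intro trig_poly.add trig_poly_mult trig_poly_const trig_poly_real_polynomial)
      (simp_all only: bounded_linear_Re bounded_linear_Im)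
  moreover have "complex_of_real ((Re \<circ> P) (c t)) + complex_of_real ((Im \<circ> P) (c t)) * \<i> = P (c t)" for t
    by (simp add: complex_eq_iff)
  ultimately have "trig_poly (\<lambda>t. P (c t))" by simp
  moreover have "cmod (g t - P (c t)) < e" if "t \<in> {0..1}" for t
    using P(2)[of "c t"] Gc[OF that] circle that by auto
  ultimately show ?thesis by blast
qed

subsection \<open>Parseval's identity on an interval\<close>

lemma integral_wave_period:
  assumes L: "L > 0"
  shows "(LINT x|lborel. indicator {c..c+L} x * cis (2 * pi * of_int k * (x / L)))
      = (if k = 0 then complex_of_real L else 0)"
proof (cases "k = 0")
  case True
  have "(LINT x|lborel. complex_of_real (indicator {c..c+L} x)) = complex_of_real L"
    using L by (subst integral_complex_of_real) simp
  then show ?thesis using True by (simp add: of_real_indicator)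
next
  case False
  define w where "w = 2 * pi * of_int k / L"
  have w: "w \<noteq> 0" using False L by (simp add: w_def)
  define F where "F x = cis (w * x) / (\<i> * of_real w)" for x
  have "(LINT x|lborel. indicator {c..c+L} x *\<^sub>R cis (w * x)) = F (c + L) - F c"
  proof (rule integral_FTC_Icc)
    show "(F has_vector_derivative cis (w * x)) (at x within {c..c+L})" for x
    proof -
      have "((\<lambda>x. exp (\<i> * of_real w * of_real x) / (\<i> * of_real w)) has_vector_derivative
          exp (\<i> * of_real w * of_real x)) (at x within {c..c+L})"
        by (rule has_vector_derivative_real_field)
          (use w in \<open>auto intro!: derivative_eq_intros\<close>)
      then show ?thesis by (simp add: F_def[abs_def] cis_conv_exp mult.assoc)
    qed
    show "continuous_on {c..c+L} (\<lambda>x. cis (w * x))" by (intro continuous_intros)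
  qed (use L in simp)
  also have "w * (c + L) = w * c + 2 * pi * of_int k" using L by (simp add: w_def field_simps)
  then have "F (c + L) - F c = 0"
    using cis_multiple_2pi[of "of_int k"] by (simp add: F_def cis_mult[symmetric])
  finally have "(LINT x|lborel. indicator {c..c+L} x *\<^sub>R cis (w * x)) = 0" .
  moreover have "indicator {c..c+L} x * cis (2 * pi * of_int k * (x / L))
      = indicator {c..c+L} x *\<^sub>R cis (w * x)" for x
    by (simp add: w_def indicator_def)
  ultimately show ?thesis using False by simp
qed

lemma has_sum_nonneg_realI:
  fixes f :: "'a \<Rightarrow> real"
  assumes nonneg: "\<And>x. x \<in> A \<Longrightarrow> 0 \<le> f x"
    and upper: "\<And>F. finite F \<Longrightarrow> F \<subseteq> A \<Longrightarrow> sum f F \<le> s"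
    and lower: "\<And>e. e > 0 \<Longrightarrow> \<exists>F. finite F \<and> F \<subseteq> A \<and> s - e < sum f F"
  shows "(f has_sum s) A"
  unfolding has_sum_def
proof (rule order_tendstoI)
  fix a assume "a < s"
  then obtain F where F: "finite F" "F \<subseteq> A" "a < sum f F" using lower[of "s - a"] by auto
  have "a < sum f G" if "finite G" "F \<subseteq> G" "G \<subseteq> A" for G
    using F that sum_mono2[of G F f] nonneg by force
  then show "\<forall>\<^sub>F G in finite_subsets_at_top A. a < sum f G"
    using F unfolding eventually_finite_subsets_at_top by (intro exI[of _ F]) auto
next
  fix a assume "s < a"
  then show "\<forall>\<^sub>F G in finite_subsets_at_top A. sum f G < a"
    using upper unfolding eventually_finite_subsets_at_top
    by (intro exI[of _ "{}"]) force
qed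

text \<open>
  Completing the square: among all combinations of an orthogonal system, the Fourier coefficients
  give the best approximation.
\<close>

lemma norm_L2_orthogonal_combination:
  assumes V: "V \<in> L2" and e: "\<And>k. e k \<in> L2" and L: "L > 0" and J: "finite J"
    and orth: "\<And>k l. inner_L2 (e k) (e l) = (if k = l then complex_of_real L else 0)"
  shows "(norm_L2 (\<lambda>x. V x - (\<Sum>k\<in>J. d k * e k x)))\<^sup>2
      = (norm_L2 V)\<^sup>2 - (\<Sum>k\<in>J. (cmod (inner_L2 V (e k)))\<^sup>2) / L
        + (\<Sum>k\<in>J. (cmod (inner_L2 V (e k) - of_real L * d k))\<^sup>2) / L"
proof -
  define P where "P x = (\<Sum>k\<in>J. (- d k) * e k x)" for x
  have P: "P \<in> L2" unfolding P_def using e by (intro L2_sum L2_scale)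
  have Pe: "inner_L2 P h = (\<Sum>k\<in>J. - d k * inner_L2 (e k) h)" if "h \<in> L2" for h
    unfolding P_def using e that by (subst inner_L2_sum_left) (auto simp only: inner_L2_scale_left)
  have ePl: "inner_L2 (e k) P = - cnj (d k) * of_real L" if "k \<in> J" for k
  proof -
    have "inner_L2 P (e k) = - d k * of_real L"
      using that J by (subst Pe[OF e]) (simp add: orth mult_delta_right sum_negf)
    then show ?thesis by (subst inner_L2_cnj[symmetric]) simp
  qed
  have VP: "inner_L2 V P = (\<Sum>k\<in>J. - cnj (d k) * inner_L2 V (e k))"
    by (subst inner_L2_cnj[symmetric]) (simp add: Pe V inner_L2_cnj)
  have "inner_L2 P P = (\<Sum>k\<in>J. of_real (L * (cmod (d k))\<^sup>2))"
    unfolding Pe[OF P] of_real_mult complex_norm_square by (intro sum.cong refl) (simp add: ePl)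
  then have PP: "(norm_L2 P)\<^sup>2 = (\<Sum>k\<in>J. L * (cmod (d k))\<^sup>2)"
    unfolding inner_L2_self of_real_sum[symmetric] of_real_eq_iff .
  have term_eq: "2 * Re (- cnj (d k) * inner_L2 V (e k)) + L * (cmod (d k))\<^sup>2
      = - ((cmod (inner_L2 V (e k)))\<^sup>2 / L) + (cmod (inner_L2 V (e k) - of_real L * d k))\<^sup>2 / L" for k
    using L unfolding cmod_power2 by (simp add: field_simps power2_eq_square)
  have "(norm_L2 (\<lambda>x. V x - (\<Sum>k\<in>J. d k * e k x)))\<^sup>2 = (norm_L2 (\<lambda>x. V x + P x))\<^sup>2"
    by (simp add: P_def sum_negf)
  also have "\<dots> = (norm_L2 V)\<^sup>2 + (\<Sum>k\<in>J. 2 * Re (- cnj (d k) * inner_L2 V (e k)) + L * (cmod (d k))\<^sup>2)"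
    by (simp only: norm_L2_add_square[OF V P] VP PP Re_sum sum.distrib sum_distrib_left)
  also have "\<dots> = (norm_L2 V)\<^sup>2 - (\<Sum>k\<in>J. (cmod (inner_L2 V (e k)))\<^sup>2) / L
        + (\<Sum>k\<in>J. (cmod (inner_L2 V (e k) - of_real L * d k))\<^sup>2) / L"
    unfolding term_eq sum.distrib by (simp add: sum_negf sum_divide_distrib)
  finally show ?thesis .
qed

text \<open>
  With the Fourier coefficients as coefficients, completing the square gives Bessel's inequality. With
  those of a trigonometric polynomial close to \<open>V\<close> it shows that the missing part of the sum is
  arbitrarily small.
\<close>

theorem Parseval_interval:
  assumes V: "V \<in> L2" and supp: "\<And>x. x \<notin> {c..c+L} \<Longrightarrow> V x = 0" and L: "L > 0"
  shows "((\<lambda>k::int. (cmod (fourier_L1 V (of_int k / L)))\<^sup>2) has_sum L * (norm_L2 V)\<^sup>2) UNIV"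
proof -
  define e where "e k x = indicator {c..c+L} x * cis (2 * pi * of_int k * (x / L))" for k :: int and x
  have cis_meas [measurable]: "cis \<in> borel_measurable borel"
    by (intro borel_measurable_continuous_onI continuous_intros)
  have e: "e k \<in> L2" for k
  proof -
    have "(cmod (e k x))\<^sup>2 = indicator {c..c+L} x" for x
      by (simp add: e_def norm_mult indicator_def)
    moreover have "e k \<in> borel_measurable borel" unfolding e_def[abs_def] by measurable
    ultimately show ?thesis using L
      by (simp add: L2_iff integrable_indicator_iff emeasure_lborel_Icc_eq)
  qed
  have orth: "inner_L2 (e k) (e l) = (if k = l then complex_of_real L else 0)" for k l
  proof -
    have "inner_L2 (e k) (e l)
        = (LINT x|lborel. indicator {c..c+L} x * cis (2 * pi * of_int (k - l) * (x / L)))"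
      unfolding inner_L2_def
      by (intro Bochner_Integration.integral_cong)
        (auto simp: e_def indicator_def cis_cnj cis_mult algebra_simps diff_divide_distrib)
    then show ?thesis using integral_wave_period[OF L, of c "k - l"] by simp
  qed
  have coeff: "inner_L2 V (e k) = fourier_L1 V (of_int k / L)" for k
    unfolding inner_L2_def fourier_L1_wave wave_def e_def using supp
    by (intro Bochner_Integration.integral_cong) (auto simp: indicator_def cis_cnj mult_ac)
  have best: "(norm_L2 V)\<^sup>2 - (\<Sum>k\<in>J. (cmod (inner_L2 V (e k)))\<^sup>2) / L
      \<le> (norm_L2 (\<lambda>x. V x - (\<Sum>k\<in>J. d k * e k x)))\<^sup>2" if "finite J" for J d
    unfolding norm_L2_orthogonal_combination[OF V e L that orth] using L by (simp add: sum_nonneg)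
  show ?thesis
  proof (rule has_sum_nonneg_realI)
    fix J :: "int set" assume J: "finite J"
    let ?d = "\<lambda>k. inner_L2 V (e k) / of_real L"
    have "0 \<le> (norm_L2 V)\<^sup>2 - (\<Sum>k\<in>J. (cmod (inner_L2 V (e k)))\<^sup>2) / L"
      using norm_L2_orthogonal_combination[OF V e L J orth, of ?d] L
      zero_le_power2[of "norm_L2 (\<lambda>x. V x - (\<Sum>k\<in>J. ?d k * e k x))"] by simp
    then show "(\<Sum>k\<in>J. (cmod (fourier_L1 V (of_int k / L)))\<^sup>2) \<le> L * (norm_L2 V)\<^sup>2"
      using L by (simp add: coeff field_simps)
  next
    fix r :: real assume r: "r > 0"
    \<comment> \<open>\<open>\<epsilon>\<close> for the passage to \<open>h\<close>, \<open>\<epsilon> sqrt L\<close> for that to \<open>p\<close>; the total has to stay below \<open>sqrt (r / L)\<close>\<close>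
    define \<epsilon> where "\<epsilon> = sqrt (r / L) / (1 + sqrt L + 1)"
    have \<epsilon>: "\<epsilon> > 0" using r L by (simp add: \<epsilon>_def add_pos_pos)
    obtain h where h: "continuous_on UNIV h" "\<And>x. x \<notin> {c<..<c+L} \<Longrightarrow> h x = 0" "h \<in> L2"
      "norm_L2 (\<lambda>x. V x - h x) < \<epsilon>"
      using L2_interval_continuous_approx[OF V supp L \<epsilon>] by blast
    have "continuous_on {0..1} (\<lambda>t. h (c + L * t))"
      by (rule continuous_on_compose2[OF h(1)]) (auto intro!: continuous_intros)
    then obtain p where p: "trig_poly p" "\<And>t. t \<in> {0..1} \<Longrightarrow> cmod (h (c + L * t) - p t) < \<epsilon>"
      using trig_poly_uniform_approx[OF _ _ \<epsilon>, of "\<lambda>t. h (c + L * t)"] h(2)[of c] h(2)[of "c+L"] by auto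
    from trig_poly_sum_form[OF p(1)] obtain J d where J: "finite J"
      and p_eq: "p = (\<lambda>t. \<Sum>k\<in>J. d k * cis (2 * pi * of_int k * t))" by blast
    define d' where "d' k = d k * cis (- (2 * pi * of_int k * (c / L)))" for k
    have PL2: "(\<lambda>x. \<Sum>k\<in>J. d' k * e k x) \<in> L2" using e by (intro L2_sum L2_scale)
    have P_in: "(\<Sum>k\<in>J. d' k * e k x) = p ((x - c) / L)" if "x \<in> {c..c+L}" for x
      unfolding p_eq d'_def e_def using that
      by (intro sum.cong refl) (simp add: cis_mult algebra_simps diff_divide_distrib)
    have "norm_L2 (\<lambda>x. h x - (\<Sum>k\<in>J. d' k * e k x)) \<le> norm_L2 (\<lambda>x. of_real \<epsilon> * e 0 x)"
    proof (rule norm_L2_mono[OF L2_scale[OF e]])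
      show "(\<lambda>x. h x - (\<Sum>k\<in>J. d' k * e k x)) \<in> borel_measurable borel"
        using L2_diff[OF h(3) PL2] by (rule L2_measurable)
      show "AE x in lborel. cmod (h x - (\<Sum>k\<in>J. d' k * e k x)) \<le> cmod (of_real \<epsilon> * e 0 x)"
      proof (rule AE_I2)
        fix x
        show "cmod (h x - (\<Sum>k\<in>J. d' k * e k x)) \<le> cmod (of_real \<epsilon> * e 0 x)"
        proof (cases "x \<in> {c..c+L}")
          case True
          then have "(x - c) / L \<in> {0..1}" using L by (auto simp: field_simps)
          from p(2)[OF this] have "cmod (h x - p ((x - c) / L)) < \<epsilon>" using L by simp
          then show ?thesis using P_in[OF True] True \<epsilon> by (simp add: e_def norm_mult)
        next
          case False
          then have "e k x = 0" for k by (simp add: e_def)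
          then show ?thesis using h(2)[of x] False by auto
        qed
      qed
    qed
    also have "\<dots> = \<epsilon> * sqrt L"
    proof -
      have "(norm_L2 (e 0))\<^sup>2 = L" using orth[of 0 0] unfolding inner_L2_self by (simp only: of_real_eq_iff if_True refl)
      then have "norm_L2 (e 0) = sqrt L" by (metis norm_L2_nonneg real_sqrt_unique)
      then show ?thesis using \<epsilon> by (simp add: norm_L2_scale)
    qed
    finally have "norm_L2 (\<lambda>x. V x - (\<Sum>k\<in>J. d' k * e k x)) < \<epsilon> + \<epsilon> * sqrt L"
      using norm_L2_triangle_diff[OF V h(3) PL2] h(4) by linarith
    also have "\<dots> \<le> sqrt (r / L)"
    proof -
      have "\<epsilon> * (1 + sqrt L + 1) = sqrt (r / L)" using L by (simp add: \<epsilon>_def add_pos_pos less_imp_neq[symmetric])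
      then show ?thesis using \<epsilon> by (simp add: algebra_simps)
    qed
    finally have "(norm_L2 (\<lambda>x. V x - (\<Sum>k\<in>J. d' k * e k x)))\<^sup>2 < (sqrt (r / L))\<^sup>2"
      by (intro power_strict_mono) auto
    with best[OF J, of d'] have "(norm_L2 V)\<^sup>2 - (\<Sum>k\<in>J. (cmod (inner_L2 V (e k)))\<^sup>2) / L < r / L"
      using r L by simp
    from mult_strict_left_mono[OF this L] have "L * (norm_L2 V)\<^sup>2 - r < (\<Sum>k\<in>J. (cmod (fourier_L1 V (of_int k / L)))\<^sup>2)"
      using L by (simp add: coeff right_diff_distrib)
    then show "\<exists>J. finite J \<and> J \<subseteq> UNIV \<and>
        L * (norm_L2 V)\<^sup>2 - r < (\<Sum>k\<in>J. (cmod (fourier_L1 V (of_int k / L)))\<^sup>2)"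
      using J by blast
  qed simp
qed

section \<open>Plancherel's theorem\<close>

subsection \<open>Splitting integrals into periodic cells\<close>

lemma has_sum_imp_nn_integral_count_space:
  fixes f :: "'a \<Rightarrow> real"
  assumes "(f has_sum s) A" and "\<And>x. x \<in> A \<Longrightarrow> 0 \<le> f x"
  shows "(\<integral>\<^sup>+x. ennreal (f x) \<partial>count_space A) = ennreal s"
proof -
  have "f summable_on A" using assms(1) by (auto simp: summable_on_def)
  then have "Infinite_Set_Sum.abs_summable_on f A"
    using assms(2) summable_on_iff_abs_summable_on_real[of f A] abs_summable_equivalent[of f A] by simp
  then show ?thesis
    using nn_integral_conv_infsetsum[of f A] infsetsum_infsum[of f A] infsumI[OF assms(1)] assms(2)
    by simp
qed

lemma in_cell_iff:
  assumes "l > 0"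
  shows "x \<in> {of_int k * l..<of_int k * l + l} \<longleftrightarrow> k = \<lfloor>x / l\<rfloor>"
proof -
  have "x \<in> {of_int k * l..<of_int k * l + l} \<longleftrightarrow> of_int k \<le> x / l \<and> x / l < of_int k + 1"
    using assms by (simp add: field_simps)
  also have "\<dots> \<longleftrightarrow> k = \<lfloor>x / l\<rfloor>" using floor_eq_iff[of "x / l" k] by (auto simp del: floor_divide_of_int_eq)
  finally show ?thesis .
qed

text \<open>
  An integral over the line is the integral over one cell of the sum over its translates. It turns
  Parseval's identity for the samples at \<open>t + k / L\<close>, which holds for every \<open>t\<close>, into Plancherel's.
\<close>

lemma nn_integral_cells:
  fixes g :: "real \<Rightarrow> ennreal"
  assumes [measurable]: "g \<in> borel_measurable borel" and l: "l > 0"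
  shows "(\<integral>\<^sup>+x. g x \<partial>lborel)
      = (\<integral>\<^sup>+t. (\<integral>\<^sup>+k. g (t + of_int k * l) \<partial>count_space UNIV) * indicator {0..<l} t \<partial>lborel)"
proof -
  have cell: "(\<integral>\<^sup>+k. g x * indicator {of_int k * l..<of_int k * l + l} x \<partial>count_space (UNIV :: int set)) = g x"
    for x :: real
  proof -
    have "(\<integral>\<^sup>+k. g x * indicator {of_int k * l..<of_int k * l + l} x \<partial>count_space (UNIV :: int set))
        = (\<integral>\<^sup>+k. g x * indicator {\<lfloor>x / l\<rfloor>} k \<partial>count_space (UNIV :: int set))"
      by (intro nn_integral_cong) (simp only: indicator_def in_cell_iff[OF l] singleton_iff)
    also have "\<dots> = g x" by (subst nn_integral_cmult_indicator) auto
    finally show ?thesis .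
  qed
  have "(\<integral>\<^sup>+x. g x \<partial>lborel)
      = (\<integral>\<^sup>+x. \<integral>\<^sup>+k. g x * indicator {of_int k * l..<of_int k * l + l} x \<partial>count_space (UNIV :: int set) \<partial>lborel)"
    by (simp only: cell)
  also have "\<dots> = (\<integral>\<^sup>+k. \<integral>\<^sup>+x. g x * indicator {of_int k * l..<of_int k * l + l} x \<partial>lborel \<partial>count_space (UNIV :: int set))"
    by (rule nn_integral_count_space_nn_integral) auto
  also have "\<dots> = (\<integral>\<^sup>+k. \<integral>\<^sup>+t. g (t + of_int k * l) * indicator {0..<l} t \<partial>lborel \<partial>count_space (UNIV :: int set))"
  proof (rule nn_integral_cong)
    fix k :: int
    have "(\<integral>\<^sup>+x. g x * indicator {of_int k * l..<of_int k * l + l} x \<partial>lborel)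
      = (\<integral>\<^sup>+t. g (of_int k * l + 1 * t) * indicator {of_int k * l..<of_int k * l + l} (of_int k * l + 1 * t) \<partial>lborel)"
      by (subst nn_integral_real_affine[where c=1 and t="of_int k * l"]) auto
    also have "\<dots> = (\<integral>\<^sup>+t. g (t + of_int k * l) * indicator {0..<l} t \<partial>lborel)"
      by (intro nn_integral_cong) (simp add: indicator_def add.commute)
    finally show "(\<integral>\<^sup>+x. g x * indicator {of_int k * l..<of_int k * l + l} x \<partial>lborel)
      = (\<integral>\<^sup>+t. g (t + of_int k * l) * indicator {0..<l} t \<partial>lborel)" .
  qed
  also have "\<dots> = (\<integral>\<^sup>+t. \<integral>\<^sup>+k. g (t + of_int k * l) * indicator {0..<l} t \<partial>count_space (UNIV :: int set) \<partial>lborel)"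
    by (rule nn_integral_count_space_nn_integral[symmetric]) auto
  also have "\<dots> = (\<integral>\<^sup>+t. (\<integral>\<^sup>+k. g (t + of_int k * l) \<partial>count_space UNIV) * indicator {0..<l} t \<partial>lborel)"
    by (intro nn_integral_cong nn_integral_multc) auto
  finally show ?thesis .
qed

subsection \<open>The Fourier integral\<close>

lemma fourier_L1_measurable [measurable]:
  assumes [measurable]: "f \<in> borel_measurable borel"
  shows "fourier_L1 f \<in> borel_measurable borel"
proof -
  have "(\<lambda>\<gamma>. LINT x|lborel. f x * wave \<gamma> x) \<in> borel_measurable borel"
    by (rule lborel.borel_measurable_lebesgue_integral) measurable
  then show ?thesis by (simp add: fourier_L1_wave[abs_def])
qed

lemma fourier_L1_add:
  "integrable lborel f \<Longrightarrow> integrable lborel g \<Longrightarrow>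
    fourier_L1 (\<lambda>x. f x + g x) = (\<lambda>\<gamma>. fourier_L1 f \<gamma> + fourier_L1 g \<gamma>)"
  by (simp add: fun_eq_iff fourier_L1_wave distrib_right integrable_mult_wave)

lemma fourier_L1_diff:
  "integrable lborel f \<Longrightarrow> integrable lborel g \<Longrightarrow>
    fourier_L1 (\<lambda>x. f x - g x) = (\<lambda>\<gamma>. fourier_L1 f \<gamma> - fourier_L1 g \<gamma>)"
  by (simp add: fun_eq_iff fourier_L1_wave left_diff_distrib integrable_mult_wave)

lemma fourier_L1_scale: "fourier_L1 (\<lambda>x. c * f x) \<gamma> = c * fourier_L1 f \<gamma>"
  by (simp add: fourier_L1_wave mult.assoc)

lemma fourier_L1_cnj: "fourier_L1 (\<lambda>x. cnj (f x)) \<gamma> = cnj (fourier_L1 f (- \<gamma>))"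
  unfolding fourier_L1_wave Bochner_Integration.integral_cnj[symmetric] by (simp add: cnj_wave)

lemma fourier_L1_shift: "fourier_L1 (\<lambda>x. f x * wave t x) \<gamma> = fourier_L1 f (t + \<gamma>)"
  by (simp add: fourier_L1_wave wave_add_freq mult.assoc)

lemma fourier_L1_affine:
  assumes s: "s > 0"
  shows "fourier_L1 (\<lambda>x. of_real (sqrt s) * f (s * x - t)) \<gamma>
      = of_real (1 / sqrt s) * wave (\<gamma> / s) t * fourier_L1 f (\<gamma> / s)"
proof -
  have "fourier_L1 (\<lambda>x. of_real (sqrt s) * f (s * x - t)) \<gamma>
      = of_real (sqrt s) * (LINT x|lborel. f (s * x - t) * wave \<gamma> x)"
    by (simp add: fourier_L1_wave mult.assoc)
  also have "(LINT x|lborel. f (s * x - t) * wave \<gamma> x)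
      = of_real (1 / s) * (LINT y|lborel. f y * (wave (\<gamma> / s) t * wave (\<gamma> / s) y))"
  proof -
    have "wave \<gamma> (t / s + 1 / s * y) = wave (\<gamma> / s) t * wave (\<gamma> / s) y" for y
      using s by (simp add: wave_def cis_mult add_divide_distrib algebra_simps)
    then show ?thesis
      using s by (subst lborel_integral_real_affine[where c="1/s" and t="t/s"])
        (simp_all add: scaleR_conv_of_real distrib_left)
  qed
  also have "\<dots> = of_real (1 / s) * (wave (\<gamma> / s) t * fourier_L1 f (\<gamma> / s))"
    unfolding fourier_L1_wave
    by (subst integral_mult_right_zero[of _ "wave (\<gamma> / s) t", symmetric]) (simp add: mult_ac)
  finally have eq: "fourier_L1 (\<lambda>x. of_real (sqrt s) * f (s * x - t)) \<gamma>
      = of_real (sqrt s) * of_real (1 / s) * (wave (\<gamma> / s) t * fourier_L1 f (\<gamma> / s))"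
    by (simp only: mult.assoc)
  have "sqrt s * (1 / s) = 1 / sqrt s" using s by (simp add: real_div_sqrt field_simps)
  then have "complex_of_real (sqrt s) * of_real (1 / s) = of_real (1 / sqrt s)"
    unfolding of_real_mult[symmetric] by (simp only:)
  then show ?thesis unfolding eq by (simp only: mult.assoc)
qed

text \<open>
  Fubini's theorem applies since \<open>f\<close> and \<open>g\<close> are integrable and the kernel is symmetric and bounded.
\<close>

lemma fourier_L1_multiplication:
  assumes f: "integrable lborel f" and g: "integrable lborel g"
  shows "(LINT x|lborel. fourier_L1 f x * g x) = (LINT x|lborel. f x * fourier_L1 g x)"
proof -
  have [measurable]: "f \<in> borel_measurable borel" "g \<in> borel_measurable borel"
    using f g by (auto dest: borel_measurable_integrable)
  let ?k = "\<lambda>x y. f y * wave x y * g x"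
  have ae: "integrable lborel (?k x)" for x
    using integrable_mult_wave[OF f] by simp
  have "integrable (lborel \<Otimes>\<^sub>M lborel) (\<lambda>(x, y). ?k x y)"
  proof (rule lborel_pair.Fubini_integrable)
    have "(LINT y|lborel. norm (case (x, y) of (x, y) \<Rightarrow> ?k x y)) = (LINT y|lborel. cmod (f y)) * cmod (g x)" for x
      by (simp add: norm_mult)
    then show "integrable lborel (\<lambda>x. LINT y|lborel. norm (case (x, y) of (x, y) \<Rightarrow> ?k x y))"
      using g by simp
  qed (use ae in auto)
  from lborel_pair.Fubini_integral[OF this]
  have "(LINT y|lborel. LINT x|lborel. ?k x y) = (LINT x|lborel. LINT y|lborel. ?k x y)" by simp
  moreover have "(LINT x|lborel. ?k x y) = f y * fourier_L1 g y" for y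
    unfolding fourier_L1_wave wave_commute[of y]
    by (subst integral_mult_right_zero[symmetric]) (simp add: mult_ac)
  ultimately show ?thesis by (simp add: fourier_L1_wave)
qed

subsection \<open>The isometry\<close>

text \<open>
  By Parseval's identity the squares of the samples of the transform on every translate of the
  lattice of mesh \<open>1 / L\<close> have the same sum; averaging over the translates gives the integral.
\<close>

lemma Plancherel_compact_support:
  assumes V: "V \<in> L2" and supp: "\<And>x. x \<notin> {c..c+L} \<Longrightarrow> V x = 0" and L: "L > 0"
  shows "fourier_L1 V \<in> L2" "norm_L2 (fourier_L1 V) = norm_L2 V"
proof -
  have [measurable]: "V \<in> borel_measurable borel" using V by (simp add: L2_iff)
  have samples: "(\<integral>\<^sup>+k. ennreal ((cmod (fourier_L1 V (t + of_int k * (1 / L))))\<^sup>2) \<partial>count_space UNIV)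
      = ennreal (L * (norm_L2 V)\<^sup>2)" for t
  proof -
    have Vt: "(\<lambda>x. V x * wave t x) \<in> L2"
      by (rule L2_dominated[OF V]) (auto simp: norm_mult)
    have "norm_L2 (\<lambda>x. V x * wave t x) = norm_L2 V"
      by (simp add: norm_L2_def norm_mult)
    with Parseval_interval[OF Vt _ L, of c] supp
    have "((\<lambda>k::int. (cmod (fourier_L1 V (t + of_int k / L)))\<^sup>2) has_sum L * (norm_L2 V)\<^sup>2) UNIV"
      by (simp add: fourier_L1_shift)
    from has_sum_imp_nn_integral_count_space[OF this] show ?thesis by simp
  qed
  have "(\<integral>\<^sup>+x. ennreal ((cmod (fourier_L1 V x))\<^sup>2) \<partial>lborel)
      = (\<integral>\<^sup>+t. ennreal (L * (norm_L2 V)\<^sup>2) * indicator {0..<1 / L} t \<partial>lborel)"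
    using L by (subst nn_integral_cells[where l="1/L"]) (auto simp only: samples, measurable)
  also have "\<dots> = ennreal ((norm_L2 V)\<^sup>2)"
    using L by (subst nn_integral_cmult_indicator) (simp_all add: ennreal_mult[symmetric])
  finally have *: "(\<integral>\<^sup>+x. ennreal ((cmod (fourier_L1 V x))\<^sup>2) \<partial>lborel) = ennreal ((norm_L2 V)\<^sup>2)" .
  show L2: "fourier_L1 V \<in> L2" by (rule L2_nn_boundI(1)[where c="(norm_L2 V)\<^sup>2"]) (auto simp: *)
  have "(norm_L2 (fourier_L1 V))\<^sup>2 = (norm_L2 V)\<^sup>2" using nn_norm_L2[OF L2] * by simp
  then show "norm_L2 (fourier_L1 V) = norm_L2 V" by simp
qed

lemma Plancherel_bounded_support:
  assumes "V \<in> L2" "\<And>x. \<bar>x\<bar> > R \<Longrightarrow> V x = 0"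
  shows "fourier_L1 V \<in> L2 \<and> norm_L2 (fourier_L1 V) = norm_L2 V"
proof -
  have "0 < 2 * (\<bar>R\<bar> + 1)" by simp
  moreover have "V x = 0" if "x \<notin> {- (\<bar>R\<bar> + 1)..- (\<bar>R\<bar> + 1) + 2 * (\<bar>R\<bar> + 1)}" for x
  proof -
    have "\<bar>x\<bar> > R" using that by auto
    then show ?thesis by (rule assms(2))
  qed
  ultimately show ?thesis using Plancherel_compact_support[OF assms(1)] by blast
qed

definition trunc :: "nat \<Rightarrow> (real \<Rightarrow> complex) \<Rightarrow> real \<Rightarrow> complex" where
  "trunc n f x = indicator {- real n..real n} x * f x"

lemma trunc_eq_0: "\<bar>x\<bar> > real n \<Longrightarrow> trunc n f x = 0"
  by (auto simp: trunc_def indicator_def)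

lemma trunc_L2: "f \<in> L2 \<Longrightarrow> trunc n f \<in> L2"
  unfolding trunc_def[abs_def] by (rule L2_restrict) auto

lemma trunc_integrable: "f \<in> L2 \<Longrightarrow> integrable lborel (trunc n f)"
  unfolding trunc_def[abs_def]
  by (rule L2_integrable_mult) (auto intro!: L2_indicator simp: emeasure_lborel_Icc_eq)

lemma trunc_tendsto: "(\<lambda>n. trunc n f x) \<longlonglongrightarrow> f x"
proof -
  obtain m where "\<bar>x\<bar> \<le> real m" using real_arch_simple by blast
  then have "\<forall>\<^sub>F n in sequentially. trunc n f x = f x"
    by (intro eventually_sequentiallyI[of m]) (auto simp: trunc_def indicator_def abs_le_iff)
  then show ?thesis by (rule tendsto_eventually)
qed

lemma norm_trunc_le: "cmod (trunc n f x) \<le> cmod (f x)"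
  by (simp add: trunc_def norm_mult indicator_def)

lemma trunc_tendsto_L2: 
  assumes "f \<in> L2" shows "tendsto_L2 (\<lambda>n. trunc n f) f sequentially"
  by (rule L2_dominated_convergence[OF assms])
    (use assms trunc_tendsto in \<open>auto simp: norm_trunc_le intro: L2_measurable trunc_L2\<close>)

lemma trunc_fourier_convergent:
  assumes f: "f \<in> L2"
  shows "\<exists>g. tendsto_L2 (\<lambda>n. fourier_L1 (trunc n f)) g sequentially"
proof (rule L2_complete)
  show "fourier_L1 (trunc n f) \<in> L2" for n
    using Plancherel_bounded_support[OF trunc_L2[OF f], of "real n" n] by (simp add: trunc_eq_0)
  fix e :: real assume "e > 0"
  then have "\<forall>\<^sub>F n in sequentially. norm_L2 (\<lambda>x. trunc n f x - f x) < e / 2"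
    using trunc_tendsto_L2[OF f] unfolding tendsto_L2_def by (intro order_tendstoD(2)) auto
  then obtain M where M: "\<And>n. n \<ge> M \<Longrightarrow> norm_L2 (\<lambda>x. trunc n f x - f x) < e / 2"
    unfolding eventually_sequentially by blast
  have "norm_L2 (\<lambda>x. fourier_L1 (trunc m f) x - fourier_L1 (trunc n f) x) < e"
    if "m \<ge> M" "n \<ge> M" for m n
  proof -
    have "norm_L2 (\<lambda>x. fourier_L1 (trunc m f) x - fourier_L1 (trunc n f) x)
        = norm_L2 (fourier_L1 (\<lambda>x. trunc m f x - trunc n f x))"
      using trunc_integrable[OF f] by (simp add: fourier_L1_diff)
    also have "\<dots> = norm_L2 (\<lambda>x. trunc m f x - trunc n f x)"
      using Plancherel_bounded_support[OF L2_diff[OF trunc_L2[OF f] trunc_L2[OF f]], of "real (max m n)" m n]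
      by (simp add: trunc_eq_0)
    also have "\<dots> \<le> norm_L2 (\<lambda>x. trunc m f x - f x) + norm_L2 (\<lambda>x. f x - trunc n f x)"
      by (rule norm_L2_triangle_diff[OF trunc_L2[OF f] f trunc_L2[OF f]])
    also have "\<dots> < e" using M[OF that(1)] M[OF that(2)] norm_L2_minus_commute[of f "trunc n f"] by simp
    finally show ?thesis .
  qed
  then show "\<exists>M. \<forall>m\<ge>M. \<forall>n\<ge>M. norm_L2 (\<lambda>x. fourier_L1 (trunc m f) x - fourier_L1 (trunc n f) x) < e"
    by blast
qed

text \<open>
  The transforms of the truncations converge in mean square by completeness, and pointwise to the
  Fourier integral of \<open>f\<close> by dominated convergence. The two limits agree almost everywhere.
\<close>

theorem Plancherel_L1:
  assumes f1: "integrable lborel f" and f2: "f \<in> L2"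
  shows "fourier_L1 f \<in> L2" "norm_L2 (fourier_L1 f) = norm_L2 f"
proof -
  have [measurable]: "f \<in> borel_measurable borel" using f2 by (simp add: L2_iff)
  have iso: "fourier_L1 (trunc n f) \<in> L2 \<and> norm_L2 (fourier_L1 (trunc n f)) = norm_L2 (trunc n f)" for n
    using Plancherel_bounded_support[OF trunc_L2[OF f2], of "real n" n] by (simp add: trunc_eq_0)
  obtain g where g: "tendsto_L2 (\<lambda>n. fourier_L1 (trunc n f)) g sequentially"
    using trunc_fourier_convergent[OF f2] by blast
  have pw: "(\<lambda>n. fourier_L1 (trunc n f) \<gamma>) \<longlonglongrightarrow> fourier_L1 f \<gamma>" for \<gamma>
    unfolding fourier_L1_wave
  proof (rule integral_dominated_convergence)
    show "integrable lborel (\<lambda>x. cmod (f x))" using f1 by simp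
    show "AE x in lborel. (\<lambda>n. trunc n f x * wave \<gamma> x) \<longlonglongrightarrow> f x * wave \<gamma> x"
      by (intro AE_I2 tendsto_mult trunc_tendsto tendsto_const)
    show "(\<lambda>x. trunc n f x * wave \<gamma> x) \<in> borel_measurable lborel" for n
      unfolding trunc_def by measurable
  qed (auto simp: norm_mult trunc_def indicator_def)
  have "AE x in lborel. g x = fourier_L1 f x"
    by (rule tendsto_L2_pointwise_limit_AE[OF g]) (use iso pw in auto)
  from tendsto_L2_cong_AE[OF g _ this]
  have lim: "tendsto_L2 (\<lambda>n. fourier_L1 (trunc n f)) (fourier_L1 f) sequentially" by simp
  then show "fourier_L1 f \<in> L2" by (simp add: tendsto_L2_def)
  have "(\<lambda>n. norm_L2 (trunc n f)) \<longlonglongrightarrow> norm_L2 (fourier_L1 f)"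
    using tendsto_L2_norm[OF lim] iso by simp
  then show "norm_L2 (fourier_L1 f) = norm_L2 f"
    using tendsto_L2_norm[OF trunc_tendsto_L2[OF f2]] LIMSEQ_unique by blast
qed

subsection \<open>The extension to all square-integrable functions\<close>

lemma has_fourier_L2_D: "has_fourier_L2 f g \<Longrightarrow> f \<in> L2 \<and> g \<in> L2"
  by (auto simp: has_fourier_L2_def tendsto_L2_def)

lemma has_fourier_L2_I:
  assumes "\<And>n. integrable lborel (s n)" "tendsto_L2 s f sequentially"
    "tendsto_L2 (\<lambda>n. fourier_L1 (s n)) g sequentially"
  shows "has_fourier_L2 f g"
  using assms by (auto simp: has_fourier_L2_def)

lemma has_fourier_L2_exists: "f \<in> L2 \<Longrightarrow> \<exists>g. has_fourier_L2 f g"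
  using has_fourier_L2_I[OF trunc_integrable trunc_tendsto_L2] trunc_fourier_convergent by blast

lemma has_fourier_L2_norm:
  assumes "has_fourier_L2 f g" shows "norm_L2 g = norm_L2 f"
proof -
  obtain s where s: "\<And>n. integrable lborel (s n)" "tendsto_L2 s f sequentially"
    "tendsto_L2 (\<lambda>n. fourier_L1 (s n)) g sequentially"
    using assms by (auto simp: has_fourier_L2_def)
  have "\<forall>\<^sub>F n in sequentially. s n \<in> L2" using s(2) by (simp add: tendsto_L2_def)
  then have "\<forall>\<^sub>F n in sequentially. norm_L2 (fourier_L1 (s n)) = norm_L2 (s n)"
    by eventually_elim (rule Plancherel_L1(2)[OF s(1)])
  with tendsto_L2_norm[OF s(3)] have "(\<lambda>n. norm_L2 (s n)) \<longlonglongrightarrow> norm_L2 g"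
    by (rule Lim_transform_eventually)
  with tendsto_L2_norm[OF s(2)] show ?thesis using LIMSEQ_unique by blast
qed

lemma has_fourier_L2_add:
  assumes "has_fourier_L2 f g" "has_fourier_L2 f' g'"
  shows "has_fourier_L2 (\<lambda>x. f x + f' x) (\<lambda>x. g x + g' x)"
proof -
  obtain s s' where s: "\<And>n. integrable lborel (s n)" "tendsto_L2 s f sequentially"
    "tendsto_L2 (\<lambda>n. fourier_L1 (s n)) g sequentially"
    and s': "\<And>n. integrable lborel (s' n)" "tendsto_L2 s' f' sequentially"
    "tendsto_L2 (\<lambda>n. fourier_L1 (s' n)) g' sequentially"
    using assms by (auto simp: has_fourier_L2_def)
  show ?thesis
  proof (rule has_fourier_L2_I)
    show "integrable lborel (\<lambda>x. s n x + s' n x)" for n using s(1) s'(1) by simp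
    show "tendsto_L2 (\<lambda>n. fourier_L1 (\<lambda>x. s n x + s' n x)) (\<lambda>x. g x + g' x) sequentially"
      using tendsto_L2_add[OF s(3) s'(3)] s(1) s'(1) by (simp add: fourier_L1_add)
  qed (rule tendsto_L2_add[OF s(2) s'(2)])
qed

lemma has_fourier_L2_scale:
  assumes "has_fourier_L2 f g"
  shows "has_fourier_L2 (\<lambda>x. c * f x) (\<lambda>x. c * g x)"
proof -
  obtain s where s: "\<And>n. integrable lborel (s n)" "tendsto_L2 s f sequentially"
    "tendsto_L2 (\<lambda>n. fourier_L1 (s n)) g sequentially"
    using assms by (auto simp: has_fourier_L2_def)
  show ?thesis
  proof (rule has_fourier_L2_I)
    show "integrable lborel (\<lambda>x. c * s n x)" for n using s(1) by simp
    show "tendsto_L2 (\<lambda>n. fourier_L1 (\<lambda>x. c * s n x)) (\<lambda>x. c * g x) sequentially"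
      using tendsto_L2_scale[OF s(3)] by (simp add: fourier_L1_scale[abs_def])
  qed (rule tendsto_L2_scale[OF s(2)])
qed

lemma has_fourier_L2_diff:
  assumes "has_fourier_L2 f g" "has_fourier_L2 f' g'"
  shows "has_fourier_L2 (\<lambda>x. f x - f' x) (\<lambda>x. g x - g' x)"
  using has_fourier_L2_add[OF assms(1) has_fourier_L2_scale[OF assms(2), of "-1"]] by simp

lemma has_fourier_L2_cong_AE:
  assumes "has_fourier_L2 f g"
    and "f' \<in> borel_measurable borel" "AE x in lborel. f x = f' x"
    and "g' \<in> borel_measurable borel" "AE x in lborel. g x = g' x"
  shows "has_fourier_L2 f' g'"
proof -
  obtain s where s: "\<And>n. integrable lborel (s n)" "tendsto_L2 s f sequentially"
    "tendsto_L2 (\<lambda>n. fourier_L1 (s n)) g sequentially"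
    using assms(1) by (auto simp: has_fourier_L2_def)
  show ?thesis
    by (rule has_fourier_L2_I[OF s(1) tendsto_L2_cong_AE[OF s(2) assms(2,3)]
          tendsto_L2_cong_AE[OF s(3) assms(4,5)]])
qed

lemma has_fourier_L2_unique_AE:
  assumes "has_fourier_L2 f g" "has_fourier_L2 f' g'" "AE x in lborel. f x = f' x"
  shows "AE x in lborel. g x = g' x"
proof -
  have d: "has_fourier_L2 (\<lambda>x. f x - f' x) (\<lambda>x. g x - g' x)" by (rule has_fourier_L2_diff[OF assms(1,2)])
  have "norm_L2 (\<lambda>x. f x - f' x) = norm_L2 (\<lambda>x. 0)"
    using has_fourier_L2_D[OF d] assms(3) by (intro norm_L2_cong_AE) (auto intro: L2_measurable)
  then have "norm_L2 (\<lambda>x. g x - g' x) = 0"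
    using has_fourier_L2_norm[OF d] by (simp add: norm_L2_def)
  from norm_L2_eq_0_AE[OF _ this] has_fourier_L2_D[OF d] show ?thesis by auto
qed

text \<open>
  The real part of an inner product is determined by norms; the imaginary part is the real part after
  multiplication by \<open>\<i>\<close>.
\<close>

theorem has_fourier_L2_inner:
  assumes "has_fourier_L2 f g" "has_fourier_L2 f' g'"
  shows "inner_L2 g g' = inner_L2 f f'"
proof -
  have re: "Re (inner_L2 g g') = Re (inner_L2 f f')" if "has_fourier_L2 f g" for f g
    using norm_L2_add_square[of f f'] norm_L2_add_square[of g g'] has_fourier_L2_norm[OF that]
      has_fourier_L2_norm[OF assms(2)] has_fourier_L2_norm[OF has_fourier_L2_add[OF that assms(2)]]
      has_fourier_L2_D[OF that] has_fourier_L2_D[OF assms(2)] by simp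
  have "Re (inner_L2 (\<lambda>x. \<i> * g x) g') = Re (inner_L2 (\<lambda>x. \<i> * f x) f')"
    by (rule re[OF has_fourier_L2_scale[OF assms(1)]])
  then show ?thesis using re[OF assms(1)] by (simp add: inner_L2_scale_left complex_eq_iff)
qed

text \<open>
  The relation \<open>has_fourier_L2\<close> is defined through approximating sequences, so each of its symmetries
  needs the images of such a sequence under an isometry to converge.
\<close>

lemma tendsto_L2_map:
  assumes u: "tendsto_L2 u f F" and T: "\<And>v. v \<in> L2 \<Longrightarrow> T v \<in> L2"
    and iso: "\<And>v w. v \<in> L2 \<Longrightarrow> w \<in> L2 \<Longrightarrow> norm_L2 (\<lambda>x. T v x - T w x) = norm_L2 (\<lambda>x. v x - w x)"
  shows "tendsto_L2 (\<lambda>i. T (u i)) (T f) F"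
proof -
  have f: "f \<in> L2" and uL2: "\<forall>\<^sub>F i in F. u i \<in> L2"
    and lim: "((\<lambda>i. norm_L2 (\<lambda>x. u i x - f x)) \<longlongrightarrow> 0) F"
    using u by (auto simp: tendsto_L2_def)
  have "\<forall>\<^sub>F i in F. norm_L2 (\<lambda>x. u i x - f x) = norm_L2 (\<lambda>x. T (u i) x - T f x)"
    using uL2 by eventually_elim (simp add: iso f)
  with lim have "((\<lambda>i. norm_L2 (\<lambda>x. T (u i) x - T f x)) \<longlongrightarrow> 0) F"
    by (rule Lim_transform_eventually)
  moreover have "\<forall>\<^sub>F i in F. T (u i) \<in> L2" using uL2 by eventually_elim (rule T)
  ultimately show ?thesis using T[OF f] by (simp add: tendsto_L2_def)
qed

lemma L2_affine:
  assumes f: "f \<in> L2" and c: "c \<noteq> 0"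
  shows "(\<lambda>x. f (t + c * x)) \<in> L2"
proof -
  have [measurable]: "f \<in> borel_measurable borel" using f by (simp add: L2_iff)
  show ?thesis
    using lborel_integrable_real_affine[OF L2_integrable_square[OF f] c, of t] by (simp add: L2_iff)
qed

lemma norm_L2_affine:
  assumes c: "c \<noteq> 0"
  shows "(norm_L2 (\<lambda>x. f (t + c * x)))\<^sup>2 = (norm_L2 f)\<^sup>2 / \<bar>c\<bar>"
  using c lborel_integral_real_affine[of c "\<lambda>x. (cmod (f x))\<^sup>2" t] by (simp add: norm_L2_square)

lemma has_fourier_L2_affine:
  assumes fg: "has_fourier_L2 f g" and s: "s > 0"
  shows "has_fourier_L2 (\<lambda>x. of_real (sqrt s) * f (s * x - t))
    (\<lambda>\<gamma>. of_real (1 / sqrt s) * wave (\<gamma> / s) t * g (\<gamma> / s))"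
proof -
  obtain u where u: "\<And>n. integrable lborel (u n)" "tendsto_L2 u f sequentially"
    "tendsto_L2 (\<lambda>n. fourier_L1 (u n)) g sequentially"
    using fg by (auto simp: has_fourier_L2_def)
  let ?S = "\<lambda>v x. complex_of_real (sqrt s) * v (s * x - t)"
  let ?T = "\<lambda>v \<gamma>. complex_of_real (1 / sqrt s) * wave (\<gamma> / s) t * v (\<gamma> / s)"
  have S_L2: "?S v \<in> L2" if "v \<in> L2" for v
    using L2_scale[OF L2_affine[OF that, of s "-t"]] s by simp
  have T_L2: "?T v \<in> L2" if "v \<in> L2" for v
  proof -
    have v: "(\<lambda>\<gamma>. v (\<gamma> / s)) \<in> L2" using L2_affine[OF that, of "1/s" 0] s by simp
    have [measurable]: "(\<lambda>\<gamma>. v (\<gamma> / s)) \<in> borel_measurable borel" using v by (rule L2_measurable)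
    show ?thesis by (rule L2_dominated[OF L2_scale[OF v, of "of_real (1 / sqrt s)"]]) (auto simp: norm_mult norm_divide)
  qed
  have S_norm: "norm_L2 (?S v) = norm_L2 v" for v
  proof (rule power2_eq_imp_eq)
    show "(norm_L2 (?S v))\<^sup>2 = (norm_L2 v)\<^sup>2"
      using norm_L2_affine[of s v "-t"] s by (simp add: norm_L2_scale power_mult_distrib)
  qed auto
  have T_norm: "norm_L2 (?T v) = norm_L2 v" for v
  proof (rule power2_eq_imp_eq)
    have "(norm_L2 (?T v))\<^sup>2 = (norm_L2 (\<lambda>\<gamma>. of_real (1 / sqrt s) * v (\<gamma> / s)))\<^sup>2"
      by (simp add: norm_L2_def norm_mult norm_divide)
    also have "\<dots> = (norm_L2 v)\<^sup>2"
      using norm_L2_affine[of "1/s" v 0] s unfolding norm_L2_scale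
      by (simp add: power_mult_distrib power_divide norm_divide)
    finally show "(norm_L2 (?T v))\<^sup>2 = (norm_L2 v)\<^sup>2" .
  qed auto
  have "tendsto_L2 (\<lambda>n. ?S (u n)) (?S f) sequentially"
    by (rule tendsto_L2_map[OF u(2) S_L2])
      (use S_norm in \<open>simp_all only: right_diff_distrib[symmetric] S_norm[of "\<lambda>x. _ x - _ x"]\<close>)
  moreover have "tendsto_L2 (\<lambda>n. ?T (fourier_L1 (u n))) (?T g) sequentially"
    by (rule tendsto_L2_map[OF u(3) T_L2])
      (use T_norm in \<open>simp_all only: right_diff_distrib[symmetric] T_norm[of "\<lambda>x. _ x - _ x"]\<close>)
  moreover have "fourier_L1 (?S (u n)) = ?T (fourier_L1 (u n))" for n
    by (rule ext) (rule fourier_L1_affine[OF s])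
  ultimately have "tendsto_L2 (\<lambda>n. ?S (u n)) (?S f) sequentially"
    "tendsto_L2 (\<lambda>n. fourier_L1 (?S (u n))) (?T g) sequentially"
    by (simp_all only:)
  moreover have "integrable lborel (?S (u n))" for n
    using lborel_integrable_real_affine[OF u(1), where c=s and t="-t"] s by simp
  ultimately show ?thesis by (intro has_fourier_L2_I)
qed

lemma has_fourier_L2_cnj:
  assumes fg: "has_fourier_L2 f g"
  shows "has_fourier_L2 (\<lambda>x. cnj (f x)) (\<lambda>\<gamma>. cnj (g (- \<gamma>)))"
proof -
  obtain u where u: "\<And>n. integrable lborel (u n)" "tendsto_L2 u f sequentially"
    "tendsto_L2 (\<lambda>n. fourier_L1 (u n)) g sequentially"
    using fg by (auto simp: has_fourier_L2_def)
  have refl_L2: "(\<lambda>\<gamma>. v (- \<gamma>)) \<in> L2" if "v \<in> L2" for v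
    using L2_affine[OF that, of "-1" 0] by simp
  have refl_norm: "norm_L2 (\<lambda>\<gamma>. v (- \<gamma>)) = norm_L2 v" for v
    using norm_L2_affine[of "-1" v 0] by simp
  have "tendsto_L2 (\<lambda>n x. cnj (u n x)) (\<lambda>x. cnj (f x)) sequentially"
    by (rule tendsto_L2_map[OF u(2), of "\<lambda>v x. cnj (v x)"])
      (auto simp: complex_cnj_diff[symmetric] norm_L2_cnj simp del: complex_cnj_diff)
  moreover have "tendsto_L2 (\<lambda>n \<gamma>. cnj (fourier_L1 (u n) (- \<gamma>))) (\<lambda>\<gamma>. cnj (g (- \<gamma>))) sequentially"
    by (rule tendsto_L2_map[OF u(3), of "\<lambda>v \<gamma>. cnj (v (- \<gamma>))"])
      (use refl_norm[of "\<lambda>x. _ x - _ x"] in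
        \<open>auto simp: complex_cnj_diff[symmetric] norm_L2_cnj simp del: complex_cnj_diff intro: refl_L2\<close>)
  then have "tendsto_L2 (\<lambda>n. fourier_L1 (\<lambda>x. cnj (u n x))) (\<lambda>\<gamma>. cnj (g (- \<gamma>))) sequentially"
    by (simp add: fourier_L1_cnj[abs_def])
  moreover have "integrable lborel (\<lambda>x. cnj (u n x))" for n using u(1) by simp
  ultimately show ?thesis by (intro has_fourier_L2_I)
qed

lemma has_fourier_L2_multiplication:
  assumes "has_fourier_L2 f f'" "has_fourier_L2 g g'"
  shows "(LINT x|lborel. f' x * g x) = (LINT x|lborel. f x * g' x)"
proof -
  obtain u where u: "\<And>n. integrable lborel (u n)" "tendsto_L2 u f sequentially"
    "tendsto_L2 (\<lambda>n. fourier_L1 (u n)) f' sequentially"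
    using assms(1) by (auto simp: has_fourier_L2_def)
  obtain v where v: "\<And>n. integrable lborel (v n)" "tendsto_L2 v g sequentially"
    "tendsto_L2 (\<lambda>n. fourier_L1 (v n)) g' sequentially"
    using assms(2) by (auto simp: has_fourier_L2_def)
  have cnj: "tendsto_L2 (\<lambda>n x. cnj (w n x)) (\<lambda>x. cnj (h x)) sequentially"
    if "tendsto_L2 w h sequentially" for w h
    by (rule tendsto_L2_map[OF that, of "\<lambda>v x. cnj (v x)"])
      (auto simp: complex_cnj_diff[symmetric] norm_L2_cnj simp del: complex_cnj_diff)
  have "(\<lambda>n. LINT x|lborel. fourier_L1 (u n) x * v n x) \<longlonglongrightarrow> (LINT x|lborel. f' x * g x)"
    using tendsto_L2_inner[OF u(3) cnj[OF v(2)]] by (simp add: inner_L2_def)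
  moreover have "(\<lambda>n. LINT x|lborel. u n x * fourier_L1 (v n) x) \<longlonglongrightarrow> (LINT x|lborel. f x * g' x)"
    using tendsto_L2_inner[OF u(2) cnj[OF v(3)]] by (simp add: inner_L2_def)
  ultimately show ?thesis
    using LIMSEQ_unique by (simp add: fourier_L1_multiplication[OF u(1) v(1)]) 
qed

text \<open>
  The reflected transform \<open>f\<close> of \<open>g\<close> has a transform \<open>k\<close> of the same norm as \<open>g\<close>, and the
  multiplication formula gives \<open>\<langle>k, g\<rangle> = \<parallel>g\<parallel>\<^sup>2\<close>. Hence \<open>\<parallel>k - g\<parallel> = 0\<close>.
\<close>

theorem has_fourier_L2_surj:
  assumes g: "g \<in> L2"
  shows "\<exists>f. has_fourier_L2 f g"
proof -
  obtain h where h: "has_fourier_L2 g h" using has_fourier_L2_exists[OF g] by blast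
  define f where "f x = h (- x)" for x
  have f: "f \<in> L2" using L2_affine[of h "-1" 0] has_fourier_L2_D[OF h] by (simp add: f_def[abs_def])
  have f_norm: "norm_L2 f = norm_L2 h"
    using norm_L2_affine[of "-1" h 0] by (simp add: f_def[abs_def])
  obtain k where k: "has_fourier_L2 f k" using has_fourier_L2_exists[OF f] by blast
  have kL2: "k \<in> L2" using has_fourier_L2_D[OF k] by blast
  have norms: "norm_L2 k = norm_L2 g"
    using has_fourier_L2_norm[OF k] has_fourier_L2_norm[OF h] f_norm by simp
  have "inner_L2 k g = inner_L2 f f"
    using has_fourier_L2_multiplication[OF k has_fourier_L2_cnj[OF h]]
    by (simp add: inner_L2_def f_def)
  then have "Re (inner_L2 k g) = (norm_L2 g)\<^sup>2"
    using f_norm has_fourier_L2_norm[OF h] by (simp add: inner_L2_self)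
  moreover have "Re (inner_L2 k (\<lambda>x. (-1) * g x)) = - Re (inner_L2 k g)"
    by (simp only: inner_L2_scale_right) simp
  moreover have "norm_L2 (\<lambda>x. (-1) * g x) = norm_L2 g" by (simp only: norm_L2_scale) simp
  ultimately have "(norm_L2 (\<lambda>x. k x - g x))\<^sup>2 = 0"
    using norm_L2_add_square[OF kL2 L2_scale[OF g, of "-1"]] norms by simp
  then have "norm_L2 (\<lambda>x. k x - g x) = 0" by simp
  from norm_L2_eq_0_AE[OF _ this] kL2 g have "AE x in lborel. k x = g x" by auto
  then have "has_fourier_L2 f g"
    using f g by (intro has_fourier_L2_cong_AE[OF k]) (auto intro: L2_measurable)
  then show ?thesis by blast
qed

lemma has_fourier_L2_fourier_L2: "f \<in> L2 \<Longrightarrow> has_fourier_L2 f (fourier_L2 f)"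
  unfolding fourier_L2_def using has_fourier_L2_exists by (rule someI_ex)

lemma has_fourier_L2_inv_fourier_L2: "g \<in> L2 \<Longrightarrow> has_fourier_L2 (inv_fourier_L2 g) g"
  unfolding inv_fourier_L2_def using has_fourier_L2_surj by (rule someI_ex)

lemma fourier_L2_inv_AE:
  assumes "g \<in> L2" shows "AE \<gamma> in lborel. fourier_L2 (inv_fourier_L2 g) \<gamma> = g \<gamma>"
proof -
  have h: "has_fourier_L2 (inv_fourier_L2 g) g" by (rule has_fourier_L2_inv_fourier_L2[OF assms])
  then have "inv_fourier_L2 g \<in> L2" using has_fourier_L2_D by blast
  from has_fourier_L2_unique_AE[OF has_fourier_L2_fourier_L2[OF this] h] show ?thesis by simp
qed

section \<open>Systems of dilates and translates on the Fourier side\<close>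

subsection \<open>A Bessel inequality weighted by the generator\<close>

lemma integral_cell:
  fixes h :: "real \<Rightarrow> 'a::{banach, second_countable_topology}"
  shows "(LINT t|lborel. indicator {0..<L} t *\<^sub>R h (t + of_int m * L))
    = (LINT x|lborel. indicator {of_int m * L..<of_int m * L + L} x *\<^sub>R h x)"
proof -
  have "(LINT x|lborel. indicator {of_int m * L..<of_int m * L + L} x *\<^sub>R h x)
     = (LINT t|lborel. indicator {of_int m * L..<of_int m * L + L} (of_int m * L + 1 * t) *\<^sub>R h (of_int m * L + 1 * t))"
    by (subst lborel_integral_real_affine[where c=1 and t="of_int m * L"]) auto
  also have "\<dots> = (LINT t|lborel. indicator {0..<L} t *\<^sub>R h (t + of_int m * L))"
    by (intro Bochner_Integration.integral_cong) (auto simp: indicator_def add.commute)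
  finally show ?thesis by simp
qed

lemma sum_indicator_cells:
  assumes "L > 0" "finite J"
  shows "(\<Sum>m\<in>J. indicator {of_int m * L..<of_int m * L + L} x :: real) = indicator {x. \<lfloor>x / L\<rfloor> \<in> J} x"
proof -
  have "(\<Sum>m\<in>J. indicator {of_int m * L..<of_int m * L + L} x :: real) = (\<Sum>m\<in>J. if m = \<lfloor>x / L\<rfloor> then 1 else 0)"
    by (intro sum.cong refl) (simp only: indicator_def in_cell_iff[OF assms(1)] of_bool_def)
  then show ?thesis using assms(2) by (simp add: indicator_def)
qed

text \<open>
  The Fourier coefficients of \<open>F H\<close> at the points \<open>k / L\<close> are those of its \<open>L\<close>-periodization,
  and by the Cauchy--Schwarz inequality the square of the periodization is at most
  \<open>(\<Sum>m. |F|\<^sup>2 |H|) (\<Sum>m. |H|)\<close>, both sums over the shifts by \<open>m L\<close>. Bessel's inequality on one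
  period then gives the claim. Finitely many cells are used first, so that no convergence of the
  periodization is at stake.
\<close>

theorem weighted_Bessel:
  assumes F: "F \<in> L2" and H: "H \<in> L2" and L: "L > 0" and S: "finite S"
    and M: "\<And>x J. finite J \<Longrightarrow> (\<Sum>m\<in>J. cmod (H (x + of_int m * L))) \<le> M"
  shows "(\<Sum>k\<in>S. (cmod (fourier_L1 (\<lambda>x. F x * H x) (of_int k / L)))\<^sup>2)
    \<le> L * M * (LINT x|lborel. (cmod (F x))\<^sup>2 * cmod (H x))"
proof -
  have [measurable]: "F \<in> borel_measurable borel" "H \<in> borel_measurable borel"
    using F H by (auto simp: L2_iff)
  have HM: "cmod (H x) \<le> M" for x using M[of "{0}" x] by simp
  have M0: "0 \<le> M" using HM[of 0] norm_ge_zero[of "H 0"] by linarith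
  define G where "G x = F x * H x" for x
  have G1: "integrable lborel G" unfolding G_def[abs_def] by (rule L2_integrable_mult[OF F H])
  have G2: "G \<in> L2"
    unfolding G_def[abs_def] using L2_bounded_mult[OF F, of H M] HM by (simp add: mult.commute)
  have [measurable]: "G \<in> borel_measurable borel" using G2 by (rule L2_measurable)
  define w where "w x = (cmod (F x))\<^sup>2 * cmod (H x)" for x
  have w0: "0 \<le> w x" for x by (simp add: w_def)
  have [measurable]: "w \<in> borel_measurable borel" unfolding w_def[abs_def] by measurable
  have w: "integrable lborel w"
  proof (rule Bochner_Integration.integrable_bound)
    show "integrable lborel (\<lambda>x. M * (cmod (F x))\<^sup>2)" using L2_integrable_square[OF F] by simp
    show "AE x in lborel. norm (w x) \<le> norm (M * (cmod (F x))\<^sup>2)"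
      using HM M0 by (auto simp: w_def abs_mult mult.commute[of M] intro!: mult_left_mono)
  qed simp
  define U where "U J = {x::real. \<lfloor>x / L\<rfloor> \<in> J}" for J
  have U_meas [measurable]: "U J \<in> sets borel" for J
  proof -
    have "(\<lambda>x::real. \<lfloor>x / L\<rfloor>) -` J \<inter> space borel \<in> sets borel"
      by (rule measurable_sets[of _ _ "count_space UNIV"]) auto
    then show ?thesis by (simp add: U_def vimage_def)
  qed
  have finite_case: "(\<Sum>k\<in>S. (cmod (fourier_L1 (\<lambda>x. indicator (U J) x * G x) (of_int k / L)))\<^sup>2)
      \<le> L * M * (LINT x|lborel. w x)" if J: "finite J" for J
  proof -
    define P where "P t = indicator {0..<L} t * (\<Sum>m\<in>J. G (t + of_int m * L))" for t
    have shift: "(\<lambda>t. G (t + of_int m * L)) \<in> L2" for m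
      using L2_affine[OF G2, of 1 "of_int m * L"] by (simp add: add.commute)
    have P: "P \<in> L2" unfolding P_def[abs_def] by (intro L2_restrict L2_sum shift) auto
    have coeff: "fourier_L1 P (of_int k / L) = fourier_L1 (\<lambda>x. indicator (U J) x * G x) (of_int k / L)" for k
    proof -
      have wave_per: "wave (of_int k / L) t = wave (of_int k / L) (t + of_int m * L)" for t m
      proof -
        have "wave (of_int k / L) (of_int m * L) = wave (of_int k) (of_int m)"
          using L by (simp add: wave_def)
        then show ?thesis by (simp add: wave_add wave_int)
      qed
      have int: "integrable lborel (\<lambda>t. indicator {0..<L} t *\<^sub>R (G (t + of_int m * L) * wave (of_int k / L) (t + of_int m * L)))" for m
        using lborel_integrable_real_affine[OF integrable_mult_wave[OF G1], where c=1 and t="of_int m * L"]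
        by (intro integrable_mult_indicator) (auto simp: add.commute)
      have int': "integrable lborel (\<lambda>x. indicator {of_int m * L..<of_int m * L + L} x *\<^sub>R (G x * wave (of_int k / L) x))" for m
        using integrable_mult_wave[OF G1] by (intro integrable_mult_indicator) auto
      have "fourier_L1 P (of_int k / L)
          = (LINT t|lborel. (\<Sum>m\<in>J. indicator {0..<L} t *\<^sub>R (G (t + of_int m * L) * wave (of_int k / L) (t + of_int m * L))))"
        unfolding fourier_L1_wave P_def wave_per[symmetric]
        by (intro Bochner_Integration.integral_cong) (auto simp: sum_distrib_right indicator_def)
      also have "\<dots> = (\<Sum>m\<in>J. LINT t|lborel. indicator {0..<L} t *\<^sub>R (G (t + of_int m * L) * wave (of_int k / L) (t + of_int m * L)))"
        by (rule Bochner_Integration.integral_sum) (rule int)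
      also have "\<dots> = (\<Sum>m\<in>J. LINT x|lborel. indicator {of_int m * L..<of_int m * L + L} x *\<^sub>R (G x * wave (of_int k / L) x))"
        by (simp only: integral_cell[of L "\<lambda>x. G x * wave (of_int k / L) x"])
      also have "\<dots> = (LINT x|lborel. (\<Sum>m\<in>J. indicator {of_int m * L..<of_int m * L + L} x *\<^sub>R (G x * wave (of_int k / L) x)))"
        by (rule Bochner_Integration.integral_sum[symmetric]) (rule int')
      also have "\<dots> = fourier_L1 (\<lambda>x. indicator (U J) x * G x) (of_int k / L)"
        unfolding fourier_L1_wave scaleR_sum_left[symmetric] sum_indicator_cells[OF L J] U_def
        by (intro Bochner_Integration.integral_cong) (auto simp: indicator_def)
      finally show ?thesis .
    qed
    have "(\<Sum>k\<in>S. (cmod (fourier_L1 P (of_int k / L)))\<^sup>2) \<le> L * (norm_L2 P)\<^sup>2"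
    proof (rule finite_sum_le_has_sum[OF Parseval_interval[OF P _ L, of 0]])
      show "P x = 0" if "x \<notin> {0..0 + L}" for x using that by (auto simp: P_def indicator_def)
    qed (use S in auto)
    also have "(norm_L2 P)\<^sup>2 \<le> M * (LINT x|lborel. w x)"
    proof -
      have intw: "integrable lborel (\<lambda>t. indicator {0..<L} t *\<^sub>R w (t + of_int m * L))" for m
        using lborel_integrable_real_affine[OF w, of 1 "of_int m * L"]
        by (intro integrable_mult_indicator) (auto simp: add.commute)
      have intw': "integrable lborel (\<lambda>x. indicator {of_int m * L..<of_int m * L + L} x *\<^sub>R w x)" for m
        using w by (intro integrable_mult_indicator) auto
      have pw: "(cmod (P t))\<^sup>2 \<le> M * (\<Sum>m\<in>J. indicator {0..<L} t *\<^sub>R w (t + of_int m * L))" for t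
      proof (cases "t \<in> {0..<L}")
        case True
        have "cmod (P t) \<le> (\<Sum>m\<in>J. cmod (F (t + of_int m * L)) * cmod (H (t + of_int m * L)))"
          using True by (auto simp: P_def G_def norm_mult[symmetric] intro!: norm_sum)
        also have "\<dots> = (\<Sum>m\<in>J. (cmod (F (t + of_int m * L)) * sqrt (cmod (H (t + of_int m * L))))
            * sqrt (cmod (H (t + of_int m * L))))"
          by (simp add: mult.assoc)
        finally have "(cmod (P t))\<^sup>2 \<le> (\<Sum>m\<in>J. (cmod (F (t + of_int m * L)) * sqrt (cmod (H (t + of_int m * L))))
            * sqrt (cmod (H (t + of_int m * L))))\<^sup>2"
          by (intro power_mono) auto
        also have "\<dots> \<le> (\<Sum>m\<in>J. (cmod (F (t + of_int m * L)) * sqrt (cmod (H (t + of_int m * L))))\<^sup>2)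
            * (\<Sum>m\<in>J. (sqrt (cmod (H (t + of_int m * L))))\<^sup>2)"
          by (rule Cauchy_Schwarz_ineq_sum)
        also have "\<dots> = (\<Sum>m\<in>J. w (t + of_int m * L)) * (\<Sum>m\<in>J. cmod (H (t + of_int m * L)))"
          by (simp add: w_def power_mult_distrib)
        also have "\<dots> \<le> (\<Sum>m\<in>J. w (t + of_int m * L)) * M"
          using M[OF J] w0 by (intro mult_left_mono sum_nonneg) auto
        finally show ?thesis using True by (simp add: mult.commute)
      next
        case False
        then have "P t = 0" by (auto simp: P_def)
        then show ?thesis using False by simp
      qed
      have "(norm_L2 P)\<^sup>2 \<le> (LINT t|lborel. M * (\<Sum>m\<in>J. indicator {0..<L} t *\<^sub>R w (t + of_int m * L)))"
        unfolding norm_L2_square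
        by (intro integral_mono L2_integrable_square P integrable_mult_right Bochner_Integration.integrable_sum intw pw)
      also have "\<dots> = M * (\<Sum>m\<in>J. LINT x|lborel. indicator {of_int m * L..<of_int m * L + L} x *\<^sub>R w x)"
        by (simp only: integral_mult_right_zero Bochner_Integration.integral_sum[OF intw] integral_cell[of L w])
      also have "\<dots> = M * (LINT x|lborel. indicator (U J) x *\<^sub>R w x)"
        by (simp only: Bochner_Integration.integral_sum[OF intw', symmetric] scaleR_sum_left[symmetric]
            sum_indicator_cells[OF L J] U_def)
      also have "\<dots> \<le> M * (LINT x|lborel. w x)"
        using M0 w0 w by (intro mult_left_mono integral_mono integrable_mult_indicator) (auto simp: indicator_def)
      finally show ?thesis .
    qed
    finally show ?thesis using L by (simp add: coeff mult.assoc)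
  qed
  have lim: "(\<lambda>n. fourier_L1 (\<lambda>x. indicator (U {- int n..int n}) x * G x) \<gamma>) \<longlonglongrightarrow> fourier_L1 G \<gamma>" for \<gamma>
    unfolding fourier_L1_wave
  proof (rule integral_dominated_convergence)
    show "integrable lborel (\<lambda>x. cmod (G x))" using G1 by simp
    show "AE x in lborel. (\<lambda>n. indicator (U {- int n..int n}) x * G x * wave \<gamma> x) \<longlonglongrightarrow> G x * wave \<gamma> x"
    proof (rule AE_I2)
      fix x
      have "\<forall>\<^sub>F n in sequentially. indicator (U {- int n..int n}) x * G x * wave \<gamma> x = G x * wave \<gamma> x"
        by (intro eventually_sequentiallyI[of "nat \<bar>\<lfloor>x / L\<rfloor>\<bar>"]) (auto simp: U_def indicator_def)
      then show "(\<lambda>n. indicator (U {- int n..int n}) x * G x * wave \<gamma> x) \<longlonglongrightarrow> G x * wave \<gamma> x"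
        by (rule tendsto_eventually)
    qed
    show "(\<lambda>x. indicator (U {- int n..int n}) x * G x * wave \<gamma> x) \<in> borel_measurable lborel" for n
      by measurable
  qed (auto simp: norm_mult indicator_def)
  have "(\<Sum>k\<in>S. (cmod (fourier_L1 G (of_int k / L)))\<^sup>2) \<le> L * M * (LINT x|lborel. w x)"
    by (rule LIMSEQ_le_const2[OF tendsto_sum[OF tendsto_power[OF tendsto_norm[OF lim]]]])
      (use finite_case in auto)
  then show ?thesis by (simp add: G_def[abs_def] w_def[abs_def])
qed

subsection \<open>The transformed system\<close>

text \<open>
  The transforms of the functions \<open>D\<^bsub>a\<^sup>j\<^esub> T\<^bsub>k b\<^esub> \<psi>\<close> in terms of the transform \<open>H\<close> of \<open>\<psi>\<close>: translations
  become modulations, and a dilation by \<open>a\<^sup>j\<close> becomes one by \<open>a\<^sup>-\<^sup>j\<close>.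
\<close>

definition freq_system ::
    "real \<Rightarrow> real \<Rightarrow> (real \<Rightarrow> complex) \<Rightarrow> int \<times> int \<Rightarrow> real \<Rightarrow> complex" where
  "freq_system a b H = (\<lambda>(j, k) \<gamma>.
     of_real (1 / sqrt (a powi j)) * wave (\<gamma> / a powi j) (of_int k * b) * H (\<gamma> / a powi j))"

lemma has_fourier_L2_wavelet_system:
  assumes "has_fourier_L2 \<psi> \<Psi>" and "a > 0"
  shows "has_fourier_L2 (wavelet_system a b \<psi> i) (freq_system a b \<Psi> i)"
proof -
  obtain j k where i: "i = (j, k)" by fastforce
  have "a powi j > 0" using assms(2) by simp
  from has_fourier_L2_affine[OF assms(1) this, of "of_int k * b"] show ?thesis
    by (simp add: i wavelet_system_def freq_system_def dilation_def[abs_def] translation_def[abs_def])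
qed

lemma freq_system_L2:
  assumes "H \<in> L2" "a > 0" shows "freq_system a b H i \<in> L2"
  using has_fourier_L2_surj[OF assms(1)] has_fourier_L2_wavelet_system[OF _ assms(2)] has_fourier_L2_D
  by blast

text \<open>
  At a fixed scale \<open>j\<close> the coefficients are samples of one Fourier integral at the multiples of
  \<open>b / a\<^sup>j\<close>, that is, Fourier coefficients for intervals of length \<open>a\<^sup>j / b\<close>.
\<close>

lemma inner_freq_system:
  assumes "a > 0" "b > 0"
  shows "inner_L2 F (freq_system a b H (j, k)) = of_real (1 / sqrt (a powi j)) *
    fourier_L1 (\<lambda>\<gamma>. F \<gamma> * cnj (H (\<gamma> / a powi j))) (of_int (- k) / (a powi j / b))"
proof -
  have w: "cnj (wave (\<gamma> / a powi j) (of_int k * b)) = wave (of_int (- k) / (a powi j / b)) \<gamma>" for \<gamma>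
    using assms by (simp add: wave_def cis_cnj mult_ac)
  have "inner_L2 F (freq_system a b H (j, k)) = (LINT \<gamma>|lborel. of_real (1 / sqrt (a powi j)) *
      (F \<gamma> * cnj (H (\<gamma> / a powi j)) * wave (of_int (- k) / (a powi j / b)) \<gamma>))"
    unfolding inner_L2_def freq_system_def
    by (intro Bochner_Integration.integral_cong refl)
      (simp only: prod.case complex_cnj_mult w complex_cnj_complex_of_real, simp only: mult_ac)
  then show ?thesis unfolding fourier_L1_wave by (simp only: integral_mult_right_zero)
qed

lemma norm_inner_freq_system:
  assumes "a > 0" "b > 0"
  shows "(cmod (inner_L2 F (freq_system a b H (j, k))))\<^sup>2 = 1 / a powi j *
    (cmod (fourier_L1 (\<lambda>\<gamma>. F \<gamma> * cnj (H (\<gamma> / a powi j))) (of_int (- k) / (a powi j / b))))\<^sup>2"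
  using assms unfolding inner_freq_system[OF assms] norm_mult power_mult_distrib
  by (simp add: power_divide norm_divide)

text \<open>
  If \<open>F\<close> times the dilated generator lives on an interval of length \<open>a\<^sup>j / b\<close>, then the modulations at
  scale \<open>j\<close> are, up to normalization, an orthonormal basis there and Parseval's identity applies.
\<close>

lemma freq_system_scale_energy:
  assumes a: "a > 0" and b: "b > 0"
    and G: "(\<lambda>\<gamma>. F \<gamma> * cnj (H (\<gamma> / a powi j))) \<in> L2"
    and supp: "\<And>\<gamma>. \<gamma> \<notin> {c..c + a powi j / b} \<Longrightarrow> F \<gamma> = 0 \<or> H (\<gamma> / a powi j) = 0"
  shows "((\<lambda>k. (cmod (inner_L2 F (freq_system a b H (j, k))))\<^sup>2) has_sum
    1 / b * (LINT \<gamma>|lborel. (cmod (F \<gamma>))\<^sup>2 * (cmod (H (\<gamma> / a powi j)))\<^sup>2)) UNIV"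
proof -
  define G where "G = (\<lambda>\<gamma>. F \<gamma> * cnj (H (\<gamma> / a powi j)))"
  have s: "a powi j > 0" and L: "a powi j / b > 0" using a b by auto
  have "((\<lambda>k::int. (cmod (fourier_L1 G (of_int k / (a powi j / b))))\<^sup>2) has_sum a powi j / b * (norm_L2 G)\<^sup>2) UNIV"
    by (rule Parseval_interval[OF _ _ L, of _ c]) (use assms in \<open>auto simp: G_def\<close>)
  then have "((\<lambda>k::int. (cmod (fourier_L1 G (of_int (- k) / (a powi j / b))))\<^sup>2) has_sum a powi j / b * (norm_L2 G)\<^sup>2) UNIV"
    by (subst has_sum_reindex_bij_betw[OF bij_uminus]) simp
  from has_sum_cmult_right[OF this, of "1 / a powi j"] s a
  have "((\<lambda>k. (cmod (inner_L2 F (freq_system a b H (j, k))))\<^sup>2) has_sum 1 / b * (norm_L2 G)\<^sup>2) UNIV"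
    by (simp add: norm_inner_freq_system[OF a b] G_def)
  then show ?thesis by (simp add: norm_L2_square G_def norm_mult power_mult_distrib)
qed

lemma freq_system_scale_Bessel:
  assumes a: "a > 0" and b: "b > 0" and F: "F \<in> L2" and H: "H \<in> L2" and S: "finite S"
    and M: "\<And>x J. finite J \<Longrightarrow> (\<Sum>m\<in>J. cmod (H (x + of_int m / b))) \<le> M"
  shows "(\<Sum>k\<in>S. (cmod (inner_L2 F (freq_system a b H (j, k))))\<^sup>2)
    \<le> M / b * (LINT \<gamma>|lborel. (cmod (F \<gamma>))\<^sup>2 * cmod (H (\<gamma> / a powi j)))"
proof -
  have s: "a powi j > 0" and L: "a powi j / b > 0" using a b by auto
  have H': "(\<lambda>\<gamma>. cnj (H (\<gamma> / a powi j))) \<in> L2"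
    using L2_cnj[OF L2_affine[OF H, of "1 / a powi j" 0]] s a by simp
  have M': "(\<Sum>m\<in>J. cmod (cnj (H ((x + of_int m * (a powi j / b)) / a powi j)))) \<le> M" if "finite J" for x J
    using M[OF that, of "x / a powi j"] s a by (simp add: add_divide_distrib)
  have "(\<Sum>k\<in>S. (cmod (inner_L2 F (freq_system a b H (j, k))))\<^sup>2) = 1 / a powi j *
    (\<Sum>k\<in>S. (cmod (fourier_L1 (\<lambda>\<gamma>. F \<gamma> * cnj (H (\<gamma> / a powi j))) (of_int (- k) / (a powi j / b))))\<^sup>2)"
    by (simp only: norm_inner_freq_system[OF a b] sum_distrib_left)
  also have "(\<Sum>k\<in>S. (cmod (fourier_L1 (\<lambda>\<gamma>. F \<gamma> * cnj (H (\<gamma> / a powi j))) (of_int (- k) / (a powi j / b))))\<^sup>2)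
    = (\<Sum>k\<in>uminus ` S. (cmod (fourier_L1 (\<lambda>\<gamma>. F \<gamma> * cnj (H (\<gamma> / a powi j))) (of_int k / (a powi j / b))))\<^sup>2)"
    by (subst sum.reindex) (auto simp: inj_on_def)
  also have "\<dots> \<le> a powi j / b * M * (LINT \<gamma>|lborel. (cmod (F \<gamma>))\<^sup>2 * cmod (cnj (H (\<gamma> / a powi j))))"
    using S by (intro weighted_Bessel[OF F H' L] M') auto
  finally show ?thesis using s a by (simp add: field_simps)
qed

subsection \<open>Sums over dilations and over translations\<close>

lemma sum_powi_le:
  assumes q: "q > (1::real)" and J: "finite J" and le: "\<And>j. j \<in> J \<Longrightarrow> q powi j \<le> y" and y: "0 \<le> y"
  shows "(\<Sum>j\<in>J. q powi j) \<le> y * (q / (q - 1))"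
proof (cases "J = {}")
  case True
  then show ?thesis using q y by simp
next
  case False
  define m where "m = Max J"
  have m: "m \<in> J" "\<And>j. j \<in> J \<Longrightarrow> j \<le> m" using J False by (auto simp: m_def)
  have inj: "inj_on (\<lambda>j. nat (m - j)) J" 
  proof (rule inj_onI)
    fix i j assume "i \<in> J" "j \<in> J" "nat (m - i) = nat (m - j)"
    then show "i = j" using m(2)[of i] m(2)[of j] by simp
  qed
  have "(\<Sum>j\<in>J. q powi j) = (\<Sum>j\<in>J. q powi m * (1 / q) ^ nat (m - j))"
  proof (intro sum.cong refl)
    fix j assume "j \<in> J"
    then have "j = m - int (nat (m - j))" using m(2) by simp
    then have "q powi j = q powi m / q powi int (nat (m - j))"
      using q by (metis power_int_diff less_irrefl zero_less_one less_trans)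
    then show "q powi j = q powi m * (1 / q) ^ nat (m - j)"
      by (simp only: power_int_of_nat power_one_over) simp
  qed
  also have "\<dots> = q powi m * (\<Sum>i\<in>(\<lambda>j. nat (m - j)) ` J. (1 / q) ^ i)"
    by (simp add: sum.reindex[OF inj] sum_distrib_left)
  also have "\<dots> \<le> q powi m * (\<Sum>i. (1 / q) ^ i)"
    using q J by (intro mult_left_mono sum_le_suminf summable_geometric) auto
  also have "(\<Sum>i. (1 / q) ^ i) = q / (q - 1)"
    using q by (subst suminf_geometric) (auto simp: field_simps)
  also have "q powi m * (q / (q - 1)) \<le> y * (q / (q - 1))"
    using q le[OF m(1)] by (intro mult_right_mono) auto
  finally show ?thesis .
qed

lemma powr_step_le:
  assumes p: "p > (1::real)" and t: "t > 0" and \<beta>: "\<beta> > 0"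
  shows "(p - 1) * \<beta> * (t + \<beta>) powr (- p) \<le> t powr (1 - p) - (t + \<beta>) powr (1 - p)"
proof -
  have "\<exists>z. t < z \<and> z < t + \<beta> \<and>
      (t + \<beta>) powr (1 - p) - t powr (1 - p) = (t + \<beta> - t) * ((1 - p) * z powr (- p))"
  proof (rule MVT2)
    fix z assume "t \<le> z"
    then show "((\<lambda>z. z powr (1 - p)) has_real_derivative (1 - p) * z powr (- p)) (at z)"
      using t by (auto intro!: derivative_eq_intros)
  qed (use \<beta> in simp)
  then obtain z where z: "t < z" "z < t + \<beta>"
    "(t + \<beta>) powr (1 - p) - t powr (1 - p) = \<beta> * ((1 - p) * z powr (- p))" by auto
  have "(t + \<beta>) powr (- p) \<le> z powr (- p)"
    using z t p by (intro powr_mono2') auto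
  then have "(p - 1) * \<beta> * (t + \<beta>) powr (- p) \<le> (p - 1) * \<beta> * z powr (- p)"
    using p \<beta> by (intro mult_left_mono) auto
  then show ?thesis using z(3) by (simp add: algebra_simps)
qed

text \<open>The points of a lattice beyond \<open>K\<close>: all but the first are compared with an integral.\<close>

lemma lattice_sum_right_le:
  assumes p: "p > (1::real)" and K: "K > 0" and \<beta>: "\<beta> > 0" and J: "finite J"
    and far: "\<And>m::int. m \<in> J \<Longrightarrow> x + of_int m * \<beta> \<ge> K"
  shows "(\<Sum>m\<in>J. (x + of_int m * \<beta>) powr (- p)) \<le> K powr (- p) + K powr (1 - p) / (\<beta> * (p - 1))"
proof (cases "J = {}")
  case True
  then show ?thesis using p \<beta> by simp
next
  case False
  define m0 where "m0 = Min J"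
  have m0: "m0 \<in> J" "\<And>m. m \<in> J \<Longrightarrow> m0 \<le> m" using J False by (auto simp: m0_def)
  have inj: "inj_on (\<lambda>m. nat (m - m0)) J" 
  proof (rule inj_onI)
    fix i j assume "i \<in> J" "j \<in> J" "nat (i - m0) = nat (j - m0)"
    then show "i = j" using m0(2)[of i] m0(2)[of j] by simp
  qed
  have telescope: "(\<Sum>i\<le>n. (K + real i * \<beta>) powr (- p))
      \<le> K powr (- p) + (K powr (1 - p) - (K + real n * \<beta>) powr (1 - p)) / (\<beta> * (p - 1))" for n
  proof (induction n)
    case (Suc n)
    have "K + real n * \<beta> > 0" using K \<beta> by (simp add: add_pos_nonneg)
    from powr_step_le[OF p this \<beta>] have "(K + real n * \<beta> + \<beta>) powr (- p)
        \<le> ((K + real n * \<beta>) powr (1 - p) - (K + real n * \<beta> + \<beta>) powr (1 - p)) / (\<beta> * (p - 1))"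
      using p \<beta> by (simp add: pos_le_divide_eq mult_ac)
    then show ?case using Suc by (simp add: algebra_simps diff_divide_distrib)
  qed simp
  obtain n where n: "(\<lambda>m. nat (m - m0)) ` J \<subseteq> {..n}"
    using J finite_nat_set_iff_bounded_le by (metis finite_imageI atMost_iff subsetI)
  have "(\<Sum>m\<in>J. (x + of_int m * \<beta>) powr (- p)) \<le> (\<Sum>m\<in>J. (K + real (nat (m - m0)) * \<beta>) powr (- p))"
  proof (rule sum_mono)
    fix m assume m: "m \<in> J"
    have "K + real (nat (m - m0)) * \<beta> \<le> x + of_int m0 * \<beta> + (of_int m - of_int m0) * \<beta>"
      using m0(2)[OF m] far[OF m0(1)] by simp
    then have "K + real (nat (m - m0)) * \<beta> \<le> x + of_int m * \<beta>" by (simp add: algebra_simps)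
    moreover have "0 < K + real (nat (m - m0)) * \<beta>" using K \<beta> by (simp add: add_pos_nonneg)
    ultimately show "(x + of_int m * \<beta>) powr (- p) \<le> (K + real (nat (m - m0)) * \<beta>) powr (- p)"
      using p by (intro powr_mono2') auto
  qed
  also have "\<dots> = (\<Sum>i\<in>(\<lambda>m. nat (m - m0)) ` J. (K + real i * \<beta>) powr (- p))"
    by (simp add: sum.reindex[OF inj])
  also have "\<dots> \<le> (\<Sum>i\<le>n. (K + real i * \<beta>) powr (- p))"
    using n by (intro sum_mono2) auto
  also have "\<dots> \<le> K powr (- p) + (K powr (1 - p) - (K + real n * \<beta>) powr (1 - p)) / (\<beta> * (p - 1))"
    by (rule telescope)
  also have "\<dots> \<le> K powr (- p) + K powr (1 - p) / (\<beta> * (p - 1))"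
    using p \<beta> by (intro add_left_mono divide_right_mono) auto
  finally show ?thesis .
qed

lemma lattice_sum_le:
  assumes p: "p > (1::real)" and K: "K > 0" and \<beta>: "\<beta> > 0" and J: "finite J"
    and far: "\<And>m::int. m \<in> J \<Longrightarrow> \<bar>x + of_int m * \<beta>\<bar> \<ge> K"
  shows "(\<Sum>m\<in>J. \<bar>x + of_int m * \<beta>\<bar> powr (- p)) \<le> 2 * (K powr (- p) + K powr (1 - p) / (\<beta> * (p - 1)))"
proof -
  let ?P = "{m \<in> J. x + of_int m * \<beta> \<ge> K}" and ?N = "{m \<in> J. x + of_int m * \<beta> < K}"
  have "(\<Sum>m\<in>J. \<bar>x + of_int m * \<beta>\<bar> powr (- p))
      = (\<Sum>m\<in>?P. \<bar>x + of_int m * \<beta>\<bar> powr (- p)) + (\<Sum>m\<in>?N. \<bar>x + of_int m * \<beta>\<bar> powr (- p))"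
    using J by (subst sum.union_disjoint[symmetric]) (auto intro: sum.cong)
  also have "(\<Sum>m\<in>?P. \<bar>x + of_int m * \<beta>\<bar> powr (- p)) = (\<Sum>m\<in>?P. (x + of_int m * \<beta>) powr (- p))"
    using K by (intro sum.cong) auto
  also have "\<dots> \<le> K powr (- p) + K powr (1 - p) / (\<beta> * (p - 1))"
    using J by (intro lattice_sum_right_le[OF p K \<beta>]) auto
  also have "(\<Sum>m\<in>?N. \<bar>x + of_int m * \<beta>\<bar> powr (- p)) = (\<Sum>m\<in>uminus ` ?N. (- x + of_int m * \<beta>) powr (- p))"
  proof -
    have "\<bar>x + of_int m * \<beta>\<bar> = - x + of_int (- m) * \<beta>" if "m \<in> ?N" for m
      using that far[of m] by auto
    then show ?thesis by (subst sum.reindex) (simp_all only: inj_on_def o_def neg_equal_iff_equal, simp_all)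
  qed
  also have "\<dots> \<le> K powr (- p) + K powr (1 - p) / (\<beta> * (p - 1))"
    using J far by (intro lattice_sum_right_le[OF p K \<beta>]) force+
  finally show ?thesis by simp
qed

text \<open>
  This bounds the periodization of a tail. The spacing \<open>\<beta>\<close> enters through the integral term only, which
  stays of the order of the first term when \<open>\<beta>\<close> is comparable with \<open>K\<close>.
\<close>

lemma tail_translation_sum_le:
  assumes p: "p > (1::real)" and K: "K > 0" and \<beta>: "\<beta> > 0" and J: "finite J" and C: "C \<ge> 0"
    and h: "\<And>x. \<bar>x\<bar> > K \<Longrightarrow> h x \<le> C * \<bar>x\<bar> powr (- p)" "\<And>x. \<bar>x\<bar> \<le> K \<Longrightarrow> h x = 0"
  shows "(\<Sum>m\<in>J. h (x + of_int m * \<beta>)) \<le> C * (2 * (K powr (- p) + K powr (1 - p) / (\<beta> * (p - 1))))"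
proof -
  let ?J = "{m \<in> J. \<bar>x + of_int m * \<beta>\<bar> > K}"
  have "(\<Sum>m\<in>J. h (x + of_int m * \<beta>)) = (\<Sum>m\<in>?J. h (x + of_int m * \<beta>))"
    using J h(2) by (intro sum.mono_neutral_right) (auto simp: not_less[symmetric])
  also have "\<dots> \<le> (\<Sum>m\<in>?J. C * \<bar>x + of_int m * \<beta>\<bar> powr (- p))"
    using h(1) by (intro sum_mono) auto
  also have "\<dots> \<le> C * (2 * (K powr (- p) + K powr (1 - p) / (\<beta> * (p - 1))))"
    unfolding sum_distrib_left[symmetric]
    using J C by (intro mult_left_mono lattice_sum_le[OF p K \<beta>]) auto
  finally show ?thesis .
qed

lemma powi_powr:
  assumes "a > (0::real)" shows "(a powi j) powr p = (a powr p) powi j"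
proof -
  have "(a powi j) powr p = (a powr of_int j) powr p" using assms by (simp add: powr_real_of_int')
  also have "\<dots> = (a powr p) powr of_int j" by (simp add: powr_powr mult.commute)
  also have "\<dots> = (a powr p) powi j" using assms by (simp add: powr_real_of_int')
  finally show ?thesis .
qed

text \<open>
  The condition \<open>K < |\<gamma>| / a\<^sup>j\<close> bounds the powers \<open>a\<^sup>j\<^sup>p\<close> in the sum by \<open>(|\<gamma>| / K)\<^sup>p\<close>, so that the
  geometric series is controlled by its largest term.
\<close>

lemma tail_dilation_sum_le:
  assumes a: "a > (1::real)" and p: "p > 0" and K: "K > 0" and J: "finite J" and C: "C \<ge> 0"
    and h: "\<And>x. \<bar>x\<bar> > K \<Longrightarrow> h x \<le> C * \<bar>x\<bar> powr (- p)" "\<And>x. \<bar>x\<bar> \<le> K \<Longrightarrow> h x = 0"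
  shows "(\<Sum>j\<in>J. h (\<gamma> / a powi j)) \<le> C * K powr (- p) * (a powr p / (a powr p - 1))"
proof (cases "\<gamma> = 0")
  case True
  then show ?thesis using h(2)[of 0] K C a p by (simp add: ge_one_powr_ge_zero)
next
  case False
  let ?J = "{j \<in> J. \<bar>\<gamma> / a powi j\<bar> > K}"
  have ap: "a powi j > 0" for j using a by simp
  have q: "a powr p > 1" using a p by simp
  have "(\<Sum>j\<in>J. h (\<gamma> / a powi j)) = (\<Sum>j\<in>?J. h (\<gamma> / a powi j))"
    using J h(2) by (intro sum.mono_neutral_right) (auto simp: not_less[symmetric])
  also have "\<dots> \<le> (\<Sum>j\<in>?J. C * \<bar>\<gamma> / a powi j\<bar> powr (- p))"
    by (intro sum_mono h(1)) blast
  also have "\<dots> = (\<Sum>j\<in>?J. C * \<bar>\<gamma>\<bar> powr (- p) * (a powr p) powi j)"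
  proof (intro sum.cong refl)
    fix j
    have "\<bar>\<gamma> / a powi j\<bar> powr (- p) = \<bar>\<gamma>\<bar> powr (- p) * (a powi j) powr p"
      using ap[of j] by (simp add: abs_divide powr_divide powr_minus field_simps)
    then show "C * \<bar>\<gamma> / a powi j\<bar> powr (- p) = C * \<bar>\<gamma>\<bar> powr (- p) * (a powr p) powi j"
      using powi_powr[of a j p] a by simp
  qed
  also have "\<dots> = C * \<bar>\<gamma>\<bar> powr (- p) * (\<Sum>j\<in>?J. (a powr p) powi j)"
    by (simp add: sum_distrib_left)
  also have "\<dots> \<le> C * \<bar>\<gamma>\<bar> powr (- p) * ((\<bar>\<gamma>\<bar> / K) powr p * (a powr p / (a powr p - 1)))"
  proof (intro mult_left_mono sum_powi_le[OF q])
    fix j assume "j \<in> ?J"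
    then have "a powi j \<le> \<bar>\<gamma>\<bar> / K" using ap[of j] K by (auto simp: abs_divide field_simps)
    then have "(a powi j) powr p \<le> (\<bar>\<gamma>\<bar> / K) powr p" using ap[of j] p by (intro powr_mono2) auto
    then show "(a powr p) powi j \<le> (\<bar>\<gamma>\<bar> / K) powr p" using powi_powr[of a j p] a by simp
  qed (use J C in auto)
  also have "\<dots> = C * K powr (- p) * (a powr p / (a powr p - 1))"
    using False K by (simp add: powr_divide powr_minus field_simps)
  finally show ?thesis .
qed

subsection \<open>Bessel bound for generators supported away from the origin\<close>

text \<open>
  For a generator bounded by \<open>C |x|\<^sup>-\<^sup>p\<close> beyond \<open>K\<close> and vanishing elsewhere: the bound of its
  periodization with period \<open>1 / b\<close>, divided by \<open>b\<close>, times the bound of the sum over all its dilates.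
\<close>

definition tail_bound :: "real \<Rightarrow> real \<Rightarrow> real \<Rightarrow> real \<Rightarrow> real \<Rightarrow> real" where
  "tail_bound a b C p K = C * (2 * (K powr (- p) + K powr (1 - p) / (1 / b * (p - 1)))) / b
     * (C * K powr (- p) * (a powr p / (a powr p - 1)))"

lemma tail_bound_nonneg:
  assumes "a > 1" "b > 0" "p > 1" "C \<ge> 0"
  shows "0 \<le> tail_bound a b C p K"
proof -
  have "0 \<le> a powr p - 1" using assms by (simp add: ge_one_powr_ge_zero)
  then show ?thesis unfolding tail_bound_def
    by (intro mult_nonneg_nonneg divide_nonneg_nonneg add_nonneg_nonneg) (use assms in simp_all)
qed

lemma sum_subset_product_le:
  fixes c :: "'a \<times> 'b \<Rightarrow> real"
  assumes "finite T" "\<And>i. 0 \<le> c i"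
  shows "sum c T \<le> (\<Sum>j\<in>fst ` T. \<Sum>k\<in>snd ` T. c (j, k))"
proof -
  have "sum c T \<le> sum c (fst ` T \<times> snd ` T)"
    using assms by (intro sum_mono2) (auto intro: rev_image_eqI)
  then show ?thesis by (simp add: sum.cartesian_product)
qed

text \<open>
  The weighted Bessel inequality at every scale leaves the weight \<open>|H(\<gamma> / a\<^sup>j)|\<close>, and the sum of these
  weights over \<open>j\<close> is bounded independently of \<open>\<gamma>\<close>.
\<close>

lemma tail_system_Bessel:
  assumes a: "a > 1" and b: "b > 0" and p: "p > 1" and K: "K > 0" and C: "C \<ge> 0"
    and H: "H \<in> L2" and F: "F \<in> L2" and T: "finite T"
    and tail: "\<And>x. \<bar>x\<bar> > K \<Longrightarrow> cmod (H x) \<le> C * \<bar>x\<bar> powr (- p)" "\<And>x. \<bar>x\<bar> \<le> K \<Longrightarrow> H x = 0"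
  shows "(\<Sum>i\<in>T. (cmod (inner_L2 F (freq_system a b H i)))\<^sup>2) \<le> tail_bound a b C p K * (norm_L2 F)\<^sup>2"
proof -
  define M where "M = C * (2 * (K powr (- p) + K powr (1 - p) / (1 / b * (p - 1))))"
  define R where "R = C * K powr (- p) * (a powr p / (a powr p - 1))"
  have M0: "0 \<le> M" unfolding M_def using C b p by (intro mult_nonneg_nonneg add_nonneg_nonneg divide_nonneg_nonneg) auto
  have trans: "(\<Sum>m\<in>J. cmod (H (x + of_int m / b))) \<le> M" if "finite J" for x J
    using tail_translation_sum_le[of p K "1/b" J C "\<lambda>x. cmod (H x)" x] that tail p K b C
    by (simp add: M_def)
  have dil: "(\<Sum>j\<in>J. cmod (H (\<gamma> / a powi j))) \<le> R" if "finite J" for \<gamma> J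
    unfolding R_def using tail p K C a that by (intro tail_dilation_sum_le) auto
  have [measurable]: "F \<in> borel_measurable borel" "H \<in> borel_measurable borel"
    using F H by (auto intro: L2_measurable)
  have HM: "cmod (H x) \<le> M" for x using trans[of "{0}" x] by simp
  have int: "integrable lborel (\<lambda>\<gamma>. (cmod (F \<gamma>))\<^sup>2 * cmod (H (\<gamma> / a powi j)))" for j
  proof (rule Bochner_Integration.integrable_bound)
    show "integrable lborel (\<lambda>x. M * (cmod (F x))\<^sup>2)" using L2_integrable_square[OF F] by simp
    show "AE x in lborel. norm ((cmod (F x))\<^sup>2 * cmod (H (x / a powi j))) \<le> norm (M * (cmod (F x))\<^sup>2)"
      using HM M0 by (auto simp: abs_mult mult.commute[of M] intro!: mult_left_mono)
  qed simp
  have "(\<Sum>i\<in>T. (cmod (inner_L2 F (freq_system a b H i)))\<^sup>2)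
      \<le> (\<Sum>j\<in>fst ` T. \<Sum>k\<in>snd ` T. (cmod (inner_L2 F (freq_system a b H (j, k))))\<^sup>2)"
    using T by (rule sum_subset_product_le) simp
  also have "\<dots> \<le> (\<Sum>j\<in>fst ` T. M / b * (LINT \<gamma>|lborel. (cmod (F \<gamma>))\<^sup>2 * cmod (H (\<gamma> / a powi j))))"
    using T a b by (intro sum_mono freq_system_scale_Bessel F H trans) auto
  also have "\<dots> = M / b * (LINT \<gamma>|lborel. (cmod (F \<gamma>))\<^sup>2 * (\<Sum>j\<in>fst ` T. cmod (H (\<gamma> / a powi j))))"
    by (simp only: sum_distrib_left[symmetric] Bochner_Integration.integral_sum[OF int, symmetric])
  also have "\<dots> \<le> M / b * (LINT \<gamma>|lborel. (cmod (F \<gamma>))\<^sup>2 * R)"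
  proof (intro mult_left_mono integral_mono)
    show "integrable lborel (\<lambda>\<gamma>. (cmod (F \<gamma>))\<^sup>2 * (\<Sum>j\<in>fst ` T. cmod (H (\<gamma> / a powi j))))"
      unfolding sum_distrib_left by (intro Bochner_Integration.integrable_sum int)
    show "integrable lborel (\<lambda>\<gamma>. (cmod (F \<gamma>))\<^sup>2 * R)" using L2_integrable_square[OF F] by simp
  qed (use dil T M0 b in auto)
  also have "\<dots> = tail_bound a b C p K * (norm_L2 F)\<^sup>2"
    by (simp add: tail_bound_def M_def R_def norm_L2_square)
  finally show ?thesis .
qed

section \<open>Pointwise bounds implied by a frame\<close>

definition scale_energy :: "real \<Rightarrow> (real \<Rightarrow> complex) \<Rightarrow> real \<Rightarrow> real" where
  "scale_energy a H \<gamma> = (\<Sum>\<^sub>\<infinity>j::int. (cmod (H (\<gamma> / a powi j)))\<^sup>2)"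

text \<open>
  Both sides are \<open>0\<close> when the family is not summable, so measurability in a parameter needs no
  summability.
\<close>

lemma infsum_eq_enn2real:
  fixes f :: "'a \<Rightarrow> real"
  assumes "\<And>x. 0 \<le> f x"
  shows "infsum f UNIV = enn2real (\<integral>\<^sup>+x. ennreal (f x) \<partial>count_space UNIV)"
proof (cases "f summable_on UNIV")
  case True
  then have "(\<integral>\<^sup>+x. ennreal (f x) \<partial>count_space UNIV) = ennreal (infsum f UNIV)"
    using assms by (intro has_sum_imp_nn_integral_count_space) (auto simp: has_sum_infsum)
  then show ?thesis using assms by (simp add: infsum_nonneg)
next
  case False
  have "(\<integral>\<^sup>+x. ennreal (f x) \<partial>count_space UNIV) = \<infinity>"
  proof (rule ccontr)
    assume "(\<integral>\<^sup>+x. ennreal (f x) \<partial>count_space UNIV) \<noteq> \<infinity>"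
    then have "integrable (count_space UNIV) f"
      using assms by (intro integrableI_bounded) (auto simp: top.not_eq_extremum)
    then have "Infinite_Set_Sum.abs_summable_on f UNIV" by (simp add: Infinite_Set_Sum.abs_summable_on_def)
    then have "f summable_on UNIV"
      by (rule summable_on_iff_abs_summable_on_real[THEN iffD2, OF abs_summable_equivalent[THEN iffD2]])
    then show False using False by simp
  qed
  then show ?thesis using False by (simp add: infsum_not_exists)
qed

lemma infsum_int_measurable:
  fixes f :: "int \<Rightarrow> 'a \<Rightarrow> real"
  assumes [measurable]: "\<And>j. f j \<in> borel_measurable M" and "\<And>j x. 0 \<le> f j x"
  shows "(\<lambda>x. \<Sum>\<^sub>\<infinity>j. f j x) \<in> borel_measurable M"
proof -
  have "(\<lambda>x. enn2real (\<integral>\<^sup>+j. ennreal (f j x) \<partial>count_space UNIV)) \<in> borel_measurable M"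
  proof -
    interpret sigma_finite_measure "count_space (UNIV :: int set)"
      by (rule sigma_finite_measure_count_space)
    have "(\<lambda>(x, j). ennreal (f j x)) \<in> borel_measurable (M \<Otimes>\<^sub>M count_space UNIV)"
      unfolding measurable_pair_swap_iff[of _ M]
      by (rule measurable_pair_measure_countable1) auto
    from borel_measurable_nn_integral[OF this] show ?thesis by simp
  qed
  then show ?thesis by (simp add: infsum_eq_enn2real assms(2))
qed

lemma scale_energy_measurable [measurable]:
  assumes [measurable]: "H \<in> borel_measurable borel"
  shows "scale_energy a H \<in> borel_measurable borel"
  unfolding scale_energy_def[abs_def] by (rule infsum_int_measurable) auto

lemma scale_energy_nonneg: "0 \<le> scale_energy a H \<gamma>"
  unfolding scale_energy_def by (rule infsum_nonneg) simp

lemma scale_energy_summable: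
  assumes "\<And>J. finite J \<Longrightarrow> (\<Sum>j\<in>J. (cmod (H (\<gamma> / a powi j)))\<^sup>2) \<le> D"
  shows "(\<lambda>j. (cmod (H (\<gamma> / a powi j)))\<^sup>2) summable_on UNIV" "scale_energy a H \<gamma> \<le> D"
proof -
  show s: "(\<lambda>j. (cmod (H (\<gamma> / a powi j)))\<^sup>2) summable_on UNIV"
    by (rule nonneg_bdd_above_summable_on) (use assms in \<open>auto intro!: bdd_aboveI2\<close>)
  show "scale_energy a H \<gamma> \<le> D"
    unfolding scale_energy_def by (rule infsum_le_finite_sums[OF s]) (use assms in auto)
qed

lemma scale_energy_dilate:
  assumes "a > 0"
  shows "scale_energy a H (\<gamma> / a powi i) = scale_energy a H \<gamma>"
proof -
  have "scale_energy a H (\<gamma> / a powi i) = (\<Sum>\<^sub>\<infinity>j. (cmod (H (\<gamma> / a powi (i + j))))\<^sup>2)"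
    unfolding scale_energy_def using assms by (simp add: power_int_add)
  also have "\<dots> = (\<Sum>\<^sub>\<infinity>j. (cmod (H (\<gamma> / a powi j)))\<^sup>2)"
    by (rule infsum_reindex_bij_betw[of "\<lambda>j. i + j" UNIV UNIV])
      (rule bij_betwI[of _ _ _ "\<lambda>j. j - i"], auto)
  finally show ?thesis by (simp add: scale_energy_def)
qed

text \<open>
  Testing with the set where \<open>g\<close> exceeds \<open>c\<close> shows that this set is null. Knowing the integrals over
  small sets thus replaces Lebesgue's differentiation theorem.
\<close>

lemma AE_le_from_integrals:
  fixes g :: "real \<Rightarrow> real"
  assumes [measurable]: "g \<in> borel_measurable borel" "I \<in> sets borel"
    and fin: "emeasure lborel I < \<infinity>" and bound: "AE x in lborel. \<bar>g x\<bar> \<le> D"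
    and le: "\<And>E. E \<in> sets borel \<Longrightarrow> E \<subseteq> I \<Longrightarrow>
      (LINT x|lborel. indicator E x * g x) \<le> c * measure lborel E"
  shows "AE x in lborel. x \<in> I \<longrightarrow> g x \<le> c"
proof -
  define E where "E = {x \<in> I. g x > c}"
  have E [measurable]: "E \<in> sets borel" unfolding E_def by measurable
  have EI: "E \<subseteq> I" by (auto simp: E_def)
  have Efin: "emeasure lborel E < \<infinity>"
    using emeasure_mono[OF EI, of lborel] fin by (simp add: le_less_trans)
  have intE: "integrable lborel (indicator E :: real \<Rightarrow> real)"
    using Efin by (simp add: integrable_indicator_iff)
  have intg: "integrable lborel (\<lambda>x. indicator E x * g x)"
  proof (rule Bochner_Integration.integrable_bound)
    show "integrable lborel (\<lambda>x. \<bar>D\<bar> * indicator E x)" using intE by simp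
    show "AE x in lborel. norm (indicator E x * g x) \<le> norm (\<bar>D\<bar> * indicator E x)"
      using bound by eventually_elim (auto simp: indicator_def)
  qed simp
  have int: "integrable lborel (\<lambda>x. indicator E x * (g x - c))"
    using intg integrable_mult_right[OF intE, of c] by (simp add: right_diff_distrib mult.commute)
  have "(LINT x|lborel. indicator E x * (g x - c)) = (LINT x|lborel. indicator E x * g x) - c * measure lborel E"
    using intg integrable_mult_right[OF intE, of c] by (simp add: right_diff_distrib mult.commute)
  also have "\<dots> \<le> 0" using le[OF E EI] by simp
  finally have le0: "(LINT x|lborel. indicator E x * (g x - c)) \<le> 0" .
  have nonneg: "0 \<le> indicator E x * (g x - c)" for x by (auto simp: E_def indicator_def)
  have "(LINT x|lborel. indicator E x * (g x - c)) = 0"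
    using le0 nonneg by (intro antisym Bochner_Integration.integral_nonneg) auto
  then have "AE x in lborel. indicator E x * (g x - c) = 0"
    using int nonneg by (subst (asm) integral_nonneg_eq_0_iff_AE) auto
  then show ?thesis by eventually_elim (auto simp: E_def indicator_def split: if_splits)
qed

text \<open>The frame inequalities, transported by the Fourier transform.\<close>

lemma frame_freq_system:
  assumes fr: "frame_with_bounds_L2 (wavelet_system a b \<psi>) UNIV A B"
    and \<Psi>: "has_fourier_L2 \<psi> \<Psi>" and a: "a > 0" and F: "F \<in> L2"
  shows "(\<lambda>i. (cmod (inner_L2 F (freq_system a b \<Psi> i)))\<^sup>2) summable_on UNIV"
    "A * (norm_L2 F)\<^sup>2 \<le> (\<Sum>\<^sub>\<infinity>i. (cmod (inner_L2 F (freq_system a b \<Psi> i)))\<^sup>2)"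
    "(\<Sum>\<^sub>\<infinity>i. (cmod (inner_L2 F (freq_system a b \<Psi> i)))\<^sup>2) \<le> B * (norm_L2 F)\<^sup>2"
proof -
  obtain f where f: "has_fourier_L2 f F" using has_fourier_L2_surj[OF F] by blast
  have eq: "inner_L2 f (wavelet_system a b \<psi> i) = inner_L2 F (freq_system a b \<Psi> i)" for i
    using has_fourier_L2_inner[OF f has_fourier_L2_wavelet_system[OF \<Psi> a]] by simp
  have "f \<in> L2" using has_fourier_L2_D[OF f] by blast
  with fr show "(\<lambda>i. (cmod (inner_L2 F (freq_system a b \<Psi> i)))\<^sup>2) summable_on UNIV"
    "A * (norm_L2 F)\<^sup>2 \<le> (\<Sum>\<^sub>\<infinity>i. (cmod (inner_L2 F (freq_system a b \<Psi> i)))\<^sup>2)"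
    "(\<Sum>\<^sub>\<infinity>i. (cmod (inner_L2 F (freq_system a b \<Psi> i)))\<^sup>2) \<le> B * (norm_L2 F)\<^sup>2"
    unfolding frame_with_bounds_L2_def eq[symmetric] has_fourier_L2_norm[OF f] by auto
qed

lemma sum_rows_le:
  fixes c :: "'a \<times> 'b \<Rightarrow> real"
  assumes J: "finite J" and rows: "\<And>j. j \<in> J \<Longrightarrow> ((\<lambda>k. c (j, k)) has_sum s j) UNIV"
    and bound: "\<And>S. finite S \<Longrightarrow> sum c (J \<times> S) \<le> X"
  shows "sum s J \<le> X"
proof (rule tendsto_upperbound)
  show "((\<lambda>S. \<Sum>j\<in>J. \<Sum>k\<in>S. c (j, k)) \<longlongrightarrow> sum s J) (finite_subsets_at_top UNIV)"
    using rows by (intro tendsto_sum) (simp add: has_sum_def)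
  show "\<forall>\<^sub>F S in finite_subsets_at_top UNIV. (\<Sum>j\<in>J. \<Sum>k\<in>S. c (j, k)) \<le> X"
    using eventually_finite_subsets_at_top_weakI
    by (rule eventually_mono[of "\<lambda>S. finite S"]) (auto simp: sum.cartesian_product bound)
qed simp

text \<open>
  On an interval \<open>I\<close> of length \<open>a\<^sup>-\<^sup>n / b\<close> all scales \<open>j \<ge> -n\<close> are free of overlaps, so for
  \<open>F = \<chi>\<^sub>E\<close> with \<open>E \<subseteq> I\<close> their contribution to the frame sum is the integral over \<open>E\<close> of
  \<open>(1 / b) |\<Psi>(\<gamma> / a\<^sup>j)|\<^sup>2\<close>.
\<close>

lemma indicator_scale_energy:
  assumes a: "a > 1" and b: "b > 0" and \<Psi>: "\<Psi> \<in> L2" and bnd: "\<And>x. cmod (\<Psi> x) \<le> C"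
    and E [measurable]: "E \<in> sets borel" and EI: "E \<subseteq> {c..c + a powi (- int n) / b}" and j: "j \<ge> - int n"
  shows "((\<lambda>k. (cmod (inner_L2 (indicator E) (freq_system a b \<Psi> (j, k))))\<^sup>2) has_sum
      1 / b * (LINT \<gamma>|lborel. indicator E \<gamma> * (cmod (\<Psi> (\<gamma> / a powi j)))\<^sup>2)) UNIV"
    "integrable lborel (\<lambda>\<gamma>. indicator E \<gamma> * (cmod (\<Psi> (\<gamma> / a powi j)))\<^sup>2)"
    "indicator E \<in> L2" "(norm_L2 (indicator E))\<^sup>2 = measure lborel E"
proof -
  have [measurable]: "\<Psi> \<in> borel_measurable borel" using \<Psi> by (rule L2_measurable)
  have Efin: "emeasure lborel E < \<infinity>"
  proof -
    have "emeasure lborel E \<le> emeasure lborel {c..c + a powi (- int n) / b}"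
      using EI by (rule emeasure_mono) simp
    also have "\<dots> < \<infinity>" by (simp add: emeasure_lborel_Icc_eq)
    finally show ?thesis .
  qed
  show E_L2: "indicator E \<in> L2" and "(norm_L2 (indicator E))\<^sup>2 = measure lborel E"
    using L2_indicator[OF E Efin] by auto
  have len: "a powi (- int n) / b \<le> a powi j / b"
    using a b j by (intro divide_right_mono power_int_increasing) auto
  have [measurable]: "(\<lambda>\<gamma>. cnj (\<Psi> (\<gamma> / a powi j))) \<in> borel_measurable borel" by measurable
  have G: "(\<lambda>\<gamma>. indicator E \<gamma> * cnj (\<Psi> (\<gamma> / a powi j))) \<in> L2"
    using L2_bounded_mult[OF E_L2, of "\<lambda>\<gamma>. cnj (\<Psi> (\<gamma> / a powi j))" C] bnd by (simp add: mult.commute)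
  have sq: "(cmod (indicator E \<gamma>))\<^sup>2 = indicator E \<gamma>" for \<gamma> :: real by (simp add: indicator_def)
  have "((\<lambda>k. (cmod (inner_L2 (indicator E) (freq_system a b \<Psi> (j, k))))\<^sup>2) has_sum
      1 / b * (LINT \<gamma>|lborel. (cmod (indicator E \<gamma>))\<^sup>2 * (cmod (\<Psi> (\<gamma> / a powi j)))\<^sup>2)) UNIV"
    by (rule freq_system_scale_energy[where c=c]) (use a b G EI len in \<open>auto simp: indicator_def\<close>)
  then show "((\<lambda>k. (cmod (inner_L2 (indicator E) (freq_system a b \<Psi> (j, k))))\<^sup>2) has_sum
      1 / b * (LINT \<gamma>|lborel. indicator E \<gamma> * (cmod (\<Psi> (\<gamma> / a powi j)))\<^sup>2)) UNIV"
    by (simp only: sq)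
  from L2_integrable_square[OF G]
  show "integrable lborel (\<lambda>\<gamma>. indicator E \<gamma> * (cmod (\<Psi> (\<gamma> / a powi j)))\<^sup>2)"
    by (simp only: norm_mult power_mult_distrib sq complex_mod_cnj)
qed

lemma finite_int_subset_symmetric:
  assumes "finite (J :: int set)" shows "\<exists>n::nat. J \<subseteq> {- int n..int n}"
proof -
  obtain m where m: "\<And>j. j \<in> J \<Longrightarrow> nat \<bar>j\<bar> \<le> m"
    using assms finite_nat_set_iff_bounded_le[of "(\<lambda>j. nat \<bar>j\<bar>) ` J"] by auto
  then have "J \<subseteq> {- int m..int m}" by force
  then show ?thesis ..
qed

lemma in_cell_closed:
  assumes "l > (0::real)" shows "\<exists>m::int. x \<in> {of_int m * l..of_int m * l + l}"
proof -
  have "x \<in> {of_int \<lfloor>x / l\<rfloor> * l..<of_int \<lfloor>x / l\<rfloor> * l + l}"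
    using in_cell_iff[OF assms, of x "\<lfloor>x / l\<rfloor>"] by (rule iffD2) (rule refl)
  then show ?thesis by (intro exI[of _ "\<lfloor>x / l\<rfloor>"]) auto
qed

text \<open>
  The upper frame inequality for \<open>\<chi>\<^sub>E\<close>, with all scales below \<open>-n\<close> dropped, bounds the integral of the
  truncated energy over \<open>E\<close>. The cells of length \<open>a\<^sup>-\<^sup>n / b\<close> cover the line for every \<open>n\<close>.
\<close>

theorem frame_upper_energy:
  assumes a: "a > 1" and b: "b > 0" and \<Psi>: "\<Psi> \<in> L2" and bnd: "\<And>x. cmod (\<Psi> x) \<le> C"
    and summ: "\<And>F. F \<in> L2 \<Longrightarrow> (\<lambda>i. (cmod (inner_L2 F (freq_system a b \<Psi> i)))\<^sup>2) summable_on UNIV"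
    and upper: "\<And>F. F \<in> L2 \<Longrightarrow> (\<Sum>\<^sub>\<infinity>i. (cmod (inner_L2 F (freq_system a b \<Psi> i)))\<^sup>2) \<le> B * (norm_L2 F)\<^sup>2"
  shows "AE \<gamma> in lborel. \<forall>J. finite J \<longrightarrow> (\<Sum>j\<in>J. (cmod (\<Psi> (\<gamma> / a powi j)))\<^sup>2) \<le> b * B"
proof -
  have [measurable]: "\<Psi> \<in> borel_measurable borel" using \<Psi> by (rule L2_measurable)
  define l where "l n = a powi (- int n) / b" for n
  have l: "l n > 0" for n using a b by (simp add: l_def)
  define g where "g n \<gamma> = (\<Sum>j\<in>{- int n..int n}. (cmod (\<Psi> (\<gamma> / a powi j)))\<^sup>2)" for n \<gamma>
  have "AE \<gamma> in lborel. \<gamma> \<in> {of_int m * l n..of_int m * l n + l n} \<longrightarrow> g n \<gamma> \<le> b * B" for m :: int and n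
  proof (rule AE_le_from_integrals)
    show "g n \<in> borel_measurable borel" unfolding g_def[abs_def] by measurable
    show "AE \<gamma> in lborel. \<bar>g n \<gamma>\<bar> \<le> (\<Sum>j\<in>{- int n..int n}. C\<^sup>2)"
    proof (rule AE_I2)
      fix \<gamma>
      have "\<bar>g n \<gamma>\<bar> = g n \<gamma>" unfolding g_def by (simp add: sum_nonneg)
      also have "\<dots> \<le> (\<Sum>j\<in>{- int n..int n}. C\<^sup>2)"
        unfolding g_def using bnd by (intro sum_mono power_mono) auto
      finally show "\<bar>g n \<gamma>\<bar> \<le> (\<Sum>j\<in>{- int n..int n}. C\<^sup>2)" .
    qed
    show "emeasure lborel {of_int m * l n..of_int m * l n + l n} < \<infinity>"
      using l[of n] by (simp add: emeasure_lborel_Icc_eq)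
    fix E :: "real set" assume E: "E \<in> sets borel" and EI: "E \<subseteq> {of_int m * l n..of_int m * l n + l n}"
    note ind = indicator_scale_energy[OF a b \<Psi> bnd E EI[unfolded l_def]]
    have E_L2: "indicator E \<in> L2" and E_norm: "(norm_L2 (indicator E))\<^sup>2 = measure lborel E"
      using ind(3,4)[of 0] by auto
    have "(\<Sum>j\<in>{- int n..int n}. 1 / b * (LINT \<gamma>|lborel. indicator E \<gamma> * (cmod (\<Psi> (\<gamma> / a powi j)))\<^sup>2))
        \<le> B * measure lborel E"
    proof (rule sum_rows_le)
      fix S :: "int set" assume "finite S"
      then have "(\<Sum>i\<in>{- int n..int n} \<times> S. (cmod (inner_L2 (indicator E) (freq_system a b \<Psi> i)))\<^sup>2)
          \<le> (\<Sum>\<^sub>\<infinity>i. (cmod (inner_L2 (indicator E) (freq_system a b \<Psi> i)))\<^sup>2)"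
        by (intro finite_sum_le_infsum summ E_L2) auto
      also have "\<dots> \<le> B * measure lborel E" using upper[OF E_L2] by (simp only: E_norm)
      finally show "(\<Sum>i\<in>{- int n..int n} \<times> S. (cmod (inner_L2 (indicator E) (freq_system a b \<Psi> i)))\<^sup>2)
          \<le> B * measure lborel E" .
    qed (use ind(1) in auto)
    also have "(\<Sum>j\<in>{- int n..int n}. 1 / b * (LINT \<gamma>|lborel. indicator E \<gamma> * (cmod (\<Psi> (\<gamma> / a powi j)))\<^sup>2))
        = 1 / b * (LINT \<gamma>|lborel. (\<Sum>j\<in>{- int n..int n}. indicator E \<gamma> * (cmod (\<Psi> (\<gamma> / a powi j)))\<^sup>2))"
    proof -
      have "(LINT \<gamma>|lborel. (\<Sum>j\<in>{- int n..int n}. indicator E \<gamma> * (cmod (\<Psi> (\<gamma> / a powi j)))\<^sup>2))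
          = (\<Sum>j\<in>{- int n..int n}. LINT \<gamma>|lborel. indicator E \<gamma> * (cmod (\<Psi> (\<gamma> / a powi j)))\<^sup>2)"
        by (rule Bochner_Integration.integral_sum) (rule ind(2), simp)
      then show ?thesis by (simp only: sum_distrib_left)
    qed
    also have "\<dots> = 1 / b * (LINT \<gamma>|lborel. indicator E \<gamma> * g n \<gamma>)"
      by (simp only: g_def sum_distrib_left)
    finally show "(LINT \<gamma>|lborel. indicator E \<gamma> * g n \<gamma>) \<le> b * B * measure lborel E"
      using b by (simp add: field_simps)
  qed auto
  then have "AE \<gamma> in lborel. \<forall>m::int. \<forall>n. \<gamma> \<in> {of_int m * l n..of_int m * l n + l n} \<longrightarrow> g n \<gamma> \<le> b * B"
    by (simp only: AE_all_countable simp_thms)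
  then show ?thesis
  proof (eventually_elim, intro allI impI)
    fix \<gamma> and J :: "int set"
    assume *: "\<forall>m::int. \<forall>n. \<gamma> \<in> {of_int m * l n..of_int m * l n + l n} \<longrightarrow> g n \<gamma> \<le> b * B" and "finite J"
    then obtain n where n: "J \<subseteq> {- int n..int n}" using finite_int_subset_symmetric by blast
    have "(\<Sum>j\<in>J. (cmod (\<Psi> (\<gamma> / a powi j)))\<^sup>2) \<le> g n \<gamma>"
      unfolding g_def using n by (intro sum_mono2) auto
    also have "\<dots> \<le> b * B" using * in_cell_closed[OF l, of \<gamma> n] by blast
    finally show "(\<Sum>j\<in>J. (cmod (\<Psi> (\<gamma> / a powi j)))\<^sup>2) \<le> b * B" .
  qed
qed

lemma tail_bound_tendsto_0:
  assumes "p > 1" shows "(tail_bound a b C p \<longlongrightarrow> 0) at_top"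
proof -
  have lim: "((\<lambda>K. K powr (- p)) \<longlongrightarrow> 0) at_top" "((\<lambda>K. K powr (1 - p)) \<longlongrightarrow> 0) at_top"
    by (rule tendsto_neg_powr[OF _ filterlim_ident], use assms in simp)+
  note sum0 = tendsto_add_zero[OF lim(1) tendsto_divide_zero[OF lim(2), of "1 / b * (p - 1)"]]
  have "((\<lambda>K. C * (2 * (K powr (- p) + K powr (1 - p) / (1 / b * (p - 1)))) / b) \<longlongrightarrow> 0) at_top"
    by (intro tendsto_divide_zero tendsto_mult_right_zero sum0)
  moreover have "((\<lambda>K. C * K powr (- p) * (a powr p / (a powr p - 1))) \<longlongrightarrow> 0) at_top"
    by (intro tendsto_mult_left_zero tendsto_mult_right_zero lim(1))
  ultimately show ?thesis unfolding tail_bound_def[abs_def] by (rule tendsto_mult_zero)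
qed

lemma filterlim_power_at_top:
  assumes "a > (1::real)" "c > 0"
  shows "filterlim (\<lambda>n. c * a ^ n) at_top sequentially"
  unfolding filterlim_at_top
proof
  fix Z
  obtain n where n: "Z / c < a ^ n" using real_arch_pow[OF assms(1)] by blast
  have "Z \<le> c * a ^ m" if "m \<ge> n" for m
  proof -
    have "Z / c \<le> a ^ m" using n power_increasing[OF that, of a] assms(1) by linarith
    then show ?thesis using assms(2) by (simp add: field_simps)
  qed
  then show "\<forall>\<^sub>F m in sequentially. Z \<le> c * a ^ m" by (rule eventually_sequentiallyI)
qed

text \<open>
  For \<open>E\<close> in an interval of length \<open>a\<^sup>-\<^sup>n / b\<close> at distance at least \<open>\<delta>\<close> from the origin, the scales
  \<open>j \<ge> -n\<close> contribute at most the integral of the energy, and the remaining ones only see the part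
  of \<open>\<Psi>\<close> beyond \<open>\<delta> a\<^sup>n\<close>, whose Bessel bound tends to \<open>0\<close> as \<open>n\<close> grows.
\<close>

theorem frame_lower_energy:
  assumes a: "a > 1" and b: "b > 0" and p: "p > 1" and C: "C \<ge> 0" and \<Psi>: "\<Psi> \<in> L2"
    and bnd: "\<And>x. cmod (\<Psi> x) \<le> C"
    and decay: "\<And>x. x \<noteq> 0 \<Longrightarrow> cmod (\<Psi> x) \<le> C * \<bar>x\<bar> powr (- p)"
    and summ: "\<And>F. F \<in> L2 \<Longrightarrow> (\<lambda>i. (cmod (inner_L2 F (freq_system a b \<Psi> i)))\<^sup>2) summable_on UNIV"
    and lower: "\<And>F. F \<in> L2 \<Longrightarrow> A * (norm_L2 F)\<^sup>2 \<le> (\<Sum>\<^sub>\<infinity>i. (cmod (inner_L2 F (freq_system a b \<Psi> i)))\<^sup>2)"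
    and energy: "AE \<gamma> in lborel. \<forall>J. finite J \<longrightarrow> (\<Sum>j\<in>J. (cmod (\<Psi> (\<gamma> / a powi j)))\<^sup>2) \<le> D"
  shows "AE \<gamma> in lborel. b * A \<le> scale_energy a \<Psi> \<gamma>"
proof -
  have [measurable]: "\<Psi> \<in> borel_measurable borel" using \<Psi> by (rule L2_measurable)
  define l where "l n = a powi (- int n) / b" for n
  have l: "l n > 0" for n using a b by (simp add: l_def)
  define \<delta> where "\<delta> d = 1 / real (Suc d)" for d
  have \<delta>: "\<delta> d > 0" for d by (simp add: \<delta>_def)
  define \<tau> where "\<tau> n d = tail_bound a b C p (\<delta> d * a ^ n)" for n d
  define I where "I m n d = {of_int m * l n..of_int m * l n + l n} \<inter> {x. \<bar>x\<bar> \<ge> \<delta> d}" for m :: int and n d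
  have "AE \<gamma> in lborel. \<gamma> \<in> I m n d \<longrightarrow> - scale_energy a \<Psi> \<gamma> \<le> - (b * (A - \<tau> n d))" for m n d
  proof (rule AE_le_from_integrals)
    show "(\<lambda>\<gamma>. - scale_energy a \<Psi> \<gamma>) \<in> borel_measurable borel" by measurable
    show "I m n d \<in> sets borel" unfolding I_def by measurable
    have "emeasure lborel (I m n d) \<le> emeasure lborel {of_int m * l n..of_int m * l n + l n}"
      by (rule emeasure_mono) (auto simp: I_def)
    also have "\<dots> < \<infinity>" by (simp add: emeasure_lborel_Icc_eq)
    finally show "emeasure lborel (I m n d) < \<infinity>" .
    show "AE \<gamma> in lborel. \<bar>- scale_energy a \<Psi> \<gamma>\<bar> \<le> D"
      using energy by eventually_elim (auto simp: abs_of_nonneg scale_energy_nonneg intro: scale_energy_summable(2))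
    fix E :: "real set" assume E [measurable]: "E \<in> sets borel" and EI: "E \<subseteq> I m n d"
    have EI': "E \<subseteq> {of_int m * l n..of_int m * l n + a powi (- int n) / b}"
      using EI by (auto simp: I_def l_def)
    note ind = indicator_scale_energy[OF a b \<Psi> bnd E EI']
    have E_L2: "indicator E \<in> L2" and E_norm: "(norm_L2 (indicator E))\<^sup>2 = measure lborel E"
      using ind(3,4)[of 0] by auto
    have energy_int: "integrable lborel (\<lambda>\<gamma>. indicator E \<gamma> * scale_energy a \<Psi> \<gamma>)"
    proof (rule Bochner_Integration.integrable_bound)
      show "integrable lborel (\<lambda>\<gamma>. D * (cmod (indicator E \<gamma>))\<^sup>2)"
        using L2_integrable_square[OF E_L2] by (rule integrable_mult_right)
      show "AE \<gamma> in lborel. norm (indicator E \<gamma> * scale_energy a \<Psi> \<gamma>) \<le> norm (D * (cmod (indicator E \<gamma>))\<^sup>2)"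
        using energy
      proof eventually_elim
        case (elim \<gamma>)
        then have "scale_energy a \<Psi> \<gamma> \<le> D" by (intro scale_energy_summable(2)) auto
        then show ?case using scale_energy_nonneg[of a \<Psi> \<gamma>] by (simp add: indicator_def)
      qed
    qed measurable
    \<comment> \<open>the part of \<open>\<Psi>\<close> that the scales \<open>j < -n\<close> move onto \<open>E\<close>\<close>
    define H where "H x = (if \<bar>x\<bar> > \<delta> d * a ^ n then \<Psi> x else 0)" for x
    have H: "H \<in> L2"
      by (rule L2_dominated[OF \<Psi>]) (auto simp: H_def[abs_def])
    have tail_eq: "inner_L2 (indicator E) (freq_system a b \<Psi> (j, k)) = inner_L2 (indicator E) (freq_system a b H (j, k))"
      if j: "j < - int n" for j k
      unfolding inner_L2_def
    proof (intro Bochner_Integration.integral_cong refl)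
      fix \<gamma>
      show "indicator E \<gamma> * cnj (freq_system a b \<Psi> (j, k) \<gamma>) = indicator E \<gamma> * cnj (freq_system a b H (j, k) \<gamma>)"
      proof (cases "\<gamma> \<in> E")
        case True
        then have \<gamma>: "\<delta> d \<le> \<bar>\<gamma>\<bar>" using EI by (auto simp: I_def)
        have "\<delta> d * a ^ n \<le> \<bar>\<gamma>\<bar> * a powi (int n)" using \<gamma> a by (simp add: mult_right_mono)
        also have "\<dots> < \<bar>\<gamma>\<bar> * a powi (- j)"
          using \<gamma> \<delta>[of d] a j by (intro mult_strict_left_mono power_int_strict_increasing) auto
        also have "\<dots> = \<bar>\<gamma> / a powi j\<bar>" using a by (simp add: abs_mult power_int_minus divide_inverse)
        finally show ?thesis by (simp add: freq_system_def H_def)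
      qed simp
    qed
    have "A * measure lborel E \<le> (\<Sum>\<^sub>\<infinity>i. (cmod (inner_L2 (indicator E) (freq_system a b \<Psi> i)))\<^sup>2)"
      using lower[OF E_L2] by (simp only: E_norm)
    also have "\<dots> \<le> 1 / b * (LINT \<gamma>|lborel. indicator E \<gamma> * scale_energy a \<Psi> \<gamma>) + \<tau> n d * measure lborel E"
    proof (rule infsum_le_finite_sums[OF summ[OF E_L2]])
      fix T :: "(int \<times> int) set" assume T: "finite T"
      let ?c = "\<lambda>i. (cmod (inner_L2 (indicator E) (freq_system a b \<Psi> i)))\<^sup>2"
      let ?T1 = "{i \<in> T. fst i \<ge> - int n}" and ?T2 = "{i \<in> T. fst i < - int n}"
      have "sum ?c T = sum ?c ?T1 + sum ?c ?T2"
        using T by (subst sum.union_disjoint[symmetric]) (auto intro: sum.cong)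
      also have "sum ?c ?T2 = (\<Sum>i\<in>?T2. (cmod (inner_L2 (indicator E) (freq_system a b H i)))\<^sup>2)"
        using tail_eq by (intro sum.cong refl) (auto simp: split_paired_all)
      also have "\<dots> \<le> tail_bound a b C p (\<delta> d * a ^ n) * (norm_L2 (indicator E))\<^sup>2"
      proof (rule tail_system_Bessel[OF a b p _ C H E_L2])
        show pos: "0 < \<delta> d * a ^ n" using \<delta>[of d] a by simp
        show "cmod (H x) \<le> C * \<bar>x\<bar> powr (- p)" if "\<bar>x\<bar> > \<delta> d * a ^ n" for x
        proof -
          have "x \<noteq> 0" using that pos by auto
          then show ?thesis using decay that by (simp add: H_def)
        qed
      qed (use T in \<open>auto simp: H_def\<close>)
      also have "\<dots> = \<tau> n d * measure lborel E" by (simp add: \<tau>_def E_norm)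
      also have "sum ?c ?T1 \<le> (\<Sum>j\<in>fst ` ?T1. \<Sum>k\<in>snd ` ?T1. ?c (j, k))"
        using T by (intro sum_subset_product_le) auto
      also have "\<dots> \<le> (\<Sum>j\<in>fst ` ?T1. 1 / b * (LINT \<gamma>|lborel. indicator E \<gamma> * (cmod (\<Psi> (\<gamma> / a powi j)))\<^sup>2))"
        using T by (intro sum_mono finite_sum_le_has_sum[OF ind(1)]) auto
      also have "\<dots> = 1 / b * (LINT \<gamma>|lborel. (\<Sum>j\<in>fst ` ?T1. indicator E \<gamma> * (cmod (\<Psi> (\<gamma> / a powi j)))\<^sup>2))"
      proof -
        have "(LINT \<gamma>|lborel. (\<Sum>j\<in>fst ` ?T1. indicator E \<gamma> * (cmod (\<Psi> (\<gamma> / a powi j)))\<^sup>2))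
            = (\<Sum>j\<in>fst ` ?T1. LINT \<gamma>|lborel. indicator E \<gamma> * (cmod (\<Psi> (\<gamma> / a powi j)))\<^sup>2)"
          by (rule Bochner_Integration.integral_sum) (rule ind(2), auto)
        then show ?thesis by (simp only: sum_distrib_left)
      qed
      also have "\<dots> \<le> 1 / b * (LINT \<gamma>|lborel. indicator E \<gamma> * scale_energy a \<Psi> \<gamma>)"
      proof (intro mult_left_mono integral_mono_AE Bochner_Integration.integrable_sum energy_int)
        show "AE \<gamma> in lborel. (\<Sum>j\<in>fst ` ?T1. indicator E \<gamma> * (cmod (\<Psi> (\<gamma> / a powi j)))\<^sup>2)
            \<le> indicator E \<gamma> * scale_energy a \<Psi> \<gamma>"
          using energy
        proof eventually_elim
          case (elim \<gamma>)
          have "(\<Sum>j\<in>fst ` ?T1. (cmod (\<Psi> (\<gamma> / a powi j)))\<^sup>2) \<le> scale_energy a \<Psi> \<gamma>"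
            unfolding scale_energy_def
            by (rule finite_sum_le_infsum[OF scale_energy_summable(1)]) (use elim T in auto)
          then show ?case unfolding sum_distrib_left[symmetric] by (intro mult_left_mono) auto
        qed
      qed (use b ind(2) in auto)
      finally show "sum ?c T \<le> 1 / b * (LINT \<gamma>|lborel. indicator E \<gamma> * scale_energy a \<Psi> \<gamma>) + \<tau> n d * measure lborel E"
        by simp
    qed
    finally have "b * (A * measure lborel E) \<le> b * (1 / b * (LINT \<gamma>|lborel. indicator E \<gamma> * scale_energy a \<Psi> \<gamma>) + \<tau> n d * measure lborel E)"
      using b by (intro mult_left_mono) auto
    also have "\<dots> = (LINT \<gamma>|lborel. indicator E \<gamma> * scale_energy a \<Psi> \<gamma>) + b * \<tau> n d * measure lborel E"
      using b by (simp add: algebra_simps)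
    finally show "(LINT \<gamma>|lborel. indicator E \<gamma> * - scale_energy a \<Psi> \<gamma>) \<le> - (b * (A - \<tau> n d)) * measure lborel E"
      by (simp add: algebra_simps)
  qed
  then have "AE \<gamma> in lborel. \<forall>(m::int) n d. \<gamma> \<in> I m n d \<longrightarrow> - scale_energy a \<Psi> \<gamma> \<le> - (b * (A - \<tau> n d))"
    by (simp only: AE_all_countable simp_thms)
  moreover have "AE \<gamma> in lborel. \<gamma> \<noteq> (0::real)" by (rule AE_lborel_singleton)
  ultimately show ?thesis
  proof eventually_elim
    case (elim \<gamma>)
    obtain d where d: "\<delta> d < \<bar>\<gamma>\<bar>" using reals_Archimedean[of "\<bar>\<gamma>\<bar>"] elim(2) by (auto simp: \<delta>_def inverse_eq_divide)
    have le: "b * (A - \<tau> n d) \<le> scale_energy a \<Psi> \<gamma>" for n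
    proof -
      obtain m where "\<gamma> \<in> {of_int m * l n..of_int m * l n + l n}" using in_cell_closed[OF l] by blast
      then have "\<gamma> \<in> I m n d" using d by (simp add: I_def)
      then show ?thesis using elim(1) by force
    qed
    have "(\<lambda>n. \<tau> n d) \<longlonglongrightarrow> 0"
      unfolding \<tau>_def by (rule filterlim_compose[OF tail_bound_tendsto_0[OF p] filterlim_power_at_top[OF a \<delta>]])
    then have "(\<lambda>n. b * (A - \<tau> n d)) \<longlonglongrightarrow> b * (A - 0)" by (intro tendsto_intros)
    from LIMSEQ_le_const2[OF this] le show ?case by simp
  qed
qed

section \<open>Band-limited systems\<close>

lemma has_sum_rows:
  fixes c :: "'a \<times> 'b \<Rightarrow> real"
  assumes nonneg: "\<And>i. 0 \<le> c i" and rows: "\<And>j. ((\<lambda>k. c (j, k)) has_sum s j) UNIV"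
    and total: "(s has_sum t) UNIV"
  shows "(c has_sum t) UNIV"
proof (rule has_sum_nonneg_realI)
  have s0: "0 \<le> s j" for j using rows[of j] nonneg by (auto intro: has_sum_nonneg)
  fix T :: "('a \<times> 'b) set" assume T: "finite T"
  have "sum c T \<le> (\<Sum>j\<in>fst ` T. \<Sum>k\<in>snd ` T. c (j, k))" by (rule sum_subset_product_le[OF T nonneg])
  also have "\<dots> \<le> (\<Sum>j\<in>fst ` T. s j)"
    using T nonneg by (intro sum_mono finite_sum_le_has_sum[OF rows]) auto
  also have "\<dots> \<le> t" using T s0 by (intro finite_sum_le_has_sum[OF total]) auto
  finally show "sum c T \<le> t" .
next
  fix e :: real assume e: "e > 0"
  have "\<forall>\<^sub>F J in finite_subsets_at_top UNIV. t - e / 2 < sum s J"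
    using total e unfolding has_sum_def by (intro order_tendstoD(1)) auto
  then obtain J where J: "finite J" "t - e / 2 < sum s J"
    unfolding eventually_finite_subsets_at_top by auto
  have "((\<lambda>S. \<Sum>j\<in>J. \<Sum>k\<in>S. c (j, k)) \<longlongrightarrow> sum s J) (finite_subsets_at_top UNIV)"
    using rows by (intro tendsto_sum) (simp add: has_sum_def)
  then have "\<forall>\<^sub>F S in finite_subsets_at_top UNIV. sum s J - e / 2 < (\<Sum>j\<in>J. \<Sum>k\<in>S. c (j, k))"
    using e by (intro order_tendstoD(1)) auto
  then obtain S where S: "finite S" "sum s J - e / 2 < (\<Sum>j\<in>J. \<Sum>k\<in>S. c (j, k))"
    unfolding eventually_finite_subsets_at_top by auto
  then have "t - e < sum c (J \<times> S)" using J by (simp add: sum.cartesian_product)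
  then show "\<exists>F. finite F \<and> F \<subseteq> UNIV \<and> t - e < sum c F"
    using J(1) S(1) by (intro exI[of _ "J \<times> S"]) simp
qed (rule nonneg)

lemma has_sum_int_LIMSEQ:
  assumes "(f has_sum s) (UNIV :: int set)"
  shows "(\<lambda>n. \<Sum>j\<in>{- int n..int n}. f j) \<longlonglongrightarrow> s"
proof -
  have "filterlim (\<lambda>n. {- int n..int n}) (finite_subsets_at_top UNIV) sequentially"
    unfolding filterlim_finite_subsets_at_top
  proof (intro allI impI)
    fix X :: "int set" assume "finite X \<and> X \<subseteq> UNIV"
    then obtain n where "X \<subseteq> {- int n..int n}" using finite_int_subset_symmetric by blast
    then show "\<forall>\<^sub>F m in sequentially. finite {- int m..int m} \<and> X \<subseteq> {- int m..int m} \<and> {- int m..int m} \<subseteq> UNIV"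
      by (intro eventually_sequentiallyI[of n]) force
  qed
  from filterlim_compose[OF assms[unfolded has_sum_def] this] show ?thesis .
qed

lemma integrable_square_mult_bounded:
  assumes U: "U \<in> L2" and [measurable]: "S \<in> borel_measurable borel" and D: "AE x in lborel. \<bar>S x\<bar> \<le> D"
  shows "integrable lborel (\<lambda>x. (cmod (U x))\<^sup>2 * S x)"
proof (rule Bochner_Integration.integrable_bound)
  have [measurable]: "U \<in> borel_measurable borel" using U by (rule L2_measurable)
  show "integrable lborel (\<lambda>x. D * (cmod (U x))\<^sup>2)" using L2_integrable_square[OF U] by simp
  show "AE x in lborel. norm ((cmod (U x))\<^sup>2 * S x) \<le> norm (D * (cmod (U x))\<^sup>2)"
    using D
  proof eventually_elim
    case (elim x)
    then have "\<bar>S x\<bar> \<le> \<bar>D\<bar>" by linarith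
    then show ?case by (simp add: abs_mult mult.commute[of D] mult_left_mono)
  qed
  show "(\<lambda>x. (cmod (U x))\<^sup>2 * S x) \<in> borel_measurable lborel" by measurable
qed

text \<open>
  When the generator lives on an interval of length at most \<open>1 / b\<close> there is no overlap at any scale.
  Parseval's identity at every scale shows that the frame operator is multiplication by
  \<open>(1 / b) \<Sum>j. |\<Phi>(\<gamma> / a\<^sup>j)|\<^sup>2\<close>.
\<close>

theorem band_system_energy:
  assumes a: "a > 1" and b: "b > 0" and \<Phi>: "\<Phi> \<in> L2" and bnd: "\<And>x. cmod (\<Phi> x) \<le> C"
    and supp: "\<And>x. \<bar>x\<bar> > R \<Longrightarrow> \<Phi> x = 0" and R: "2 * R \<le> 1 / b"
    and energy: "AE \<gamma> in lborel. \<forall>J. finite J \<longrightarrow> (\<Sum>j\<in>J. (cmod (\<Phi> (\<gamma> / a powi j)))\<^sup>2) \<le> D"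
    and U: "U \<in> L2"
  shows "((\<lambda>i. (cmod (inner_L2 U (freq_system a b \<Phi> i)))\<^sup>2) has_sum
    1 / b * (LINT \<gamma>|lborel. (cmod (U \<gamma>))\<^sup>2 * scale_energy a \<Phi> \<gamma>)) UNIV"
proof (rule has_sum_rows)
  have [measurable]: "\<Phi> \<in> borel_measurable borel" "U \<in> borel_measurable borel"
    using \<Phi> U by (auto intro: L2_measurable)
  let ?w = "\<lambda>j \<gamma>. (cmod (U \<gamma>))\<^sup>2 * (cmod (\<Phi> (\<gamma> / a powi j)))\<^sup>2"
  have int: "integrable lborel (?w j)" for j
    by (rule integrable_square_mult_bounded[OF U, of _ "C\<^sup>2"]) (use bnd in \<open>auto intro!: power_mono\<close>)
  have energy_le: "AE \<gamma> in lborel. scale_energy a \<Phi> \<gamma> \<le> D"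
    using energy by eventually_elim (auto intro: scale_energy_summable(2))
  have int_energy: "integrable lborel (\<lambda>\<gamma>. (cmod (U \<gamma>))\<^sup>2 * scale_energy a \<Phi> \<gamma>)"
    by (rule integrable_square_mult_bounded[OF U, of _ D])
      (use energy_le in \<open>auto simp: abs_of_nonneg scale_energy_nonneg\<close>)
  have partial: "(\<Sum>j\<in>J. 1 / b * (LINT \<gamma>|lborel. ?w j \<gamma>)) = 1 / b * (LINT \<gamma>|lborel. (\<Sum>j\<in>J. ?w j \<gamma>))" for J
    by (simp only: sum_distrib_left Bochner_Integration.integral_sum[OF int])
  have pointwise: "AE \<gamma> in lborel. (\<Sum>j\<in>J. ?w j \<gamma>) \<le> (cmod (U \<gamma>))\<^sup>2 * scale_energy a \<Phi> \<gamma>" if "finite J" for J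
    using energy
  proof eventually_elim
    case (elim \<gamma>)
    have "(\<Sum>j\<in>J. (cmod (\<Phi> (\<gamma> / a powi j)))\<^sup>2) \<le> scale_energy a \<Phi> \<gamma>"
      unfolding scale_energy_def
      by (rule finite_sum_le_infsum[OF scale_energy_summable(1)]) (use elim that in auto)
    then show ?case unfolding sum_distrib_left[symmetric] by (intro mult_left_mono) auto
  qed
  show "((\<lambda>k. (cmod (inner_L2 U (freq_system a b \<Phi> (j, k))))\<^sup>2) has_sum 1 / b * (LINT \<gamma>|lborel. ?w j \<gamma>)) UNIV" for j
  proof (rule freq_system_scale_energy[where c="- R * a powi j"])
    show "(\<lambda>\<gamma>. U \<gamma> * cnj (\<Phi> (\<gamma> / a powi j))) \<in> L2"
      using L2_bounded_mult[OF U, of "\<lambda>\<gamma>. cnj (\<Phi> (\<gamma> / a powi j))" C] bnd by (simp add: mult.commute)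
    fix \<gamma> assume out: "\<gamma> \<notin> {- R * a powi j..- R * a powi j + a powi j / b}"
    have s: "a powi j > 0" using a by simp
    have "\<bar>\<gamma> / a powi j\<bar> > R"
    proof (rule ccontr)
      assume "\<not> \<bar>\<gamma> / a powi j\<bar> > R"
      then have "- R \<le> \<gamma> / a powi j" "\<gamma> / a powi j \<le> R" by linarith+
      then have "- R * a powi j \<le> \<gamma>" "\<gamma> \<le> R * a powi j"
        using s by (simp_all add: pos_le_divide_eq pos_divide_le_eq)
      moreover have "2 * R * a powi j \<le> 1 / b * a powi j" using R s by (intro mult_right_mono) auto
      ultimately show False using out by auto
    qed
    then show "U \<gamma> = 0 \<or> \<Phi> (\<gamma> / a powi j) = 0" using supp by simp
  qed (use a b in auto)
  show "((\<lambda>j. 1 / b * (LINT \<gamma>|lborel. ?w j \<gamma>)) has_sum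
      1 / b * (LINT \<gamma>|lborel. (cmod (U \<gamma>))\<^sup>2 * scale_energy a \<Phi> \<gamma>)) UNIV"
  proof (rule has_sum_nonneg_realI)
    fix J :: "int set" assume J: "finite J"
    show "(\<Sum>j\<in>J. 1 / b * (LINT \<gamma>|lborel. ?w j \<gamma>)) \<le> 1 / b * (LINT \<gamma>|lborel. (cmod (U \<gamma>))\<^sup>2 * scale_energy a \<Phi> \<gamma>)"
      unfolding partial
      by (intro mult_left_mono integral_mono_AE Bochner_Integration.integrable_sum int int_energy pointwise J)
        (use b in simp)
  next
    have "(\<lambda>n. LINT \<gamma>|lborel. (\<Sum>j\<in>{- int n..int n}. ?w j \<gamma>)) \<longlonglongrightarrow>
        (LINT \<gamma>|lborel. (cmod (U \<gamma>))\<^sup>2 * scale_energy a \<Phi> \<gamma>)"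
    proof (rule integral_dominated_convergence[OF _ _ int_energy])
      show "AE \<gamma> in lborel. (\<lambda>n. \<Sum>j\<in>{- int n..int n}. ?w j \<gamma>) \<longlonglongrightarrow> (cmod (U \<gamma>))\<^sup>2 * scale_energy a \<Phi> \<gamma>"
        using energy
      proof eventually_elim
        case (elim \<gamma>)
        have "((\<lambda>j. (cmod (\<Phi> (\<gamma> / a powi j)))\<^sup>2) has_sum scale_energy a \<Phi> \<gamma>) UNIV"
          unfolding scale_energy_def by (rule has_sum_infsum[OF scale_energy_summable(1)]) (use elim in auto)
        from tendsto_mult[OF tendsto_const has_sum_int_LIMSEQ[OF this]]
        show ?case by (simp only: sum_distrib_left)
      qed
      show "AE \<gamma> in lborel. norm (\<Sum>j\<in>{- int n..int n}. ?w j \<gamma>) \<le> (cmod (U \<gamma>))\<^sup>2 * scale_energy a \<Phi> \<gamma>" for n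
        using pointwise[of "{- int n..int n}"] by (simp add: abs_of_nonneg sum_nonneg)
    qed measurable
    then have lim: "(\<lambda>n. \<Sum>j\<in>{- int n..int n}. 1 / b * (LINT \<gamma>|lborel. ?w j \<gamma>)) \<longlonglongrightarrow>
        1 / b * (LINT \<gamma>|lborel. (cmod (U \<gamma>))\<^sup>2 * scale_energy a \<Phi> \<gamma>)"
      unfolding partial by (intro tendsto_mult tendsto_const)
    fix e :: real assume "e > 0"
    then have "\<forall>\<^sub>F n in sequentially. 1 / b * (LINT \<gamma>|lborel. (cmod (U \<gamma>))\<^sup>2 * scale_energy a \<Phi> \<gamma>) - e
        < (\<Sum>j\<in>{- int n..int n}. 1 / b * (LINT \<gamma>|lborel. ?w j \<gamma>))"
      by (intro order_tendstoD(1)[OF lim]) auto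
    then obtain n where "1 / b * (LINT \<gamma>|lborel. (cmod (U \<gamma>))\<^sup>2 * scale_energy a \<Phi> \<gamma>) - e
        < (\<Sum>j\<in>{- int n..int n}. 1 / b * (LINT \<gamma>|lborel. ?w j \<gamma>))"
      using eventually_happens'[OF sequentially_bot] by blast
    then show "\<exists>J. finite J \<and> J \<subseteq> UNIV \<and> 1 / b * (LINT \<gamma>|lborel. (cmod (U \<gamma>))\<^sup>2 * scale_energy a \<Phi> \<gamma>) - e
        < (\<Sum>j\<in>J. 1 / b * (LINT \<gamma>|lborel. ?w j \<gamma>))"
      by (intro exI[of _ "{- int n..int n}"]) auto
  qed (use b in auto)
qed simp

lemma complex_polarization:
  "z * cnj w = (of_real ((cmod (z + w))\<^sup>2) + (- 1) * of_real ((cmod (z + (- 1) * w))\<^sup>2)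
    + \<i> * of_real ((cmod (z + \<i> * w))\<^sup>2) + (- \<i>) * of_real ((cmod (z + (- \<i>) * w))\<^sup>2)) / 4"
  unfolding cmod_power2 by (simp add: complex_eq_iff power2_eq_square field_simps)

text \<open>
  The identity of quadratic forms proved above yields the identity of the sesquilinear forms, which is
  what reconstruction requires.
\<close>

lemma weighted_polarization:
  assumes P: "\<And>i. P i \<in> L2" and S: "S \<in> borel_measurable borel" "AE x in lborel. \<bar>S x\<bar> \<le> D"
    and quad: "\<And>U. U \<in> L2 \<Longrightarrow> ((\<lambda>i. (cmod (inner_L2 U (P i)))\<^sup>2) has_sum
        c * (LINT x|lborel. (cmod (U x))\<^sup>2 * S x)) UNIV"
    and U: "U \<in> L2" and V: "V \<in> L2"
  shows "((\<lambda>i. inner_L2 U (P i) * cnj (inner_L2 V (P i))) has_sum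
      of_real c * (LINT x|lborel. U x * cnj (V x) * of_real (S x))) UNIV"
proof -
  have W: "(\<lambda>x. U x + d * V x) \<in> L2" for d using U V by (intro L2_add L2_scale)
  let ?q = "\<lambda>d. of_real (c * (LINT x|lborel. (cmod (U x + d * V x))\<^sup>2 * S x)) :: complex"
  have row: "((\<lambda>i. of_real ((cmod (inner_L2 U (P i) + d * inner_L2 V (P i)))\<^sup>2)) has_sum ?q d) UNIV" for d
    using has_sum_of_real[OF quad[OF W[of d]]] U V P
    by (simp add: inner_L2_add_left L2_scale inner_L2_scale_left)
  have "((\<lambda>i. inner_L2 U (P i) * cnj (inner_L2 V (P i))) has_sum
      (?q 1 + (- 1) * ?q (- 1) + \<i> * ?q \<i> + (- \<i>) * ?q (- \<i>)) * (1 / 4)) UNIV"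
  proof -
    have "((\<lambda>i. (of_real ((cmod (inner_L2 U (P i) + 1 * inner_L2 V (P i)))\<^sup>2)
        + (- 1) * of_real ((cmod (inner_L2 U (P i) + (- 1) * inner_L2 V (P i)))\<^sup>2)
        + \<i> * of_real ((cmod (inner_L2 U (P i) + \<i> * inner_L2 V (P i)))\<^sup>2)
        + (- \<i>) * of_real ((cmod (inner_L2 U (P i) + (- \<i>) * inner_L2 V (P i)))\<^sup>2)) * (1 / 4)) has_sum
      (?q 1 + (- 1) * ?q (- 1) + \<i> * ?q \<i> + (- \<i>) * ?q (- \<i>)) * (1 / 4)) UNIV"
      by (intro has_sum_cmult_left has_sum_add has_sum_cmult_right row)
    then show ?thesis
      unfolding complex_polarization[of "inner_L2 U _"] by simp
  qed
  also have "(?q 1 + (- 1) * ?q (- 1) + \<i> * ?q \<i> + (- \<i>) * ?q (- \<i>)) * (1 / 4)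
      = of_real c * (LINT x|lborel. U x * cnj (V x) * of_real (S x))"
  proof -
    have int: "integrable lborel (\<lambda>x. complex_of_real ((cmod (U x + d * V x))\<^sup>2 * S x))" for d
      using integrable_square_mult_bounded[OF W S] by (intro integrable_of_real)
    have "(LINT x|lborel. U x * cnj (V x) * of_real (S x)) = (LINT x|lborel.
       (complex_of_real ((cmod (U x + 1 * V x))\<^sup>2 * S x) + (- 1) * complex_of_real ((cmod (U x + (- 1) * V x))\<^sup>2 * S x)
       + \<i> * complex_of_real ((cmod (U x + \<i> * V x))\<^sup>2 * S x)
       + (- \<i>) * complex_of_real ((cmod (U x + (- \<i>) * V x))\<^sup>2 * S x)) * (1 / 4))"
      by (intro Bochner_Integration.integral_cong refl, subst complex_polarization)
        (simp add: algebra_simps add_divide_distrib diff_divide_distrib)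
    also have "\<dots> = (of_real (LINT x|lborel. (cmod (U x + 1 * V x))\<^sup>2 * S x)
       + (- 1) * of_real (LINT x|lborel. (cmod (U x + (- 1) * V x))\<^sup>2 * S x)
       + \<i> * of_real (LINT x|lborel. (cmod (U x + \<i> * V x))\<^sup>2 * S x)
       + (- \<i>) * of_real (LINT x|lborel. (cmod (U x + (- \<i>) * V x))\<^sup>2 * S x)) * (1 / 4)"
      by (simp only: integral_mult_left_zero integral_mult_right_zero integral_complex_of_real[symmetric]
          Bochner_Integration.integral_add integrable_mult_right int Bochner_Integration.integrable_add)
    finally have eq: "(LINT x|lborel. U x * cnj (V x) * of_real (S x)) = \<dots>" .
    show ?thesis unfolding eq of_real_mult by (simp only: ring_distribs mult_ac)
  qed
  finally show ?thesis .
qed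

section \<open>Synthesis and the reconstruction error\<close>

text \<open>
  The synthesis operator is the adjoint of the analysis operator: \<open>\<parallel>v\<parallel>\<^sup>2\<close> is the sum of \<open>c\<^sub>i \<langle>e\<^sub>i, v\<rangle>\<close>, to
  which the Cauchy--Schwarz and Bessel inequalities apply.
\<close>

lemma Bessel_combination_norm_le:
  assumes e: "\<And>i. e i \<in> L2" and T: "finite T" and \<beta>: "0 \<le> \<beta>"
    and Bessel: "\<And>u. u \<in> L2 \<Longrightarrow> (\<Sum>i\<in>T. (cmod (inner_L2 u (e i)))\<^sup>2) \<le> \<beta> * (norm_L2 u)\<^sup>2"
  shows "norm_L2 (\<lambda>x. \<Sum>i\<in>T. c i * e i x) \<le> sqrt (\<beta> * (\<Sum>i\<in>T. (cmod (c i))\<^sup>2))"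
proof -
  define v where "v x = (\<Sum>i\<in>T. c i * e i x)" for x
  have v: "v \<in> L2" unfolding v_def[abs_def] using e by (intro L2_sum L2_scale)
  have "inner_L2 v v = (\<Sum>i\<in>T. c i * inner_L2 (e i) v)"
    by (subst (1) v_def[abs_def], subst inner_L2_sum_left) (auto simp: inner_L2_scale_left v e)
  then have "(norm_L2 v)\<^sup>2 = cmod (\<Sum>i\<in>T. c i * inner_L2 (e i) v)"
    unfolding inner_L2_self by (metis norm_of_real abs_of_nonneg zero_le_power2)
  also have "\<dots> \<le> (\<Sum>i\<in>T. cmod (c i) * cmod (inner_L2 v (e i)))"
    by (rule norm_sum[THEN order_trans])
      (simp add: norm_mult inner_L2_cnj[symmetric, of v] flip: complex_mod_cnj[of "inner_L2 v _"])
  finally have "((norm_L2 v)\<^sup>2)\<^sup>2 \<le> (\<Sum>i\<in>T. cmod (c i) * cmod (inner_L2 v (e i)))\<^sup>2"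
    by (intro power_mono) auto
  also have "\<dots> \<le> (\<Sum>i\<in>T. (cmod (c i))\<^sup>2) * (\<Sum>i\<in>T. (cmod (inner_L2 v (e i)))\<^sup>2)"
    by (rule Cauchy_Schwarz_ineq_sum)
  also have "\<dots> \<le> (\<Sum>i\<in>T. (cmod (c i))\<^sup>2) * (\<beta> * (norm_L2 v)\<^sup>2)"
    by (intro mult_left_mono Bessel v sum_nonneg) auto
  finally have le: "(norm_L2 v)\<^sup>2 * (norm_L2 v)\<^sup>2 \<le> (\<beta> * (\<Sum>i\<in>T. (cmod (c i))\<^sup>2)) * (norm_L2 v)\<^sup>2"
    by (simp add: power2_eq_square mult_ac)
  have "norm_L2 v \<le> sqrt (\<beta> * (\<Sum>i\<in>T. (cmod (c i))\<^sup>2))"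
  proof (cases "norm_L2 v = 0")
    case True
    have "0 \<le> \<beta> * (\<Sum>i\<in>T. (cmod (c i))\<^sup>2)"
      using \<beta> by (intro mult_nonneg_nonneg sum_nonneg) auto
    then show ?thesis using True by simp
  next
    case False
    then have "(norm_L2 v)\<^sup>2 > 0" by simp
    with le have "(norm_L2 v)\<^sup>2 \<le> \<beta> * (\<Sum>i\<in>T. (cmod (c i))\<^sup>2)" by (rule mult_right_le_imp_le)
    then show ?thesis by (rule real_le_rsqrt)
  qed
  then show ?thesis by (simp add: v_def[abs_def])
qed

text \<open>
  By the preceding bound, square-summable coefficients make the finite partial sums a Cauchy net. The
  sums over finite sets \<open>J n\<close> that leave ever smaller tails converge by completeness, and the net has the
  same limit.
\<close>

lemma Bessel_synthesis:
  assumes e: "\<And>i. e i \<in> L2" and \<beta>: "0 \<le> \<beta>"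
    and Bessel: "\<And>u T. u \<in> L2 \<Longrightarrow> finite T \<Longrightarrow> (\<Sum>i\<in>T. (cmod (inner_L2 u (e i)))\<^sup>2) \<le> \<beta> * (norm_L2 u)\<^sup>2"
    and c: "(\<lambda>i. (cmod (c i))\<^sup>2) summable_on UNIV"
  shows "\<exists>g. has_sum_L2 (\<lambda>i x. c i * e i x) UNIV g"
proof -
  define v where "v T x = (\<Sum>i\<in>T. c i * e i x)" for T x
  have v: "v T \<in> L2" for T unfolding v_def[abs_def] using e by (intro L2_sum L2_scale)
  define s where "s = (\<Sum>\<^sub>\<infinity>i. (cmod (c i))\<^sup>2)"
  have tail: "\<exists>J. finite J \<and> (\<forall>T. finite T \<longrightarrow> J \<subseteq> T \<longrightarrow> norm_L2 (\<lambda>x. v T x - v J x) \<le> r)"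
    if r: "r > 0" for r
  proof -
    define d where "d = r\<^sup>2 / (\<beta> + 1)"
    have d: "d > 0" using r \<beta> by (simp add: d_def)
    have "\<forall>\<^sub>F J in finite_subsets_at_top UNIV. s - d < (\<Sum>i\<in>J. (cmod (c i))\<^sup>2)"
      using has_sum_infsum[OF c] d unfolding has_sum_def s_def by (intro order_tendstoD(1)) auto
    then obtain J where J: "finite J" "s - d < (\<Sum>i\<in>J. (cmod (c i))\<^sup>2)"
      unfolding eventually_finite_subsets_at_top by auto
    have "norm_L2 (\<lambda>x. v T x - v J x) \<le> r" if T: "finite T" "J \<subseteq> T" for T
    proof -
      have "(\<Sum>i\<in>T. (cmod (c i))\<^sup>2) \<le> s"
        unfolding s_def using T by (intro finite_sum_le_infsum[OF c]) auto
      then have small: "(\<Sum>i\<in>T - J. (cmod (c i))\<^sup>2) \<le> d"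
        using J T by (simp add: sum_diff)
      have "v T x - v J x = (\<Sum>i\<in>T - J. c i * e i x)" for x
        unfolding v_def using T J by (simp add: sum_diff)
      then have "norm_L2 (\<lambda>x. v T x - v J x) = norm_L2 (\<lambda>x. \<Sum>i\<in>T - J. c i * e i x)" by simp
      also have "\<dots> \<le> sqrt (\<beta> * (\<Sum>i\<in>T - J. (cmod (c i))\<^sup>2))"
        using T \<beta> by (intro Bessel_combination_norm_le e Bessel) auto
      also have "\<dots> \<le> sqrt ((\<beta> + 1) * d)"
        using small \<beta> by (intro real_sqrt_le_mono mult_mono) (auto intro: sum_nonneg)
      also have "(\<beta> + 1) * d = r\<^sup>2" using \<beta> by (simp add: d_def)
      finally show ?thesis using r by simp
    qed
    then show ?thesis using J(1) by blast
  qed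
  have "\<exists>J. \<forall>n::nat. finite (J n) \<and> (\<forall>T. finite T \<longrightarrow> J n \<subseteq> T \<longrightarrow> norm_L2 (\<lambda>x. v T x - v (J n) x) \<le> inverse (real (Suc n)))"
    by (intro choice allI tail) simp
  then obtain J where J: "\<And>n. finite (J n)"
    "\<And>n T. finite T \<Longrightarrow> J n \<subseteq> T \<Longrightarrow> norm_L2 (\<lambda>x. v T x - v (J n) x) \<le> inverse (real (Suc n))" by blast
  have "\<exists>g. tendsto_L2 (\<lambda>n. v (J n)) g sequentially"
  proof (rule L2_complete[OF v])
    fix r :: real assume "r > 0"
    then obtain M where M: "inverse (real (Suc M)) < r / 2" using reals_Archimedean[of "r / 2"] by auto
    have "norm_L2 (\<lambda>x. v (J m) x - v (J n) x) < r" if "m \<ge> M" "n \<ge> M" for m n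
    proof -
      let ?T = "J m \<union> J n"
      have "inverse (real (Suc m)) \<le> inverse (real (Suc M))" "inverse (real (Suc n)) \<le> inverse (real (Suc M))"
        using that by (auto simp del: of_nat_Suc intro!: le_imp_inverse_le)
      moreover have "norm_L2 (\<lambda>x. v ?T x - v (J m) x) \<le> inverse (real (Suc m))"
        "norm_L2 (\<lambda>x. v ?T x - v (J n) x) \<le> inverse (real (Suc n))"
        by (rule J(2); use J(1) in simp)+
      moreover have "norm_L2 (\<lambda>x. v (J m) x - v (J n) x)
          \<le> norm_L2 (\<lambda>x. v (J m) x - v ?T x) + norm_L2 (\<lambda>x. v ?T x - v (J n) x)"
        by (rule norm_L2_triangle_diff[OF v v v])
      ultimately show ?thesis using M norm_L2_minus_commute[of "v (J m)" "v ?T"] by linarith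
    qed
    then show "\<exists>M. \<forall>m\<ge>M. \<forall>n\<ge>M. norm_L2 (\<lambda>x. v (J m) x - v (J n) x) < r" by blast
  qed
  then obtain g where g: "tendsto_L2 (\<lambda>n. v (J n)) g sequentially" by blast
  have gL2: "g \<in> L2" using g by (simp add: tendsto_L2_def)
  have "((\<lambda>T. norm_L2 (\<lambda>x. v T x - g x)) \<longlongrightarrow> 0) (finite_subsets_at_top UNIV)"
  proof (rule tendstoI)
    fix r :: real assume r: "r > 0"
    have "\<forall>\<^sub>F n in sequentially. norm_L2 (\<lambda>x. v (J n) x - g x) < r / 2 \<and> inverse (real (Suc n)) < r / 2"
      using g r LIMSEQ_inverse_real_of_nat unfolding tendsto_L2_def
      by (intro eventually_conj order_tendstoD(2)) auto
    then obtain n where n: "norm_L2 (\<lambda>x. v (J n) x - g x) < r / 2" "inverse (real (Suc n)) < r / 2"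
      using eventually_happens'[OF sequentially_bot] by blast
    have "norm_L2 (\<lambda>x. v T x - g x) < r" if "finite T" "J n \<subseteq> T" for T
      using norm_L2_triangle_diff[OF v[of T] v[of "J n"] gL2] J(2)[OF that] n by linarith
    then show "\<forall>\<^sub>F T in finite_subsets_at_top UNIV. dist (norm_L2 (\<lambda>x. v T x - g x)) 0 < r"
      unfolding eventually_finite_subsets_at_top using J(1)[of n] by (intro exI[of _ "J n"]) auto
  qed
  then have "has_sum_L2 (\<lambda>i x. c i * e i x) UNIV g"
    unfolding has_sum_L2_def tendsto_L2_def using v gL2 by (simp add: v_def[abs_def])
  then show ?thesis by (intro exI[of _ g])
qed

text \<open>
  If \<open>\<Sum>i. c\<^sub>i p\<^sub>i\<close> represents \<open>f\<close> weakly and \<open>p\<close> is replaced by \<open>p + h\<close>, then the error is,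
  up to sign, \<open>\<Sum>i. c\<^sub>i h\<^sub>i\<close>; testing it against itself bounds it by the norm of the coefficients and the Bessel
  bound of \<open>h\<close>.
\<close>

lemma perturbed_expansion_error:
  assumes e: "\<And>i. e i \<in> L2" and f: "f \<in> L2" and Y: "0 \<le> Y"
    and g: "has_sum_L2 (\<lambda>i x. c i * e i x) UNIV g"
    and split: "\<And>i u. u \<in> L2 \<Longrightarrow> inner_L2 (e i) u = inner_L2 (p i) u + inner_L2 (h i) u"
    and weak: "\<And>u. u \<in> L2 \<Longrightarrow> ((\<lambda>i. c i * inner_L2 (p i) u) has_sum inner_L2 f u) UNIV"
    and c: "\<And>T. finite T \<Longrightarrow> (\<Sum>i\<in>T. (cmod (c i))\<^sup>2) \<le> X"
    and h: "\<And>u T. u \<in> L2 \<Longrightarrow> finite T \<Longrightarrow> (\<Sum>i\<in>T. (cmod (inner_L2 u (h i)))\<^sup>2) \<le> Y * (norm_L2 u)\<^sup>2"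
  shows "norm_L2 (\<lambda>x. f x - g x) \<le> sqrt (X * Y)"
proof -
  have gL2: "g \<in> L2" using g by (simp add: has_sum_L2_def tendsto_L2_def)
  define u where "u x = f x - g x" for x
  have u: "u \<in> L2" unfolding u_def[abs_def] using f gL2 by (rule L2_diff)
  have X0: "0 \<le> X" using c[of "{}"] by simp
  have "((\<lambda>T. inner_L2 (\<lambda>x. \<Sum>i\<in>T. c i * e i x) u) \<longlongrightarrow> inner_L2 g u) (finite_subsets_at_top UNIV)"
    using tendsto_L2_inner[OF g[unfolded has_sum_L2_def] tendsto_L2_const[OF u]] .
  moreover have "inner_L2 (\<lambda>x. \<Sum>i\<in>T. c i * e i x) u = (\<Sum>i\<in>T. c i * inner_L2 (e i) u)" for T
    using e u by (subst inner_L2_sum_left) (auto simp: inner_L2_scale_left)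
  ultimately have "((\<lambda>i. c i * inner_L2 (e i) u) has_sum inner_L2 g u) UNIV"
    by (simp add: has_sum_def)
  from has_sum_add[OF weak[OF u] has_sum_cmult_right[OF this, of "- 1"]]
  have "((\<lambda>i. c i * inner_L2 (p i) u - c i * inner_L2 (e i) u) has_sum inner_L2 u u) UNIV"
    using inner_L2_diff_left[OF f gL2 u] by (simp add: u_def[abs_def])
  then have sum_u: "((\<lambda>i. - (c i * inner_L2 (h i) u)) has_sum inner_L2 u u) UNIV"
    by (simp add: split[OF u] algebra_simps)
  have bound: "cmod (\<Sum>i\<in>T. - (c i * inner_L2 (h i) u)) \<le> sqrt (X * (Y * (norm_L2 u)\<^sup>2))" if T: "finite T" for T
  proof (rule real_le_rsqrt)
    have "cmod (\<Sum>i\<in>T. - (c i * inner_L2 (h i) u)) \<le> (\<Sum>i\<in>T. cmod (- (c i * inner_L2 (h i) u)))"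
      by (rule norm_sum)
    also have "\<dots> = (\<Sum>i\<in>T. cmod (c i) * cmod (inner_L2 u (h i)))"
    proof (intro sum.cong refl)
      fix i
      have "cmod (inner_L2 (h i) u) = cmod (inner_L2 u (h i))"
        by (metis complex_mod_cnj inner_L2_cnj)
      then show "cmod (- (c i * inner_L2 (h i) u)) = cmod (c i) * cmod (inner_L2 u (h i))"
        by (simp add: norm_mult)
    qed
    finally have "(cmod (\<Sum>i\<in>T. - (c i * inner_L2 (h i) u)))\<^sup>2
        \<le> (\<Sum>i\<in>T. cmod (c i) * cmod (inner_L2 u (h i)))\<^sup>2"
      by (intro power_mono) auto
    also have "\<dots> \<le> (\<Sum>i\<in>T. (cmod (c i))\<^sup>2) * (\<Sum>i\<in>T. (cmod (inner_L2 u (h i)))\<^sup>2)"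
      by (rule Cauchy_Schwarz_ineq_sum)
    also have "\<dots> \<le> X * (Y * (norm_L2 u)\<^sup>2)"
      using X0 by (intro mult_mono c h T u sum_nonneg) auto
    finally show "(cmod (\<Sum>i\<in>T. - (c i * inner_L2 (h i) u)))\<^sup>2 \<le> X * (Y * (norm_L2 u)\<^sup>2)" .
  qed
  have "cmod (inner_L2 u u) \<le> sqrt (X * (Y * (norm_L2 u)\<^sup>2))"
  proof (rule tendsto_upperbound[OF tendsto_norm[OF sum_u[unfolded has_sum_def]]])
    show "\<forall>\<^sub>F T in finite_subsets_at_top UNIV. cmod (\<Sum>i\<in>T. - (c i * inner_L2 (h i) u)) \<le> sqrt (X * (Y * (norm_L2 u)\<^sup>2))"
      unfolding eventually_finite_subsets_at_top using bound by (intro exI[of _ "{}"]) auto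
  qed simp
  then have "(norm_L2 u)\<^sup>2 \<le> sqrt (X * Y) * norm_L2 u"
    unfolding inner_L2_self by (simp add: real_sqrt_mult norm_power mult.assoc)
  then have le: "norm_L2 u * norm_L2 u \<le> sqrt (X * Y) * norm_L2 u" by (simp add: power2_eq_square)
  show ?thesis
  proof (cases "norm_L2 u = 0")
    case True
    have "0 \<le> X * Y" using X0 Y by simp
    then show ?thesis using True by (simp add: u_def[abs_def])
  next
    case False
    then have "norm_L2 u > 0" using norm_L2_nonneg[of u] by linarith
    with le have "norm_L2 u \<le> sqrt (X * Y)" by (rule mult_right_le_imp_le)
    then show ?thesis by (simp add: u_def[abs_def])
  qed
qed

text \<open>
  Here \<open>X0\<close> bounds the energy of the tail over all scales and \<open>b / N / (b A - X0)\<close> the coefficients.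
  Since \<open>2 b K < N\<close>, the periodized tail is at most \<open>1 + 1 / (2 \<sigma>)\<close> times its leading term, so that
  everything is controlled by \<open>X = 2 X0 (1 + 1 / (2 \<sigma>))\<close>, and \<open>\<epsilon>\<^sup>2 \<ge> 2 X\<close>. The last step is
  \<open>b A - X \<ge> (sqrt (b A) - sqrt X)\<^sup>2\<close>.
\<close>

lemma approx_eps_error_bound:
  fixes a b A C \<sigma> N :: real and K :: nat
  assumes a: "a > 1" and b: "b > 0" and A: "A > 0" and C: "C > 0" and \<sigma>: "\<sigma> > 0" and K: "K \<ge> 1"
    and N: "2 * b * real K < N" and eps: "approx_eps a b C \<sigma> K < sqrt (2 * b * A)"
  defines "X0 \<equiv> C * real K powr (- (1 + \<sigma>)) * (C * real K powr (- (1 + \<sigma>)) * (a powr (1 + \<sigma>) / (a powr (1 + \<sigma>) - 1)))"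
  shows "X0 < b * A"
    "sqrt (b / N / (b * A - X0) * tail_bound a (b / N) C (1 + \<sigma>) (real K))
      \<le> approx_eps a b C \<sigma> K / (sqrt (2 * b * A) - approx_eps a b C \<sigma> K)"
proof -
  define Q where "Q = a powr (1 + \<sigma>) / (a powr (1 + \<sigma>) - 1)"
  define y where "y = real K powr (1 + \<sigma>)"
  define \<epsilon> where "\<epsilon> = approx_eps a b C \<sigma> K"
  define X where "X = 2 * X0 * (1 + 1 / (2 * \<sigma>))"
  have ap: "a powr (1 + \<sigma>) > 1" using a \<sigma> by simp
  have Q: "Q > 0" unfolding Q_def using ap by (intro divide_pos_pos) linarith+
  have k: "real K > 0" using K by simp
  have y: "y > 0" using k by (simp add: y_def)
  have Km: "real K powr (- (1 + \<sigma>)) = 1 / y"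
    unfolding powr_minus y_def[symmetric] by (simp add: inverse_eq_divide)
  have X0_eq: "X0 = C\<^sup>2 * Q / y\<^sup>2"
    unfolding X0_def Q_def[symmetric] Km by (simp add: power2_eq_square)
  have X0: "X0 > 0" using C Q y by (simp add: X0_eq)
  have X: "X > 0" using X0 \<sigma> by (simp add: X_def add_pos_pos)
  have X0X: "X0 \<le> X"
  proof -
    have "X0 * 1 \<le> X0 * (2 * (1 + 1 / (2 * \<sigma>)))" using X0 \<sigma> by (intro mult_left_mono) auto
    then show ?thesis by (simp add: X_def mult_ac)
  qed
  have \<epsilon>0: "\<epsilon> \<ge> 0"
    unfolding \<epsilon>_def approx_eps_def Q_def[symmetric] using C Q b \<sigma>
    by (intro mult_nonneg_nonneg real_sqrt_ge_zero divide_nonneg_nonneg add_nonneg_nonneg) auto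
  have "real K powr (3 + 2 * \<sigma>) = real K powr (1 + ((1 + \<sigma>) + (1 + \<sigma>)))" by (simp add: algebra_simps)
  also have "\<dots> = real K powr 1 * (y * y)"
    by (simp only: powr_add[of _ 1 "(1 + \<sigma>) + (1 + \<sigma>)"] powr_add[of _ "1 + \<sigma>" "1 + \<sigma>"] y_def)
  also have "\<dots> = real K * y\<^sup>2" using k by (simp add: power2_eq_square)
  finally have K_pow: "real K powr (3 + 2 * \<sigma>) = real K * y\<^sup>2" .
  have eps2: "\<epsilon>\<^sup>2 = (real K + 1 / b) / (real K * y\<^sup>2) * (2 * C)\<^sup>2 * ((1 + 1 / (2 * \<sigma>)) * Q)"
  proof -
    have "0 \<le> (real K + 1 / b) / (real K * y\<^sup>2)" "0 \<le> (1 + 1 / (2 * \<sigma>)) * Q" using k b y Q \<sigma> by auto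
    then show ?thesis
      unfolding \<epsilon>_def approx_eps_def K_pow Q_def[symmetric] by (simp only: power_mult_distrib real_sqrt_pow2)
  qed
  have "2 * X \<le> \<epsilon>\<^sup>2"
  proof -
    have "2 * X = 1 / y\<^sup>2 * (2 * C)\<^sup>2 * ((1 + 1 / (2 * \<sigma>)) * Q)"
      by (simp add: X_def X0_eq power2_eq_square)
    also have "\<dots> \<le> (real K + 1 / b) / (real K * y\<^sup>2) * (2 * C)\<^sup>2 * ((1 + 1 / (2 * \<sigma>)) * Q)"
    proof (intro mult_right_mono)
      have "real K / (real K * y\<^sup>2) \<le> (real K + 1 / b) / (real K * y\<^sup>2)"
        using b k y by (intro divide_right_mono) auto
      then show "1 / y\<^sup>2 \<le> (real K + 1 / b) / (real K * y\<^sup>2)" using k by simp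
    qed (use Q \<sigma> in auto)
    finally show ?thesis by (simp add: eps2)
  qed
  then have "sqrt (2 * X) \<le> sqrt (\<epsilon>\<^sup>2)" by (rule real_sqrt_le_mono)
  then have xe: "sqrt 2 * sqrt X \<le> \<epsilon>" using \<epsilon>0 by (simp add: real_sqrt_mult)
  have root: "sqrt (2 * b * A) = sqrt 2 * sqrt (b * A)" by (simp add: real_sqrt_mult mult.assoc)
  have "sqrt 2 * sqrt X < sqrt 2 * sqrt (b * A)" using xe eps unfolding \<epsilon>_def root by linarith
  then have x_less: "sqrt X < sqrt (b * A)" by simp
  then have "X < b * A" by simp
  then show "X0 < b * A" using X0X by simp
  have N0: "N > 0" using N b k by (smt (verit) mult_pos_pos)
  have tail: "b / N * tail_bound a (b / N) C (1 + \<sigma>) (real K) \<le> X"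
  proof -
    have "real K powr (1 - (1 + \<sigma>)) = real K powr (1 + - (1 + \<sigma>))" by simp
    also have "\<dots> = real K powr 1 * real K powr (- (1 + \<sigma>))" by (rule powr_add)
    also have "\<dots> = real K * (1 / y)" unfolding Km using k by simp
    finally have Ks: "real K powr (1 - (1 + \<sigma>)) = real K * (1 / y)" .
    have bN: "b / N > 0" using b N0 by simp
    have "b / N * tail_bound a (b / N) C (1 + \<sigma>) (real K)
        = C * (2 * (1 / y + real K * (1 / y) / (1 / (b / N) * \<sigma>))) * (C * (1 / y) * Q)"
      unfolding tail_bound_def Ks Km Q_def[symmetric] using b N0 by simp
    also have "\<dots> = 2 * X0 * (1 + real K / (1 / (b / N) * \<sigma>))"
      using y by (simp add: X0_eq power2_eq_square field_simps)
    also have "real K / (1 / (b / N) * \<sigma>) = b * real K / N / \<sigma>" using b N0 \<sigma> by simp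
    also have "2 * X0 * (1 + b * real K / N / \<sigma>) \<le> 2 * X0 * (1 + 1 / 2 / \<sigma>)"
    proof (intro mult_left_mono add_left_mono divide_right_mono)
      show "b * real K / N \<le> 1 / 2" using N N0 by (simp add: field_simps)
    qed (use X0 \<sigma> in auto)
    finally show ?thesis by (simp add: X_def)
  qed
  have "b / N / (b * A - X0) * tail_bound a (b / N) C (1 + \<sigma>) (real K)
      = (b / N * tail_bound a (b / N) C (1 + \<sigma>) (real K)) / (b * A - X0)" by simp
  also have "\<dots> \<le> X / (b * A - X)"
    using tail X X0X \<open>X < b * A\<close> by (intro frac_le) auto
  also have "\<dots> \<le> X / (sqrt (b * A) - sqrt X)\<^sup>2"
  proof (intro divide_left_mono mult_pos_pos)
    have "sqrt X * sqrt X \<le> sqrt (b * A) * sqrt X" using x_less X by (intro mult_right_mono) auto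
    then show "(sqrt (b * A) - sqrt X)\<^sup>2 \<le> b * A - X"
      using X b A by (simp add: power2_diff mult.commute)
  qed (use X x_less \<open>X < b * A\<close> in auto)
  also have "\<dots> = (sqrt X / (sqrt (b * A) - sqrt X))\<^sup>2" using X by (simp add: power_divide)
  finally have "sqrt (b / N / (b * A - X0) * tail_bound a (b / N) C (1 + \<sigma>) (real K))
      \<le> sqrt X / (sqrt (b * A) - sqrt X)"
    using x_less X by (intro real_le_lsqrt) auto
  also have "\<dots> = sqrt 2 * sqrt X / (sqrt (2 * b * A) - sqrt 2 * sqrt X)"
    unfolding root right_diff_distrib[symmetric] by simp
  also have "\<dots> \<le> \<epsilon> / (sqrt (2 * b * A) - \<epsilon>)"
    using xe eps \<epsilon>0 by (intro frac_le) (auto simp: \<epsilon>_def)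
  finally show "sqrt (b / N / (b * A - X0) * tail_bound a (b / N) C (1 + \<sigma>) (real K))
      \<le> approx_eps a b C \<sigma> K / (sqrt (2 * b * A) - approx_eps a b C \<sigma> K)" by (simp add: \<epsilon>_def)
qed

section \<open>The dual generator\<close>

lemma AE_lborel_scale:
  assumes [measurable]: "{x::real. P x} \<in> sets borel" and c: "c \<noteq> 0" and P: "AE x in lborel. P x"
  shows "AE x in lborel. P (c * x)"
proof -
  have "AE x in density (distr lborel borel (\<lambda>x. 0 + c * x)) (\<lambda>_. ennreal \<bar>c\<bar>). P x"
    unfolding lborel_real_affine[OF c, of 0, symmetric] by (rule P)
  then have "AE x in distr lborel borel (\<lambda>x. 0 + c * x). P x"
    using c by (subst (asm) AE_density) auto
  then show ?thesis by (subst (asm) AE_distr_iff) auto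
qed

text \<open>
  The transform of the dual generator is the truncated transform \<open>\<Phi>\<close> times the dilation-invariant
  real weight \<open>(b / N) / \<Sum>j. |\<Phi>(\<gamma> / a\<^sup>j)|\<^sup>2\<close>, whichever representatives are chosen.
\<close>

lemma has_fourier_L2_dual_generator:
  assumes a: "a > 0" and \<Psi>: "has_fourier_L2 \<psi> \<Psi>"
    and \<Phi>_def: "\<Phi> = (\<lambda>\<gamma>. if \<bar>\<gamma>\<bar> \<le> real K then \<Psi> \<gamma> else 0)"
    and \<Theta>_def: "\<Theta> = (\<lambda>\<gamma>. complex_of_real (b / of_int N / scale_energy a \<Phi> \<gamma>) * \<Phi> \<gamma>)"
    and \<Theta>: "\<Theta> \<in> L2"
  shows "has_fourier_L2 (dual_generator a b N K \<psi>) \<Theta>"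
proof -
  have \<psi>: "\<psi> \<in> L2" and \<Psi>L2: "\<Psi> \<in> L2" using has_fourier_L2_D[OF \<Psi>] by auto
  have [measurable]: "\<Psi> \<in> borel_measurable borel" using \<Psi>L2 by (rule L2_measurable)
  define \<psi>h where "\<psi>h = fourier_L2 \<psi>"
  have \<psi>h: "has_fourier_L2 \<psi> \<psi>h" unfolding \<psi>h_def by (rule has_fourier_L2_fourier_L2[OF \<psi>])
  have \<psi>hL2: "\<psi>h \<in> L2" using has_fourier_L2_D[OF \<psi>h] by blast
  have \<psi>h_AE: "AE \<gamma> in lborel. \<psi>h \<gamma> = \<Psi> \<gamma>" by (rule has_fourier_L2_unique_AE[OF \<psi>h \<Psi>]) simp
  define \<phi>h where "\<phi>h = fourier_L2 (band_limit K \<psi>)"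
  have cutL2: "(\<lambda>\<gamma>. \<psi>h \<gamma> * indicator {- real K..real K} \<gamma>) \<in> L2"
    using L2_restrict[OF \<psi>hL2, of "{- real K..real K}"] by (simp add: mult.commute)
  have "band_limit K \<psi> \<in> L2"
    using has_fourier_L2_D[OF has_fourier_L2_inv_fourier_L2[OF cutL2]] by (simp add: band_limit_def \<psi>h_def)
  then have \<phi>hL2: "\<phi>h \<in> L2"
    unfolding \<phi>h_def using has_fourier_L2_D[OF has_fourier_L2_fourier_L2] by blast
  have [measurable]: "\<phi>h \<in> borel_measurable borel" using \<phi>hL2 by (rule L2_measurable)
  have [measurable]: "\<Phi> \<in> borel_measurable borel" unfolding \<Phi>_def by measurable
  have "AE \<gamma> in lborel. \<phi>h \<gamma> = \<psi>h \<gamma> * indicator {- real K..real K} \<gamma>"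
    using fourier_L2_inv_AE[OF cutL2] by (simp add: \<phi>h_def band_limit_def \<psi>h_def)
  with \<psi>h_AE have \<phi>h_AE: "AE \<gamma> in lborel. \<phi>h \<gamma> = \<Phi> \<gamma>"
    by eventually_elim (auto simp: \<Phi>_def indicator_def abs_le_iff)
  have "AE \<gamma> in lborel. \<phi>h (a powi k * \<gamma>) = \<Phi> (a powi k * \<gamma>)" for k
    using a by (intro AE_lborel_scale[where P="\<lambda>x. \<phi>h x = \<Phi> x"] \<phi>h_AE) auto
  then have all: "AE \<gamma> in lborel. \<forall>k. \<phi>h (a powi k * \<gamma>) = \<Phi> (a powi k * \<gamma>)"
    by (simp add: AE_all_countable)
  define \<Theta>0 where "\<Theta>0 \<gamma> = complex_of_real b * \<phi>h \<gamma> /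
    complex_of_real (of_int N * (\<Sum>\<^sub>\<infinity>k\<in>(UNIV :: int set). (cmod (\<phi>h (a powi k * \<gamma>)))\<^sup>2))" for \<gamma>
  have energy: "(\<Sum>\<^sub>\<infinity>k. (cmod (\<Phi> (a powi k * \<gamma>)))\<^sup>2) = scale_energy a \<Phi> \<gamma>" for \<gamma>
  proof -
    have "(\<Sum>\<^sub>\<infinity>k. (cmod (\<Phi> (a powi k * \<gamma>)))\<^sup>2) = (\<Sum>\<^sub>\<infinity>k. (cmod (\<Phi> (\<gamma> / a powi (- k))))\<^sup>2)"
      by (simp add: power_int_minus divide_inverse mult.commute)
    also have "\<dots> = scale_energy a \<Phi> \<gamma>"
      unfolding scale_energy_def by (rule infsum_reindex_bij_betw[OF bij_uminus])
    finally show ?thesis .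
  qed
  have \<Theta>_AE: "AE \<gamma> in lborel. \<Theta>0 \<gamma> = \<Theta> \<gamma>"
    using \<phi>h_AE all
  proof eventually_elim
    case (elim \<gamma>)
    then show ?case by (simp add: \<Theta>0_def \<Theta>_def energy)
  qed
  have meas [measurable]: "\<Theta>0 \<in> borel_measurable borel"
  proof -
    have [measurable]: "(\<lambda>\<gamma>. \<Sum>\<^sub>\<infinity>k\<in>(UNIV :: int set). (cmod (\<phi>h (a powi k * \<gamma>)))\<^sup>2) \<in> borel_measurable borel"
      by (rule infsum_int_measurable) auto
    show ?thesis unfolding \<Theta>0_def[abs_def] by measurable
  qed
  have "\<Theta>0 \<in> L2" by (rule L2_dominated[OF \<Theta> meas]) (use \<Theta>_AE in auto)
  from has_fourier_L2_inv_fourier_L2[OF this]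
  have dual: "has_fourier_L2 (dual_generator a b N K \<psi>) \<Theta>0"
    by (simp add: dual_generator_def \<Theta>0_def[abs_def] \<phi>h_def)
  have "dual_generator a b N K \<psi> \<in> L2" using has_fourier_L2_D[OF dual] by blast
  with \<Theta> \<Theta>_AE show ?thesis
    by (intro has_fourier_L2_cong_AE[OF dual]) (auto intro: L2_measurable)
qed

section \<open>The approximate reconstruction formula\<close>

theorem theorem3p2:
  fixes a b A C \<sigma> :: real and \<psi> :: "real \<Rightarrow> complex" and K :: nat and N :: int
  assumes "a > 1" and "b > 0"
    and "\<psi> \<in> L2"
    and "A > 0"
    and "\<exists>B>0. frame_with_bounds_L2 (wavelet_system a b \<psi>) UNIV A B"
    and "C > 0" and "\<sigma> > 0"
    and "AE \<gamma> in lborel. cmod (fourier_L2 \<psi> \<gamma>) \<le> C / (1 + \<bar>\<gamma>\<bar> powr (1 + \<sigma>))"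
    and "K \<ge> 1"
    and "odd N" and "real_of_int N - 2 \<le> 2 * b * real K" and "2 * b * real K < real_of_int N"
    and "approx_eps a b C \<sigma> K < sqrt (2 * b * A)"
  shows "\<forall>f\<in>L2. \<exists>g.
    has_sum_L2
      (\<lambda>i x. inner_L2 f (wavelet_system a (b / real_of_int N) (dual_generator a b N K \<psi>) i)
              * wavelet_system a (b / real_of_int N) \<psi> i x)
      UNIV g \<and>
    norm_L2 (\<lambda>x. f x - g x)
      \<le> approx_eps a b C \<sigma> K / (sqrt (2 * b * A) - approx_eps a b C \<sigma> K) * norm_L2 f"
proof
  fix f assume f: "f \<in> L2"
  note a = \<open>a > 1\<close> and b = \<open>b > 0\<close>
  have a0: "a > 0" using a by simp
  define p where "p = 1 + \<sigma>"
  have p: "p > 1" using \<open>\<sigma> > 0\<close> by (simp add: p_def)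
  have C: "C \<ge> 0" using \<open>C > 0\<close> by simp
  have k: "real K > 0" using \<open>K \<ge> 1\<close> by simp
  have "0 < 2 * b * real K" using b k by simp
  then have N: "real_of_int N > 0" using \<open>2 * b * real K < real_of_int N\<close> by linarith
  define \<beta> where "\<beta> = b / real_of_int N"
  have \<beta>: "\<beta> > 0" using b N by (simp add: \<beta>_def)
  obtain B where B: "B > 0" and fr: "frame_with_bounds_L2 (wavelet_system a b \<psi>) UNIV A B"
    using assms(5) by blast

  \<comment> \<open>a representative of the transform for which the decay condition holds everywhere\<close>
  define \<psi>h where "\<psi>h = fourier_L2 \<psi>"
  have \<psi>h: "has_fourier_L2 \<psi> \<psi>h" unfolding \<psi>h_def by (rule has_fourier_L2_fourier_L2[OF \<open>\<psi> \<in> L2\<close>])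
  have \<psi>h_meas [measurable]: "\<psi>h \<in> borel_measurable borel"
    using has_fourier_L2_D[OF \<psi>h] by (auto intro: L2_measurable)
  define \<Psi> where "\<Psi> \<gamma> = (if cmod (\<psi>h \<gamma>) \<le> C / (1 + \<bar>\<gamma>\<bar> powr p) then \<psi>h \<gamma> else 0)" for \<gamma>
  have \<Psi>_meas [measurable]: "\<Psi> \<in> borel_measurable borel" unfolding \<Psi>_def[abs_def] by measurable
  have \<Psi>: "has_fourier_L2 \<psi> \<Psi>"
  proof (rule has_fourier_L2_cong_AE[OF \<psi>h _ _ \<Psi>_meas])
    show "AE \<gamma> in lborel. \<psi>h \<gamma> = \<Psi> \<gamma>"
      using assms(8) by eventually_elim (simp add: \<Psi>_def \<psi>h_def p_def)
  qed (use L2_measurable[OF \<open>\<psi> \<in> L2\<close>] in auto)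
  have \<Psi>L2: "\<Psi> \<in> L2" using has_fourier_L2_D[OF \<Psi>] by blast
  have \<Psi>_le: "cmod (\<Psi> x) \<le> C / (1 + \<bar>x\<bar> powr p)" for x
    using C by (auto simp: \<Psi>_def intro!: divide_nonneg_nonneg add_nonneg_nonneg)
  have bnd: "cmod (\<Psi> x) \<le> C" for x
  proof -
    have "C / (1 + \<bar>x\<bar> powr p) \<le> C / 1"
      using C by (intro divide_left_mono) (auto intro!: add_pos_nonneg)
    then show ?thesis using \<Psi>_le[of x] by simp
  qed
  have decay: "cmod (\<Psi> x) \<le> C * \<bar>x\<bar> powr (- p)" if "x \<noteq> 0" for x
  proof -
    have "C / (1 + \<bar>x\<bar> powr p) \<le> C / (\<bar>x\<bar> powr p)"
      using C that by (intro divide_left_mono) (auto intro!: mult_pos_pos add_pos_nonneg)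
    then show ?thesis using \<Psi>_le[of x] by (simp add: powr_minus divide_inverse)
  qed
  note frame = frame_freq_system[OF fr \<Psi> a0]
  have energy_upper: "AE \<gamma> in lborel. \<forall>J. finite J \<longrightarrow> (\<Sum>j\<in>J. (cmod (\<Psi> (\<gamma> / a powi j)))\<^sup>2) \<le> b * B"
    by (rule frame_upper_energy[OF a b \<Psi>L2 bnd frame(1,3)])
  have energy_lower: "AE \<gamma> in lborel. b * A \<le> scale_energy a \<Psi> \<gamma>"
    by (rule frame_lower_energy[OF a b p C \<Psi>L2 bnd decay frame(1,2) energy_upper])

  \<comment> \<open>the band-limited part, the tail, and their energies\<close>
  define \<Phi> where "\<Phi> = (\<lambda>\<gamma>. if \<bar>\<gamma>\<bar> \<le> real K then \<Psi> \<gamma> else 0)"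
  define H where "H = (\<lambda>\<gamma>. if \<bar>\<gamma>\<bar> \<le> real K then 0 else \<Psi> \<gamma>)"
  have \<Phi>L2: "\<Phi> \<in> L2" by (rule L2_dominated[OF \<Psi>L2]) (auto simp: \<Phi>_def)
  have HL2: "H \<in> L2" by (rule L2_dominated[OF \<Psi>L2]) (auto simp: H_def)
  have [measurable]: "\<Phi> \<in> borel_measurable borel" using \<Phi>L2 by (rule L2_measurable)
  have \<Phi>_bnd: "cmod (\<Phi> x) \<le> C" for x using bnd C by (simp add: \<Phi>_def)
  have \<Phi>_supp: "\<Phi> x = 0" if "\<bar>x\<bar> > real K" for x using that by (simp add: \<Phi>_def)
  have H_decay: "cmod (H x) \<le> C * \<bar>x\<bar> powr (- p)" if "\<bar>x\<bar> > real K" for x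
    using decay[of x] that k by (auto simp: H_def)
  have H_zero: "H x = 0" if "\<bar>x\<bar> \<le> real K" for x using that by (simp add: H_def)
  have energy_\<Phi>: "AE \<gamma> in lborel. \<forall>J. finite J \<longrightarrow> (\<Sum>j\<in>J. (cmod (\<Phi> (\<gamma> / a powi j)))\<^sup>2) \<le> b * B"
    using energy_upper
  proof (eventually_elim, intro allI impI)
    fix \<gamma> and J :: "int set"
    assume *: "\<forall>J. finite J \<longrightarrow> (\<Sum>j\<in>J. (cmod (\<Psi> (\<gamma> / a powi j)))\<^sup>2) \<le> b * B" and "finite J"
    have "(\<Sum>j\<in>J. (cmod (\<Phi> (\<gamma> / a powi j)))\<^sup>2) \<le> (\<Sum>j\<in>J. (cmod (\<Psi> (\<gamma> / a powi j)))\<^sup>2)"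
      by (intro sum_mono power_mono) (auto simp: \<Phi>_def)
    then show "(\<Sum>j\<in>J. (cmod (\<Phi> (\<gamma> / a powi j)))\<^sup>2) \<le> b * B" using * \<open>finite J\<close> by force
  qed
  define M where "M = C * real K powr (- p)"
  define X0 where "X0 = M * (M * (a powr p / (a powr p - 1)))"
  have M: "M \<ge> 0" using C by (simp add: M_def)
  have H_energy: "(\<Sum>j\<in>J. (cmod (H (\<gamma> / a powi j)))\<^sup>2) \<le> X0" if "finite J" for \<gamma> J
  proof -
    have HM: "cmod (H x) \<le> M" for x
    proof (cases "\<bar>x\<bar> > real K")
      case True
      have "\<bar>x\<bar> powr (- p) \<le> real K powr (- p)" using True k p by (intro powr_mono2') auto
      then have "C * \<bar>x\<bar> powr (- p) \<le> M" unfolding M_def using C by (rule mult_left_mono)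
      then show ?thesis using H_decay[OF True] by linarith
    qed (use M H_zero in auto)
    have "(\<Sum>j\<in>J. (cmod (H (\<gamma> / a powi j)))\<^sup>2) \<le> (\<Sum>j\<in>J. M * cmod (H (\<gamma> / a powi j)))"
      unfolding power2_eq_square using HM by (intro sum_mono mult_right_mono) auto
    also have "\<dots> = M * (\<Sum>j\<in>J. cmod (H (\<gamma> / a powi j)))" by (simp add: sum_distrib_left)
    also have "\<dots> \<le> M * (M * (a powr p / (a powr p - 1)))"
      using tail_dilation_sum_le[OF a _ k that C, of p "\<lambda>x. cmod (H x)"] p H_decay H_zero M
      by (intro mult_left_mono) (auto simp: M_def)
    finally show ?thesis by (simp add: X0_def)
  qed
  \<comment> \<open>\<open>\<Phi>\<close> and \<open>H\<close> have disjoint supports, so the energies add up to at least \<open>b A\<close>\<close>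
  define S where "S = scale_energy a \<Phi>"
  have [measurable]: "S \<in> borel_measurable borel" unfolding S_def by measurable
  define \<kappa> where "\<kappa> = b * A - X0"
  note eps = approx_eps_error_bound[OF a b \<open>A > 0\<close> \<open>C > 0\<close> \<open>\<sigma> > 0\<close> \<open>K \<ge> 1\<close> assms(12,13)]
  have X0_eq: "X0 = C * real K powr (- (1 + \<sigma>)) * (C * real K powr (- (1 + \<sigma>)) * (a powr (1 + \<sigma>) / (a powr (1 + \<sigma>) - 1)))"
    by (simp add: X0_def M_def p_def)
  have \<kappa>: "\<kappa> > 0" using eps(1) by (simp add: \<kappa>_def X0_eq)
  have S_bounds: "AE \<gamma> in lborel. \<kappa> \<le> S \<gamma> \<and> S \<gamma> \<le> b * B"
    using energy_lower energy_upper energy_\<Phi>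
  proof eventually_elim
    case (elim \<gamma>)
    have summ: "(\<lambda>j. (cmod (\<Psi> (\<gamma> / a powi j)))\<^sup>2) summable_on UNIV" "(\<lambda>j. (cmod (\<Phi> (\<gamma> / a powi j)))\<^sup>2) summable_on UNIV"
      using elim(2,3) by (auto intro: scale_energy_summable(1))
    have "scale_energy a \<Psi> \<gamma> \<le> S \<gamma> + X0"
      unfolding scale_energy_def[of a \<Psi>]
    proof (rule infsum_le_finite_sums[OF summ(1)])
      fix J :: "int set" assume J: "finite J"
      have "(\<Sum>j\<in>J. (cmod (\<Psi> (\<gamma> / a powi j)))\<^sup>2)
          = (\<Sum>j\<in>J. (cmod (\<Phi> (\<gamma> / a powi j)))\<^sup>2) + (\<Sum>j\<in>J. (cmod (H (\<gamma> / a powi j)))\<^sup>2)"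
        unfolding sum.distrib[symmetric] by (intro sum.cong refl) (auto simp: \<Phi>_def H_def)
      moreover have "(\<Sum>j\<in>J. (cmod (\<Phi> (\<gamma> / a powi j)))\<^sup>2) \<le> S \<gamma>"
        unfolding S_def scale_energy_def by (rule finite_sum_le_infsum[OF summ(2) J]) auto
      ultimately show "(\<Sum>j\<in>J. (cmod (\<Psi> (\<gamma> / a powi j)))\<^sup>2) \<le> S \<gamma> + X0"
        using H_energy[OF J, of \<gamma>] by linarith
    qed
    then show ?case using elim(1,3) scale_energy_summable(2)[of \<Phi> \<gamma> a "b * B"] by (simp add: \<kappa>_def S_def)
  qed
  have S_abs: "AE \<gamma> in lborel. \<bar>S \<gamma>\<bar> \<le> b * B" using S_bounds by eventually_elim (use \<kappa> in auto)

  \<comment> \<open>the analysis coefficients are those of the weighted transform with respect to \<open>\<Phi>\<close>\<close>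
  define q where "q \<gamma> = \<beta> / S \<gamma>" for \<gamma>
  have [measurable]: "q \<in> borel_measurable borel" unfolding q_def[abs_def] by measurable
  have q_bound: "AE \<gamma> in lborel. cmod (complex_of_real (q \<gamma>)) \<le> \<beta> / \<kappa>"
    using S_bounds
  proof eventually_elim
    case (elim \<gamma>)
    then have "0 < S \<gamma>" using \<kappa> by linarith
    then show ?case using elim \<beta> \<kappa> by (simp add: q_def norm_divide frac_le)
  qed
  define \<Theta> where "\<Theta> = (\<lambda>\<gamma>. complex_of_real (b / of_int N / scale_energy a \<Phi> \<gamma>) * \<Phi> \<gamma>)"
  have \<Theta>_q: "\<Theta> \<gamma> = complex_of_real (q \<gamma>) * \<Phi> \<gamma>" for \<gamma> by (simp add: \<Theta>_def q_def \<beta>_def S_def)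
  have \<Theta>L2: "\<Theta> \<in> L2"
    unfolding \<Theta>_q[abs_def] by (rule L2_bounded_mult[OF \<Phi>L2 _ q_bound]) measurable
  have \<Theta>: "has_fourier_L2 (dual_generator a b N K \<psi>) \<Theta>"
    by (rule has_fourier_L2_dual_generator[OF a0 \<Psi> \<Phi>_def \<Theta>_def \<Theta>L2])
  obtain F where F: "has_fourier_L2 f F" using has_fourier_L2_exists[OF f] by blast
  have FL2: "F \<in> L2" using has_fourier_L2_D[OF F] by blast
  have [measurable]: "F \<in> borel_measurable borel" using FL2 by (rule L2_measurable)
  define qF where "qF \<gamma> = complex_of_real (q \<gamma>) * F \<gamma>" for \<gamma>
  have qFL2: "qF \<in> L2" unfolding qF_def[abs_def] by (rule L2_bounded_mult[OF FL2 _ q_bound]) measurable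
  define c where "c i = inner_L2 f (wavelet_system a \<beta> (dual_generator a b N K \<psi>) i)" for i
  have c_eq: "c i = inner_L2 qF (freq_system a \<beta> \<Phi> i)" for i
  proof -
    obtain j m where i: "i = (j, m)" by fastforce
    have "q (\<gamma> / a powi j) = q \<gamma>" for \<gamma> by (simp add: q_def S_def scale_energy_dilate[OF a0])
    then have "F \<gamma> * cnj (freq_system a \<beta> \<Theta> i \<gamma>) = qF \<gamma> * cnj (freq_system a \<beta> \<Phi> i \<gamma>)" for \<gamma>
      by (simp add: i freq_system_def qF_def \<Theta>_q)
    moreover have "c i = inner_L2 F (freq_system a \<beta> \<Theta> i)"
      unfolding c_def using has_fourier_L2_inner[OF F has_fourier_L2_wavelet_system[OF \<Theta> a0]] by simp
    ultimately show ?thesis by (simp add: inner_L2_def)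
  qed
  have no_overlap: "2 * real K \<le> 1 / \<beta>" using assms(12) b N by (simp add: \<beta>_def field_simps)
  have band: "((\<lambda>i. (cmod (inner_L2 U (freq_system a \<beta> \<Phi> i)))\<^sup>2) has_sum
      1 / \<beta> * (LINT \<gamma>|lborel. (cmod (U \<gamma>))\<^sup>2 * S \<gamma>)) UNIV" if "U \<in> L2" for U
    unfolding S_def
    by (rule band_system_energy[OF a \<beta> \<Phi>L2 \<Phi>_bnd _ no_overlap energy_\<Phi> that]) (rule \<Phi>_supp)
  have c_sum: "((\<lambda>i. (cmod (c i))\<^sup>2) has_sum 1 / \<beta> * (LINT \<gamma>|lborel. (cmod (qF \<gamma>))\<^sup>2 * S \<gamma>)) UNIV"
    using band[OF qFL2] by (simp only: c_eq)
  have "(LINT \<gamma>|lborel. (cmod (qF \<gamma>))\<^sup>2 * S \<gamma>) \<le> (LINT \<gamma>|lborel. \<beta>\<^sup>2 / \<kappa> * (cmod (F \<gamma>))\<^sup>2)"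
  proof (rule integral_mono_AE)
    show "integrable lborel (\<lambda>\<gamma>. (cmod (qF \<gamma>))\<^sup>2 * S \<gamma>)"
      by (rule integrable_square_mult_bounded[OF qFL2 _ S_abs]) measurable
    show "integrable lborel (\<lambda>\<gamma>. \<beta>\<^sup>2 / \<kappa> * (cmod (F \<gamma>))\<^sup>2)" using L2_integrable_square[OF FL2] by simp
    show "AE \<gamma> in lborel. (cmod (qF \<gamma>))\<^sup>2 * S \<gamma> \<le> \<beta>\<^sup>2 / \<kappa> * (cmod (F \<gamma>))\<^sup>2"
      using S_bounds
    proof eventually_elim
      case (elim \<gamma>)
      then have S0: "S \<gamma> > 0" using \<kappa> by linarith
      have "(cmod (qF \<gamma>))\<^sup>2 * S \<gamma> = \<beta>\<^sup>2 / S \<gamma> * (cmod (F \<gamma>))\<^sup>2"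
        using S0 \<beta> by (simp add: qF_def q_def norm_mult norm_divide power_mult_distrib power_divide power2_eq_square)
      also have "\<dots> \<le> \<beta>\<^sup>2 / \<kappa> * (cmod (F \<gamma>))\<^sup>2"
        using elim \<kappa> by (intro mult_right_mono divide_left_mono) auto
      finally show ?case .
    qed
  qed
  also have "\<dots> = \<beta>\<^sup>2 / \<kappa> * (norm_L2 f)\<^sup>2"
    by (simp add: norm_L2_square[symmetric] has_fourier_L2_norm[OF F])
  finally have "1 / \<beta> * (LINT \<gamma>|lborel. (cmod (qF \<gamma>))\<^sup>2 * S \<gamma>) \<le> 1 / \<beta> * (\<beta>\<^sup>2 / \<kappa> * (norm_L2 f)\<^sup>2)"
    using \<beta> by (intro mult_left_mono) auto
  also have "\<dots> = \<beta> / \<kappa> * (norm_L2 f)\<^sup>2" using \<beta> by (simp add: power2_eq_square)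
  finally have total_le: "1 / \<beta> * (LINT \<gamma>|lborel. (cmod (qF \<gamma>))\<^sup>2 * S \<gamma>) \<le> \<beta> / \<kappa> * (norm_L2 f)\<^sup>2" .
  have c_le: "(\<Sum>i\<in>T. (cmod (c i))\<^sup>2) \<le> \<beta> / \<kappa> * (norm_L2 f)\<^sup>2" if "finite T" for T
    by (rule order_trans[OF finite_sum_le_has_sum[OF c_sum that] total_le]) auto

  \<comment> \<open>the systems generated by \<open>\<psi>\<close>, by its band-limited part and by the tail\<close>
  obtain \<phi> \<eta> where \<phi>: "has_fourier_L2 \<phi> \<Phi>" and \<eta>: "has_fourier_L2 \<eta> H"
    using has_fourier_L2_surj[OF \<Phi>L2] has_fourier_L2_surj[OF HL2] by blast
  define e where "e = wavelet_system a \<beta> \<psi>"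
  define P where "P = wavelet_system a \<beta> \<phi>"
  define h where "h = wavelet_system a \<beta> \<eta>"
  have e: "has_fourier_L2 (e i) (freq_system a \<beta> \<Psi> i)" for i
    unfolding e_def by (rule has_fourier_L2_wavelet_system[OF \<Psi> a0])
  have P: "has_fourier_L2 (P i) (freq_system a \<beta> \<Phi> i)" for i
    unfolding P_def by (rule has_fourier_L2_wavelet_system[OF \<phi> a0])
  have h: "has_fourier_L2 (h i) (freq_system a \<beta> H i)" for i
    unfolding h_def by (rule has_fourier_L2_wavelet_system[OF \<eta> a0])
  have eL2: "e i \<in> L2" and PL2: "P i \<in> L2" and hL2: "h i \<in> L2" for i
    using has_fourier_L2_D e P h by blast+
  have split: "inner_L2 (e i) u = inner_L2 (P i) u + inner_L2 (h i) u" if u: "u \<in> L2" for i u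
  proof -
    obtain U where U: "has_fourier_L2 u U" using has_fourier_L2_exists[OF u] by blast
    have UL2: "U \<in> L2" using has_fourier_L2_D[OF U] by blast
    have "freq_system a \<beta> \<Psi> i \<gamma> = freq_system a \<beta> \<Phi> i \<gamma> + freq_system a \<beta> H i \<gamma>" for \<gamma>
      by (cases i) (simp add: freq_system_def \<Phi>_def H_def)
    then have "inner_L2 (freq_system a \<beta> \<Psi> i) U
        = inner_L2 (\<lambda>\<gamma>. freq_system a \<beta> \<Phi> i \<gamma> + freq_system a \<beta> H i \<gamma>) U" by (simp add: inner_L2_def)
    then show ?thesis
      using has_fourier_L2_inner[OF e U] has_fourier_L2_inner[OF P U] has_fourier_L2_inner[OF h U]
        inner_L2_add_left[OF freq_system_L2[OF \<Phi>L2 a0] freq_system_L2[OF HL2 a0] UL2] by simp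
  qed
  define Y where "Y = tail_bound a \<beta> C p (real K)"
  have Y: "0 \<le> Y" unfolding Y_def by (rule tail_bound_nonneg[OF a \<beta> p C])
  have h_Bessel: "(\<Sum>i\<in>T. (cmod (inner_L2 u (h i)))\<^sup>2) \<le> Y * (norm_L2 u)\<^sup>2"
    if u: "u \<in> L2" and T: "finite T" for u T
  proof -
    obtain U where U: "has_fourier_L2 u U" using has_fourier_L2_exists[OF u] by blast
    have UL2: "U \<in> L2" using has_fourier_L2_D[OF U] by blast
    have "inner_L2 u (h i) = inner_L2 U (freq_system a \<beta> H i)" for i
      using has_fourier_L2_inner[OF U h] by simp
    then show ?thesis
      using tail_system_Bessel[OF a \<beta> p k C HL2 UL2 T H_decay H_zero] has_fourier_L2_norm[OF U]
      by (simp add: Y_def)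
  qed
  have P_Bessel: "(\<Sum>i\<in>T. (cmod (inner_L2 u (P i)))\<^sup>2) \<le> b * B / \<beta> * (norm_L2 u)\<^sup>2"
    if u: "u \<in> L2" and T: "finite T" for u T
  proof -
    obtain U where U: "has_fourier_L2 u U" using has_fourier_L2_exists[OF u] by blast
    have UL2: "U \<in> L2" using has_fourier_L2_D[OF U] by blast
    have "(\<Sum>i\<in>T. (cmod (inner_L2 u (P i)))\<^sup>2) = (\<Sum>i\<in>T. (cmod (inner_L2 U (freq_system a \<beta> \<Phi> i)))\<^sup>2)"
      using has_fourier_L2_inner[OF U P] by simp
    also have "\<dots> \<le> 1 / \<beta> * (LINT \<gamma>|lborel. (cmod (U \<gamma>))\<^sup>2 * S \<gamma>)"
      by (rule finite_sum_le_has_sum[OF band[OF UL2] T]) auto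
    also have "\<dots> \<le> 1 / \<beta> * (LINT \<gamma>|lborel. b * B * (cmod (U \<gamma>))\<^sup>2)"
    proof (intro mult_left_mono integral_mono_AE)
      show "integrable lborel (\<lambda>\<gamma>. (cmod (U \<gamma>))\<^sup>2 * S \<gamma>)"
        by (rule integrable_square_mult_bounded[OF UL2 _ S_abs]) measurable
      show "AE \<gamma> in lborel. (cmod (U \<gamma>))\<^sup>2 * S \<gamma> \<le> b * B * (cmod (U \<gamma>))\<^sup>2"
        using S_bounds by eventually_elim (subst mult.commute, rule mult_right_mono, auto)
    qed (use L2_integrable_square[OF UL2] \<beta> in auto)
    also have "\<dots> = b * B / \<beta> * (norm_L2 u)\<^sup>2"
      by (simp add: norm_L2_square[symmetric] has_fourier_L2_norm[OF U])
    finally show ?thesis .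
  qed
  have e_Bessel: "(\<Sum>i\<in>T. (cmod (inner_L2 u (e i)))\<^sup>2) \<le> (2 * (b * B / \<beta>) + 2 * Y) * (norm_L2 u)\<^sup>2"
    if u: "u \<in> L2" and T: "finite T" for u T
  proof -
    have "inner_L2 u (e i) = inner_L2 u (P i) + inner_L2 u (h i)" for i
      using arg_cong[OF split[OF u, of i], of cnj] by (simp add: inner_L2_cnj)
    then have "(\<Sum>i\<in>T. (cmod (inner_L2 u (e i)))\<^sup>2)
        \<le> (\<Sum>i\<in>T. 2 * (cmod (inner_L2 u (P i)))\<^sup>2 + 2 * (cmod (inner_L2 u (h i)))\<^sup>2)"
      by (intro sum_mono) (simp add: cmod_add_square_le)
    also have "\<dots> = 2 * (\<Sum>i\<in>T. (cmod (inner_L2 u (P i)))\<^sup>2) + 2 * (\<Sum>i\<in>T. (cmod (inner_L2 u (h i)))\<^sup>2)"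
      by (simp add: sum.distrib sum_distrib_left)
    also have "\<dots> \<le> (2 * (b * B / \<beta>) + 2 * Y) * (norm_L2 u)\<^sup>2"
      using P_Bessel[OF u T] h_Bessel[OF u T] unfolding distrib_right mult.assoc[of 2] by linarith
    finally show ?thesis .
  qed

  \<comment> \<open>the weight \<open>q\<close> inverts the frame operator of the band-limited system\<close>
  have weak: "((\<lambda>i. c i * inner_L2 (P i) u) has_sum inner_L2 f u) UNIV" if u: "u \<in> L2" for u
  proof -
    obtain U where U: "has_fourier_L2 u U" using has_fourier_L2_exists[OF u] by blast
    have UL2: "U \<in> L2" using has_fourier_L2_D[OF U] by blast
    have [measurable]: "U \<in> borel_measurable borel" using UL2 by (rule L2_measurable)
    have "((\<lambda>i. inner_L2 qF (freq_system a \<beta> \<Phi> i) * cnj (inner_L2 U (freq_system a \<beta> \<Phi> i))) has_sum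
        of_real (1 / \<beta>) * (LINT \<gamma>|lborel. qF \<gamma> * cnj (U \<gamma>) * of_real (S \<gamma>))) UNIV"
      by (rule weighted_polarization[OF freq_system_L2[OF \<Phi>L2 a0] _ S_abs band qFL2 UL2]) measurable
    moreover have "inner_L2 qF (freq_system a \<beta> \<Phi> i) * cnj (inner_L2 U (freq_system a \<beta> \<Phi> i)) = c i * inner_L2 (P i) u" for i
      using has_fourier_L2_inner[OF P U] by (simp add: c_eq inner_L2_cnj)
    moreover have "(LINT \<gamma>|lborel. qF \<gamma> * cnj (U \<gamma>) * of_real (S \<gamma>)) = (LINT \<gamma>|lborel. of_real \<beta> * (F \<gamma> * cnj (U \<gamma>)))"
    proof (rule integral_cong_AE)
      show "AE \<gamma> in lborel. qF \<gamma> * cnj (U \<gamma>) * of_real (S \<gamma>) = of_real \<beta> * (F \<gamma> * cnj (U \<gamma>))"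
        using S_bounds
      proof eventually_elim
        case (elim \<gamma>)
        then have "S \<gamma> \<noteq> 0" using \<kappa> by linarith
        then show ?case by (simp add: qF_def q_def)
      qed
    qed (use qFL2 in measurable)
    then have "of_real (1 / \<beta>) * (LINT \<gamma>|lborel. qF \<gamma> * cnj (U \<gamma>) * of_real (S \<gamma>)) = inner_L2 f u"
      using \<beta> has_fourier_L2_inner[OF F U] by (simp add: inner_L2_def)
    ultimately show ?thesis by simp
  qed
  have "(\<lambda>i. (cmod (c i))\<^sup>2) summable_on UNIV" using c_sum by (auto simp: summable_on_def)
  moreover have "0 \<le> 2 * (b * B / \<beta>) + 2 * Y" using B b \<beta> Y by simp
  ultimately obtain g where g: "has_sum_L2 (\<lambda>i x. c i * e i x) UNIV g"
    using Bessel_synthesis[OF eL2 _ e_Bessel] by blast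
  have "norm_L2 (\<lambda>x. f x - g x) \<le> sqrt (\<beta> / \<kappa> * (norm_L2 f)\<^sup>2 * Y)"
    by (rule perturbed_expansion_error[OF eL2 f Y g split weak c_le h_Bessel])
  also have "\<dots> = sqrt (\<beta> / \<kappa> * Y) * norm_L2 f"
  proof -
    have "\<beta> / \<kappa> * (norm_L2 f)\<^sup>2 * Y = \<beta> / \<kappa> * Y * (norm_L2 f)\<^sup>2" by simp
    then show ?thesis by (simp only: real_sqrt_mult real_sqrt_abs abs_of_nonneg norm_L2_nonneg)
  qed
  also have "\<dots> \<le> approx_eps a b C \<sigma> K / (sqrt (2 * b * A) - approx_eps a b C \<sigma> K) * norm_L2 f"
    using eps(2) by (intro mult_right_mono) (simp_all add: \<beta>_def \<kappa>_def Y_def X0_eq p_def)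
  finally show "\<exists>g. has_sum_L2
      (\<lambda>i x. inner_L2 f (wavelet_system a (b / real_of_int N) (dual_generator a b N K \<psi>) i)
              * wavelet_system a (b / real_of_int N) \<psi> i x) UNIV g \<and>
    norm_L2 (\<lambda>x. f x - g x)
      \<le> approx_eps a b C \<sigma> K / (sqrt (2 * b * A) - approx_eps a b C \<sigma> K) * norm_L2 f"
    using g by (intro exI[of _ g]) (simp add: c_def e_def \<beta>_def)
qed

end
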